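(* Let $T>0$, let $(u_0,v_0)$ be LEFM initial data and $b\in C^1([0,T];L^2(D))$. Let $\epsilon_j=2^{-j}$, $j=1,2,\dots$, and let $u^{\epsilon_j}$ be the corresponding peridynamic evolutions, all with the same data $(u_0,v_0)$ and $b$. For $\delta>0$ and $t\in[0,T]$ let $$C_{\delta,t}=\Big\{x\in D:\ \exists\,\epsilon_j<\delta \text{ with } P\big(\{y\in\mathcal H_{\epsilon_j}(x):|u^{\epsilon_j}(t,y)-u^{\epsilon_j}(t,x)|>\overline\eta\}\big)>\sqrt{\epsilon_j}\Big\},\qquad C_{0,t}=\bigcap_{\delta>0}C_{\delta,t}.$$ Then $C_{\delta,t}$ is decreasing as $\delta\to0$, and there is a positive constant $C$ independent of $t$ and $\delta$ such that $$|C_{\delta,t}|\le C\sqrt\delta\qquad\text{for } 0\le t\le T.$$ Moreover $C_{0,t}$ is a set of Lebesgue measure zero and $$\lim_{\delta\to0}|C_{\delta,t}|=|C_{0,t}|=0 .$$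
   Context: $|S|$ denotes the two-dimensional Lebesgue measure. $D\subset\mathbb{R}^2$ is a bounded convex domain, $\alpha$ is a fixed number larger than all horizons $\epsilon$ considered, $D_\alpha=\{x:\mathrm{dist}(x,D)<\alpha\}$, and $L^2_0(D)$ is the space of functions that are square integrable over $D$ and zero on $D_\alpha\setminus D$. $\mathcal H_\epsilon(x)$ is the disk of radius $\epsilon$ centered at $x$. The mass density $\rho>0$ is constant. The influence function $J$ satisfies $0\le J(r)<M$ for $0\le r\le 1$ and $J(r)=0$ for $r>1$. The function $f:[0,\infty)\to\mathbb{R}$ is positive (on $(0,\infty)$), smooth and concave, with $\lim_{r\to0^+}f(r)/r=f'(0)>0$ and $\lim_{r\to\infty}f(r)=f_\infty<\infty$. The map $r\mapsto f(r^2)$ on $[0,\infty)$ is convex-concave with inflection point $\overline r>0$. Define $W^\epsilon(\eta,\epsilon\xi)=\frac1{\epsilon^3}J(|\xi|)f\big(\frac{|\eta|^2}{\epsilon|\xi|}\big)$. With $e=\xi/|\xi|$ and $D_{-e}^{\epsilon|\xi|}\psi(x)=\frac{\psi(x-\epsilon\xi)-\psi(x)}{\epsilon|\xi|}$, for $u\in L^2_0(D)$ and $x\in D$ set $$\nabla PD^\epsilon(u)(x)=\epsilon^3\int_{\mathcal H_1(0)} D_{-e}^{\epsilon|\xi|}\big[\partial_\eta W^\epsilon(u(\cdot+\epsilon\xi)-u(\cdot),\epsilon\xi)\big](x)\,|\xi|\,d\xi .$$ LEFM initial data: with $\mu=\pi f'(0)\int_0^1r^2J(r)\,dr$ and $\mathcal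 G_c=2\pi f_\infty\int_0^1r^2J(r)\,dr$, a pair $u_0,v_0\in L^2_0(D)$ is LEFM initial data if $u_0|_D\in SBV(D)$, $\sup_D|u_0|<\infty$, $\sup_D|v_0|<\infty$, and $\int_D\mu|\nabla u_0|^2dx+\mathcal G_c\mathcal H^1(S_{u_0})<\infty$ ($\nabla u_0$ the approximate gradient, $S_{u_0}$ the jump set, $\mathcal H^1$ one-dimensional Hausdorff measure). The peridynamic evolution with horizon $\epsilon$ is the unique $u^\epsilon\in C^2([0,T];L^2_0(D))$ with $\rho u^\epsilon_{tt}=-\nabla PD^\epsilon(u^\epsilon)+b$ in $D$ for $0<t\le T$, $u^\epsilon(0)=u_0$, $u^\epsilon_t(0)=v_0$. The critical relative displacement for the pair $x,y$ is $\overline\eta=\sqrt{|y-x|}\,\overline r$. The weighted area fraction of the unstable subset is $$P\big(\{y\in\mathcal H_\epsilon(x):|u^\epsilon(t,y)-u^\epsilon(t,x)|>\overline\eta\}\big)=\frac1{\epsilon^2m}\int_{\mathcal H_\epsilon(x)}\chi^{+,\epsilon}(x,y)\left|\frac{y-x}{\epsilon}\right|J\!\left(\left|\frac{y-x}{\epsilon}\right|\right)dy,$$ where $\chi^{+,\epsilon}(x,y)=1$ if $|u^\epsilon(t,y)-u^\epsilon(t,x)|>\overline\eta$ and $0$ otherwise, and $m=\int_{\mathcal H_1(0)}|\xi|J(|\xi|)\,d\xi>0$. *)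

theory Defs
  imports "HOL-Analysis.Analysis"
begin

section \<open>One-dimensional Hausdorff measure\<close>

text \<open>In dimension one the normalising constant is 1, so that the measure of a
  segment is its length.\<close>

definition hausdorff1_delta :: "real \<Rightarrow> 'a::metric_space set \<Rightarrow> ennreal" where
  "hausdorff1_delta d A =
     (INF U \<in> {U :: nat \<Rightarrow> 'a set. A \<subseteq> (\<Union>i. U i) \<and> (\<forall>i. bounded (U i) \<and> diameter (U i) \<le> d)}.
        \<Sum>i. ennreal (diameter (U i)))"

definition hausdorff1 :: "'a::metric_space set \<Rightarrow> ennreal" where
  "hausdorff1 A = (SUP d \<in> {0<..}. hausdorff1_delta d A)"

text \<open>The outer measure \<^const>\<open>hausdorff1\<close> is a metric outer measure, hence countably
  additive on the Borel sets; this is the corresponding Borel measure.\<close>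

definition hausdorff1_measure :: "'a::metric_space measure" where
  "hausdorff1_measure = measure_of UNIV (sets borel) hausdorff1"


section \<open>Special functions of bounded variation\<close>

text \<open>All approximate limits are taken at points of the open set \<open>D\<close> as the radius tends to
  zero, so only the restriction of the function to \<open>D\<close> matters, and only up to null sets.\<close>

definition has_approx_gradient :: "(real^2 \<Rightarrow> real) \<Rightarrow> real^2 \<Rightarrow> real^2 \<Rightarrow> bool" where
  "has_approx_gradient u g x \<longleftrightarrow>
     (\<exists>z. ((\<lambda>r. (LINT y:ball x r|lebesgue. \<bar>u y - z - g \<bullet> (y - x)\<bar> / r)
                 / measure lebesgue (ball x r)) \<longlongrightarrow> 0) (at_right 0))"

definition approx_gradient :: "(real^2 \<Rightarrow> real) \<Rightarrow> real^2 \<Rightarrow> real^2" where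
  "approx_gradient u x = (THE g. has_approx_gradient u g x)"

definition half_ball :: "real^2 \<Rightarrow> real \<Rightarrow> real^2 \<Rightarrow> (real^2) set" where
  "half_ball x r n = {y \<in> ball x r. 0 < (y - x) \<bullet> n}"

definition has_approx_jump ::
    "(real^2 \<Rightarrow> real) \<Rightarrow> real \<Rightarrow> real \<Rightarrow> real^2 \<Rightarrow> real^2 \<Rightarrow> bool" where
  "has_approx_jump u a b n x \<longleftrightarrow> a \<noteq> b \<and> norm n = 1 \<and>
     ((\<lambda>r. (LINT y:half_ball x r n|lebesgue. \<bar>u y - a\<bar>)
            / measure lebesgue (half_ball x r n)) \<longlongrightarrow> 0) (at_right 0) \<and>
     ((\<lambda>r. (LINT y:half_ball x r (- n)|lebesgue. \<bar>u y - b\<bar>)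
            / measure lebesgue (half_ball x r (- n))) \<longlongrightarrow> 0) (at_right 0)"

definition jump_set :: "(real^2) set \<Rightarrow> (real^2 \<Rightarrow> real) \<Rightarrow> (real^2) set" where
  "jump_set D u = {x \<in> D. \<exists>a b n. has_approx_jump u a b n x}"

text \<open>The triple \<open>(u\<^sup>+, u\<^sup>-, \<nu>)\<close> at a jump point is unique up to replacing it by
  \<open>(u\<^sup>-, u\<^sup>+, -\<nu>)\<close>, which does not affect the vector \<open>(u\<^sup>+ - u\<^sup>-) \<nu>\<close>.\<close>

definition jump_vector :: "(real^2 \<Rightarrow> real) \<Rightarrow> real^2 \<Rightarrow> real^2" where
  "jump_vector u x = (THE w. \<exists>a b n. has_approx_jump u a b n x \<and> w = (a - b) *\<^sub>R n)"

definition test_function ::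
    "(real^2) set \<Rightarrow> (real^2 \<Rightarrow> real) \<Rightarrow> (real^2 \<Rightarrow> real^2) \<Rightarrow> bool" where
  "test_function D \<phi> \<phi>' \<longleftrightarrow>
     (\<forall>x. (\<phi> has_derivative (\<lambda>h. \<phi>' x \<bullet> h)) (at x)) \<and> continuous_on UNIV \<phi>' \<and>
     (\<exists>K. compact K \<and> K \<subseteq> D \<and> (\<forall>x. x \<notin> K \<longrightarrow> \<phi> x = 0))"

text \<open>A function in \<open>L\<^sup>1(D)\<close> belongs to \<open>SBV(D)\<close> if its distributional derivative is the finite
  vector measure \<open>Du = \<nabla>u dx + (u\<^sup>+ - u\<^sup>-) \<nu> H\<^sup>1\<close>, the second term being restricted to the
  jump set (no Cantor part).\<close>

definition SBV :: "(real^2) set \<Rightarrow> (real^2 \<Rightarrow> real) set" where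
  "SBV D = {u. set_integrable lebesgue D u \<and>
     (AE x in lebesgue. x \<in> D \<longrightarrow> (\<exists>g. has_approx_gradient u g x)) \<and>
     set_integrable lebesgue D (approx_gradient u) \<and>
     set_integrable hausdorff1_measure (jump_set D u) (jump_vector u) \<and>
     (\<forall>\<phi> \<phi>'. test_function D \<phi> \<phi>' \<longrightarrow>
        (LINT x:D|lebesgue. u x *\<^sub>R \<phi>' x) =
        - ((LINT x:D|lebesgue. \<phi> x *\<^sub>R approx_gradient u x) +
           (LINT x:jump_set D u|hausdorff1_measure. \<phi> x *\<^sub>R jump_vector u x)))}"


section \<open>Square integrable functions and curves of such functions\<close>

text \<open>Elements of \<open>L\<^sup>2\<close> are represented by functions, with identities required almost everywhere.\<close>

definition L2 :: "(real^2) set \<Rightarrow> (real^2 \<Rightarrow> real) set" where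
  "L2 D = {g. set_borel_measurable lebesgue D g \<and> set_integrable lebesgue D (\<lambda>x. (g x)\<^sup>2)}"

definition L2_norm :: "(real^2) set \<Rightarrow> (real^2 \<Rightarrow> real) \<Rightarrow> real" where
  "L2_norm D g = sqrt (LINT x:D|lebesgue. (g x)\<^sup>2)"

definition nbhd :: "real \<Rightarrow> (real^2) set \<Rightarrow> (real^2) set" where
  "nbhd \<alpha> D = {x. infdist x D < \<alpha>}"

definition L20 :: "real \<Rightarrow> (real^2) set \<Rightarrow> (real^2 \<Rightarrow> real) set" where
  "L20 \<alpha> D = {g \<in> L2 D. AE x in lebesgue. x \<in> nbhd \<alpha> D - D \<longrightarrow> g x = 0}"

definition L2_continuous ::
    "(real^2) set \<Rightarrow> real \<Rightarrow> (real \<Rightarrow> real^2 \<Rightarrow> real) \<Rightarrow> bool" where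
  "L2_continuous D T w \<longleftrightarrow>
     (\<forall>t\<in>{0..T}. ((\<lambda>s. L2_norm D (\<lambda>x. w s x - w t x)) \<longlongrightarrow> 0) (at t within {0..T}))"

definition L2_derivative ::
    "(real^2) set \<Rightarrow> real \<Rightarrow> (real \<Rightarrow> real^2 \<Rightarrow> real) \<Rightarrow> (real \<Rightarrow> real^2 \<Rightarrow> real) \<Rightarrow> bool" where
  "L2_derivative D T w w' \<longleftrightarrow>
     (\<forall>t\<in>{0..T}. ((\<lambda>s. L2_norm D (\<lambda>x. (w s x - w t x) / (s - t) - w' t x)) \<longlongrightarrow> 0)
                    (at t within {0..T}))"

definition C1_L2 :: "(real^2) set \<Rightarrow> real \<Rightarrow> (real \<Rightarrow> real^2 \<Rightarrow> real) \<Rightarrow> bool" where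
  "C1_L2 D T b \<longleftrightarrow> (\<exists>b'. (\<forall>t\<in>{0..T}. b t \<in> L2 D \<and> b' t \<in> L2 D) \<and>
     L2_derivative D T b b' \<and> L2_continuous D T b')"


section \<open>Peridynamics\<close>

definition smooth_halfline :: "(real \<Rightarrow> real) \<Rightarrow> bool" where
  "smooth_halfline f \<longleftrightarrow> (\<exists>F :: nat \<Rightarrow> real \<Rightarrow> real. F 0 = f \<and>
     (\<forall>n. \<forall>r\<ge>0. (F n has_real_derivative F (Suc n) r) (at r within {0..})))"

text \<open>\<open>peri_W J f \<epsilon> \<eta> \<xi>\<close> is \<open>W\<^sup>\<epsilon>(\<eta>, \<epsilon>\<xi>)\<close>, i.e. the bond vector is given in units of the horizon.
  The value at \<open>\<xi> = 0\<close> is irrelevant, as it only occurs under integrals over \<open>\<xi>\<close>.\<close>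

definition peri_W :: "(real \<Rightarrow> real) \<Rightarrow> (real \<Rightarrow> real) \<Rightarrow> real \<Rightarrow> real \<Rightarrow> real^2 \<Rightarrow> real" where
  "peri_W J f \<epsilon> \<eta> \<xi> = 1 / \<epsilon>^3 * J (norm \<xi>) * f (\<bar>\<eta>\<bar>\<^sup>2 / (\<epsilon> * norm \<xi>))"

text \<open>The difference quotient \<open>\<psi> \<mapsto> (\<psi>(x - \<epsilon>\<xi>) - \<psi>(x)) / (\<epsilon>|\<xi>|)\<close> in the direction \<open>-\<xi>/|\<xi>|\<close>.\<close>

definition back_quotient :: "real \<Rightarrow> real^2 \<Rightarrow> (real^2 \<Rightarrow> real) \<Rightarrow> real^2 \<Rightarrow> real" where
  "back_quotient \<epsilon> \<xi> \<psi> x = (\<psi> (x - \<epsilon> *\<^sub>R \<xi>) - \<psi> x) / (\<epsilon> * norm \<xi>)"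

definition grad_PD ::
    "(real \<Rightarrow> real) \<Rightarrow> (real \<Rightarrow> real) \<Rightarrow> real \<Rightarrow> (real^2 \<Rightarrow> real) \<Rightarrow> real^2 \<Rightarrow> real" where
  "grad_PD J f \<epsilon> u x = \<epsilon>^3 * (LINT \<xi>:ball 0 1|lebesgue.
     back_quotient \<epsilon> \<xi>
       (\<lambda>z. deriv (\<lambda>\<eta>. peri_W J f \<epsilon> \<eta> \<xi>) (u (z + \<epsilon> *\<^sub>R \<xi>) - u z)) x * norm \<xi>)"

definition LEFM_mu :: "(real \<Rightarrow> real) \<Rightarrow> real \<Rightarrow> real" where
  "LEFM_mu J f0' = pi * f0' * (LINT r:{0..1}|lebesgue. r\<^sup>2 * J r)"

definition LEFM_Gc :: "(real \<Rightarrow> real) \<Rightarrow> real \<Rightarrow> real" where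
  "LEFM_Gc J f_inf = 2 * pi * f_inf * (LINT r:{0..1}|lebesgue. r\<^sup>2 * J r)"

definition LEFM_initial_data ::
    "real \<Rightarrow> (real^2) set \<Rightarrow> (real \<Rightarrow> real) \<Rightarrow> real \<Rightarrow> real \<Rightarrow>
     (real^2 \<Rightarrow> real) \<Rightarrow> (real^2 \<Rightarrow> real) \<Rightarrow> bool" where
  "LEFM_initial_data \<alpha> D J f0' f_inf u0 v0 \<longleftrightarrow>
     u0 \<in> L20 \<alpha> D \<and> v0 \<in> L20 \<alpha> D \<and> u0 \<in> SBV D \<and>
     (\<exists>K. AE x in lebesgue. x \<in> D \<longrightarrow> \<bar>u0 x\<bar> \<le> K) \<and>
     (\<exists>K. AE x in lebesgue. x \<in> D \<longrightarrow> \<bar>v0 x\<bar> \<le> K) \<and>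
     (\<integral>\<^sup>+x\<in>D. ennreal (LEFM_mu J f0' * (norm (approx_gradient u0 x))\<^sup>2) \<partial>lebesgue)
       + ennreal (LEFM_Gc J f_inf) * hausdorff1 (jump_set D u0) < \<infinity>"

definition peridynamic_evolution ::
    "real \<Rightarrow> (real^2) set \<Rightarrow> real \<Rightarrow> (real \<Rightarrow> real) \<Rightarrow> (real \<Rightarrow> real) \<Rightarrow> real \<Rightarrow>
     (real \<Rightarrow> real^2 \<Rightarrow> real) \<Rightarrow> (real^2 \<Rightarrow> real) \<Rightarrow> (real^2 \<Rightarrow> real) \<Rightarrow> real \<Rightarrow>
     (real \<Rightarrow> real^2 \<Rightarrow> real) \<Rightarrow> bool" where
  "peridynamic_evolution \<alpha> D \<rho> J f T b u0 v0 \<epsilon> u \<longleftrightarrow>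
     (\<exists>u' u''.
        (\<forall>t\<in>{0..T}. u t \<in> L20 \<alpha> D \<and> u' t \<in> L20 \<alpha> D \<and> u'' t \<in> L20 \<alpha> D) \<and>
        L2_derivative D T u u' \<and> L2_derivative D T u' u'' \<and> L2_continuous D T u'' \<and>
        (\<forall>t\<in>{0<..T}. AE x in lebesgue. x \<in> D \<longrightarrow>
           \<rho> * u'' t x = - grad_PD J f \<epsilon> (u t) x + b t x) \<and>
        (AE x in lebesgue. x \<in> D \<longrightarrow> u 0 x = u0 x) \<and>
        (AE x in lebesgue. x \<in> D \<longrightarrow> u' 0 x = v0 x))"

definition J_moment :: "(real \<Rightarrow> real) \<Rightarrow> real" where
  "J_moment J = (LINT \<xi>:(ball 0 1 :: (real^2) set)|lebesgue. norm \<xi> * J (norm \<xi>))"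

definition weighted_area_fraction ::
    "(real \<Rightarrow> real) \<Rightarrow> real \<Rightarrow> real^2 \<Rightarrow> (real^2) set \<Rightarrow> real" where
  "weighted_area_fraction J \<epsilon> x A = 1 / (\<epsilon>\<^sup>2 * J_moment J) *
     (LINT y:ball x \<epsilon>|lebesgue.
        indicator A y * norm ((y - x) /\<^sub>R \<epsilon>) * J (norm ((y - x) /\<^sub>R \<epsilon>)))"

definition unstable_subset :: "real \<Rightarrow> real \<Rightarrow> (real^2 \<Rightarrow> real) \<Rightarrow> real^2 \<Rightarrow> (real^2) set" where
  "unstable_subset rbar \<epsilon> w x = {y \<in> ball x \<epsilon>. \<bar>w y - w x\<bar> > sqrt (norm (y - x)) * rbar}"

definition horizon :: "nat \<Rightarrow> real" where
  "horizon j = (1/2) ^ j"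

text \<open>\<open>u j\<close> is the evolution with horizon \<open>2\<^sup>-\<^sup>j\<close>; only indices \<open>j \<ge> 1\<close> are used.\<close>

definition process_zone ::
    "(real^2) set \<Rightarrow> (real \<Rightarrow> real) \<Rightarrow> real \<Rightarrow> (nat \<Rightarrow> real \<Rightarrow> real^2 \<Rightarrow> real) \<Rightarrow>
     real \<Rightarrow> real \<Rightarrow> (real^2) set" where
  "process_zone D J rbar u \<delta> t =
     {x \<in> D. \<exists>j\<ge>1. horizon j < \<delta> \<and>
        weighted_area_fraction J (horizon j) x (unstable_subset rbar (horizon j) (u j t) x)
          > sqrt (horizon j)}"

definition process_zone0 ::
    "(real^2) set \<Rightarrow> (real \<Rightarrow> real) \<Rightarrow> real \<Rightarrow> (nat \<Rightarrow> real \<Rightarrow> real^2 \<Rightarrow> real) \<Rightarrow>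
     real \<Rightarrow> (real^2) set" where
  "process_zone0 D J rbar u t = (\<Inter>\<delta>\<in>{0<..}. process_zone D J rbar u \<delta> t)"

end

theory Submission imports Defs
begin

text \<open>The energy \<open>V\<^sub>\<epsilon>(u) = \<epsilon>\<^sup>-\<^sup>1 \<integral>\<integral> J(|\<xi>|) f(|u(x + \<epsilon>\<xi>) - u(x)|\<^sup>2 / (\<epsilon>|\<xi>|)) d\<xi> dx\<close>, with \<open>u\<close>
  extended by zero, has \<open>\<nabla>PD\<^sup>\<epsilon>\<close> as its \<open>L\<^sup>2\<close> gradient. An unstable bond costs at least
  \<open>f(rbar\<^sup>2)\<close>, so Chebyshev's inequality bounds the set where the weighted area fraction exceeds
  \<open>\<surd>\<epsilon>\<close> by \<open>C \<surd>\<epsilon> V\<^sub>\<epsilon>(u)\<close>, and summing over \<open>\<epsilon> = 2\<^sup>-\<^sup>j < \<delta>\<close> gives \<open>C \<surd>\<delta>\<close>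
  once \<open>V\<^sub>\<epsilon>(u\<^sup>\<epsilon>(t))\<close> is bounded uniformly in \<open>\<epsilon>\<close> and \<open>t\<close>.

  By concavity of \<open>f\<close> the energy is semiconcave, hence the upper right Dini derivative of kinetic
  plus potential energy is at most the power of the load, and a comparison argument reduces the
  bound to the initial datum. There it suffices that
  \<open>\<integral> f(|u\<^sub>0(x + \<zeta>) - u\<^sub>0(x)|\<^sup>2 / |\<zeta>|) dx \<le> C |\<zeta>|\<close>. Outside a set of measure \<open>O(|\<zeta>|)\<close>,
  made of a boundary layer and of the \<open>x\<close> whose segment \<open>[x, x + \<zeta>]\<close> comes close to the jump set,
  the increment of \<open>u\<^sub>0\<close> is up to a small error an average of the approximate gradient along the
  segment. This is seen by testing the distributional derivative with a mollified segment, which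
  avoids slicing.\<close>

text \<open>The powers of \<open>h = norm \<zeta>\<close> decide what the estimate for the initial
  datum may cost. Since \<open>f\<close> grows at most linearly and is bounded, one part of the
  increment can be charged quadratically with weight 1/h, and any other part linearly with weight
  1/sqrt h. The squared gradient average has integral of order h^2, and every error only has to be
  of order h sqrt h in L^1. Hence the mollification radius, the covering of the jump set and the
  compact part of the jump measure may all depend on \<open>\<zeta>\<close> without any rate. The
  resulting bound C |\<zeta>|, with |\<zeta>| at most \<epsilon>, cancels the factor 1/\<epsilon> of
  the energy. Constants with kint / \<epsilon> degenerate with \<epsilon>, but they occur only in
  remainders that vanish with the time step. The definitions speak of Lebesgue measurable functions
  known up to null sets; the analysis is done with Borel versions that are zero outside
  \<open>D\<close>, for which product integrals are available.\<close>

section \<open>Affine changes of variables and Borel versions\<close>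

lemma nn_integral_lborel_affine:
  fixes f :: "'a::euclidean_space \<Rightarrow> ennreal"
  assumes [measurable]: "f \<in> borel_measurable borel" and c: "c \<noteq> 0"
  shows "(\<integral>\<^sup>+x. f x \<partial>lborel) = ennreal (\<bar>c\<bar> ^ DIM('a)) * (\<integral>\<^sup>+x. f (a + c *\<^sub>R x) \<partial>lborel)"
  by (subst lborel_affine[OF c, of a])
     (simp add: nn_integral_density nn_integral_distr nn_integral_cmult)

lemma nn_integral_lborel_translate:
  fixes f :: "'a::euclidean_space \<Rightarrow> ennreal"
  assumes "f \<in> borel_measurable borel"
  shows "(\<integral>\<^sup>+x. f (x + a) \<partial>lborel) = (\<integral>\<^sup>+x. f x \<partial>lborel)"
  using nn_integral_lborel_affine[OF assms, of 1 a] by (simp add: add.commute)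

lemma AE_lborel_affine:
  fixes P :: "'a::euclidean_space \<Rightarrow> bool"
  assumes "AE x in lborel. P x" and c: "c \<noteq> 0"
  shows "AE x in lborel. P (a + c *\<^sub>R x)"
proof -
  have "AE x in density (distr lborel borel (\<lambda>x. a + c *\<^sub>R x)) (\<lambda>_. ennreal (\<bar>c\<bar> ^ DIM('a))). P x"
    using assms(1) by (subst (asm) lborel_affine[OF c, of a])  simp
  then have "AE x in distr lborel borel (\<lambda>x. a + c *\<^sub>R x). P x"
    using c by (subst (asm) AE_density) auto
  then show ?thesis
    by (rule AE_distrD[rotated]) measurable
qed

lemma integral_lborel_affine:
  fixes f :: "'a::euclidean_space \<Rightarrow> real"
  assumes [measurable]: "f \<in> borel_measurable borel" and c: "c \<noteq> 0"
  shows "(\<integral>x. f x \<partial>lborel) = \<bar>c\<bar> ^ DIM('a) * (\<integral>x. f (a + c *\<^sub>R x) \<partial>lborel)"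
  by (subst lborel_affine[OF c, of a]) (simp add: integral_density integral_distr)

lemma integral_lborel_translate:
  fixes f :: "'a::euclidean_space \<Rightarrow> real"
  assumes f: "integrable lborel f"
  shows "integrable lborel (\<lambda>x. f (x + a))" "(\<integral>x. f (x + a) \<partial>lborel) = (\<integral>x. f x \<partial>lborel)"
proof -
  have m [measurable]: "f \<in> borel_measurable borel" using f by auto
  show "integrable lborel (\<lambda>x. f (x + a))"
    using f unfolding integrable_iff_bounded
    by (subst (asm) nn_integral_lborel_translate[symmetric, of _ a]) auto
  show "(\<integral>x. f (x + a) \<partial>lborel) = (\<integral>x. f x \<partial>lborel)"
    using integral_lborel_affine[OF m, of 1 a] by (simp add: add.commute)
qed

lemma AE_lebesgue_iff: "(AE x in lebesgue. P x) \<longleftrightarrow> (AE x in lborel. P x)"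
  by (auto simp: AE_completion_iff)


text \<open>The bridge from the integrals over \<open>lebesgue\<close> in the definitions to Borel
  integrals over \<open>lborel\<close>. Completeness of \<open>lebesgue\<close> transfers
  measurability from \<open>g\<close> to \<open>f\<close>.\<close>

lemma AE_eq_imp_integral_lebesgue_eq:
  fixes f g :: "'a::euclidean_space \<Rightarrow> 'b::euclidean_space"
  assumes g: "g \<in> borel_measurable borel" and ae: "AE x in lborel. f x = g x"
  shows "integral\<^sup>L lebesgue f = integral\<^sup>L lborel g"
    "integrable lebesgue f \<longleftrightarrow> integrable lborel g"
proof -
  have g': "g \<in> borel_measurable lborel" using g by simp
  have ae: "AE x in lebesgue. f x = g x" using ae by (simp add: AE_lebesgue_iff)
  have gl: "g \<in> borel_measurable lebesgue" using g' by (rule measurable_completion)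
  have f: "f \<in> borel_measurable lebesgue"
    by (rule borel_measurable_AE[OF gl]) (use ae in auto)
  show "integral\<^sup>L lebesgue f = integral\<^sup>L lborel g"
    using integral_cong_AE[OF f gl ae] integral_completion[OF g'] by simp
  show "integrable lebesgue f \<longleftrightarrow> integrable lborel g"
    using integrable_cong_AE[OF f gl ae] integrable_completion[OF g'] by simp
qed

text \<open>A completed measurable function agrees with a Borel one almost everywhere; multiplying
  by the indicator once more makes it vanish at every point outside \<open>D\<close>, as extension
  by zero demands.\<close>

lemma ex_borel_version:
  fixes f :: "'a::euclidean_space \<Rightarrow> real"
  assumes f: "set_borel_measurable lebesgue D f" and D: "D \<in> sets borel"
  obtains g where "g \<in> borel_measurable borel" "\<And>x. x \<notin> D \<Longrightarrow> g x = 0"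
    "AE x in lborel. x \<in> D \<longrightarrow> f x = g x"
proof -
  obtain g where g: "g \<in> borel_measurable lborel" "AE x in lborel. indicator D x *\<^sub>R f x = g x"
    using completion_ex_borel_measurable_real[OF f[unfolded set_borel_measurable_def]] by auto
  show ?thesis
  proof (rule that[of "\<lambda>x. indicator D x * g x"])
    show "(\<lambda>x. indicator D x * g x) \<in> borel_measurable borel" using g D by auto
    show "AE x in lborel. x \<in> D \<longrightarrow> f x = indicator D x * g x"
      using g(2) by eventually_elim auto
  qed auto
qed

section \<open>Translations in L^1 and the singularity 1/|\<xi>| in the plane\<close>

text \<open>Density argument: \<open>u\<close> is an L^1 limit of continuous functions of compact
  support, and for these uniform continuity gives the claim on a ball of finite volume. The three
  differences cost e/4 each.\<close>

lemma L1_continuous_translation: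
  fixes u :: "'a::euclidean_space \<Rightarrow> real"
  assumes [measurable]: "u \<in> borel_measurable borel" and K: "\<And>x. \<bar>u x\<bar> \<le> K"
    and D: "bounded D" "\<And>x. x \<notin> D \<Longrightarrow> u x = 0" and e: "e > 0"
  obtains d where "d > 0"
    "\<And>y. norm y < d \<Longrightarrow> (\<integral>\<^sup>+x. ennreal \<bar>u (x + y) - u x\<bar> \<partial>lborel) \<le> ennreal e"
proof -
  have K0: "0 \<le> K" using K[of 0] by linarith
  obtain R where R: "R > 0" "D \<subseteq> ball 0 R"
    using bounded_subset_ballD[OF D(1), of 0] by auto
  have "u \<in> borel_measurable lebesgue" by (rule measurable_completion) simp
  then have "u measurable_on UNIV"
    by (intro lebesgue_measurable_imp_measurable_on) auto
  then obtain N g where N: "negligible N" and g: "\<And>n. continuous_on UNIV (g n)"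
    and lim: "\<And>x. x \<notin> N \<Longrightarrow> (\<lambda>n. g n x) \<longlonglongrightarrow> u x"
    unfolding measurable_on_def by auto
  define \<psi> where "\<psi> x = max 0 (min 1 (R + 1 - norm x))" for x :: 'a
  \<comment> \<open>\<open>measurable_on\<close> supplies neither a bound nor a support, so the
    approximants are clamped to [-K, K] and cut off beyond radius R + 1. Both operations leave
    \<open>u\<close> itself unchanged, so the limit is still \<open>u\<close>.\<close>
  define G where "G n x = \<psi> x * max (- K) (min K (g n x))" for n :: nat and x
  have G_cont: "continuous_on UNIV (G n)" for n
    unfolding G_def \<psi>_def by (intro continuous_intros g)
  have G_borel[measurable]: "G n \<in> borel_measurable borel" for n
    using G_cont by (rule borel_measurable_continuous_onI)
  have \<psi>: "0 \<le> \<psi> x" "\<psi> x \<le> 1" "norm x \<ge> R + 1 \<Longrightarrow> \<psi> x = 0" "norm x < R \<Longrightarrow> \<psi> x = 1" for x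
    unfolding \<psi>_def by auto
  have G_bd: "\<bar>G n x\<bar> \<le> K" for n x
  proof -
    have "\<bar>G n x\<bar> \<le> 1 * K"
      unfolding G_def abs_mult using \<psi>[of x] K0 by (intro mult_mono) auto
    then show ?thesis by simp
  qed
  have u0: "u x = 0" if "norm x \<ge> R" for x
    using D(2)[of x] R(2) that by (force simp: subset_eq)
  have G0: "G n x = 0" if "norm x \<ge> R + 1" for n x
    using \<psi>(3)[OF that] by (simp add: G_def)
  have lim': "(\<lambda>n. G n x) \<longlonglongrightarrow> u x" if "x \<notin> N" for x
  proof -
    have "(\<lambda>n. G n x) \<longlonglongrightarrow> \<psi> x * max (- K) (min K (u x))"
      unfolding G_def by (intro tendsto_intros lim that)
    also have "\<psi> x * max (- K) (min K (u x)) = u x"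
      using \<psi>(4)[of x] u0[of x] K[of x] by (cases "norm x < R") auto
    finally show ?thesis .
  qed
  have ae: "AE x in lborel. x \<notin> N"
    using N by (simp add: negligible_iff_null_sets AE_not_in flip: AE_lebesgue_iff)
  have fin: "emeasure lborel (cball (0::'a) r) < \<infinity>" for r
    by (rule emeasure_lborel_cball_finite)
  have intu: "integrable lborel (\<lambda>x. 2 * K * indicator (cball (0::'a) (R+1)) x)"
    using fin by (intro integrable_mult_right) (simp add: less_top)
  have "(\<lambda>n. \<integral>x. \<bar>G n x - u x\<bar> \<partial>lborel) \<longlonglongrightarrow> (\<integral>x. 0 \<partial>(lborel :: 'a measure))"
  proof (rule integral_dominated_convergence[OF _ _ intu])
    show "AE x in lborel. (\<lambda>n. \<bar>G n x - u x\<bar>) \<longlonglongrightarrow> 0"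
      using ae
    proof eventually_elim
      case (elim x)
      have "(\<lambda>n. \<bar>G n x - u x\<bar>) \<longlonglongrightarrow> \<bar>u x - u x\<bar>" by (intro tendsto_intros lim' elim)
      then show ?case by simp
    qed
    show "AE x in lborel. norm \<bar>G n x - u x\<bar> \<le> 2 * K * indicator (cball 0 (R + 1)) x" for n
    proof (rule AE_I2)
      fix x
      show "norm \<bar>G n x - u x\<bar> \<le> 2 * K * indicator (cball 0 (R + 1)) x"
      proof (cases "norm x \<le> R + 1")
        case True then show ?thesis using G_bd[of n x] K[of x] by (auto simp: indicator_def)
      next
        case False then show ?thesis using G0[of x n] u0[of x] R by (auto simp: indicator_def)
      qed
    qed
  qed auto
  then have "\<forall>\<^sub>F n in sequentially. (\<integral>x. \<bar>G n x - u x\<bar> \<partial>lborel) < e / 4"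
    by (rule order_tendstoD) (use e in simp)
  then obtain n where n: "(\<integral>x. \<bar>G n x - u x\<bar> \<partial>lborel) < e / 4"
    by (meson eventually_happens sequentially_bot)
  have intG: "integrable lborel (\<lambda>x. \<bar>G n x - u x\<bar>)"
  proof (rule Bochner_Integration.integrable_bound[OF intu])
    show "AE x in lborel. norm \<bar>G n x - u x\<bar> \<le> norm (2 * K * indicator (cball 0 (R + 1)) x)"
    proof (rule AE_I2)
      fix x
      show "norm \<bar>G n x - u x\<bar> \<le> norm (2 * K * indicator (cball 0 (R + 1)) x)"
      proof (cases "norm x \<le> R + 1")
        case True then show ?thesis using G_bd[of n x] K[of x] by (auto simp: indicator_def)
      next
        case False then show ?thesis using G0[of x n] u0[of x] R by (auto simp: indicator_def)
      qed
    qed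
  qed simp
  have n': "(\<integral>\<^sup>+x. ennreal \<bar>G n x - u x\<bar> \<partial>lborel) \<le> ennreal (e / 4)"
    using n by (subst nn_integral_eq_integral[OF intG]) (auto intro: ennreal_leI)
  define V where "V = measure lborel (cball (0::'a) (R + 2))"
  have V: "emeasure lborel (cball (0::'a) (R + 2)) = ennreal V" "V \<ge> 0"
    unfolding V_def using fin[of "R+2"] by (simp_all add: emeasure_eq_ennreal_measure less_top)
  define e' where "e' = e / (4 * (V + 1))"
  have e': "e' > 0" using e V unfolding e'_def by simp
  \<comment> \<open>The shift is at most 1: beyond radius R + 2 both values vanish, and otherwise
    both points lie within radius R + 3.\<close>
  have "uniformly_continuous_on (cball 0 (R + 3)) (G n)"
    by (rule compact_uniformly_continuous) (auto intro: continuous_on_subset[OF G_cont])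
  then obtain d0 where d0: "d0 > 0"
    "\<And>x y. \<lbrakk>norm x \<le> R + 3; norm y \<le> R + 3; dist y x < d0\<rbrakk> \<Longrightarrow> dist (G n y) (G n x) < e'"
    using e' unfolding uniformly_continuous_on_def by (auto simp: dist_norm)
  show ?thesis
  proof (rule that[of "min d0 1"])
    show "min d0 1 > 0" using d0 by simp
    fix y :: 'a assume y: "norm y < min d0 1"
    have G: "\<bar>G n (x + y) - G n x\<bar> \<le> e' * indicator (cball 0 (R + 2)) x" for x
    proof (cases "norm x \<le> R + 2")
      case True
      have "norm (x + y) \<le> R + 3" using norm_triangle_ineq[of x y] True y by simp
      then show ?thesis using d0(2)[of x "x + y"] True y by (auto simp: dist_norm dist_real_def)
    next
      case False
      have "norm (x + y) \<ge> R + 1" using norm_triangle_ineq4[of "x + y" y] False y by simp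
      then show ?thesis using G0[of x n] G0[of "x + y" n] False by simp
    qed
    have "(\<integral>\<^sup>+x. ennreal \<bar>G n (x + y) - G n x\<bar> \<partial>lborel)
        \<le> (\<integral>\<^sup>+x. ennreal e' * indicator (cball 0 (R + 2)) (x::'a) \<partial>lborel)"
    proof (rule nn_integral_mono)
      fix x show "ennreal \<bar>G n (x + y) - G n x\<bar> \<le> ennreal e' * indicator (cball 0 (R + 2)) x"
        using ennreal_leI[OF G[of x]] e' by (auto simp: indicator_def split: if_splits)
    qed
    also have "\<dots> = ennreal (e' * V)"
      using e' V by (simp add: nn_integral_cmult_indicator ennreal_mult)
    also have "\<dots> \<le> ennreal (e / 4)"
      using e V unfolding e'_def by (intro ennreal_leI) (simp add: field_simps)
    finally have 1: "(\<integral>\<^sup>+x. ennreal \<bar>G n (x + y) - G n x\<bar> \<partial>lborel) \<le> ennreal (e / 4)" .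
    have 2: "(\<integral>\<^sup>+x. ennreal \<bar>G n (x + y) - u (x + y)\<bar> \<partial>lborel) \<le> ennreal (e / 4)"
      using n' by (subst nn_integral_lborel_translate[of "\<lambda>x. ennreal \<bar>G n x - u x\<bar>"]) auto
    have "(\<integral>\<^sup>+x. ennreal \<bar>u (x + y) - u x\<bar> \<partial>lborel)
       \<le> (\<integral>\<^sup>+x. ennreal \<bar>G n (x + y) - u (x + y)\<bar> + ennreal \<bar>G n (x + y) - G n x\<bar>
             + ennreal \<bar>G n x - u x\<bar> \<partial>lborel)"
      by (intro nn_integral_mono) (auto simp flip: ennreal_plus intro!: ennreal_leI)
    also have "\<dots> = (\<integral>\<^sup>+x. ennreal \<bar>G n (x + y) - u (x + y)\<bar> \<partial>lborel)
       + (\<integral>\<^sup>+x. ennreal \<bar>G n (x + y) - G n x\<bar> \<partial>lborel) + (\<integral>\<^sup>+x. ennreal \<bar>G n x - u x\<bar> \<partial>lborel)"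
      by (simp add: nn_integral_add)
    also have "\<dots> \<le> ennreal (e / 4) + ennreal (e / 4) + ennreal (e / 4)"
      by (intro add_mono 1 2 n')
    also have "\<dots> \<le> ennreal e"
      using e by (simp flip: ennreal_plus)
    finally show "(\<integral>\<^sup>+x. ennreal \<bar>u (x + y) - u x\<bar> \<partial>lborel) \<le> ennreal e" .
  qed
qed

text \<open>On the shell where |\<xi>| lies between 2^-(k+1) and 2^-k the integrand is at most
  2^(k+1), while the disc of radius 2^-k has area pi 4^-k; the majorising series is
  geometric.\<close>

lemma nn_integral_inverse_norm_ball:
  "(\<integral>\<^sup>+\<xi>. ennreal (1 / norm \<xi>) * indicator (ball 0 1) (\<xi> :: real^2) \<partial>lborel) < \<infinity>"
proof -
  have bnd: "ennreal (1 / norm \<xi>) * indicator (ball 0 1) \<xi>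
      \<le> (\<Sum>k. ennreal (2 ^ Suc k) * indicator (ball 0 ((1/2) ^ k)) \<xi>)" for \<xi> :: "real^2"
  proof (cases "\<xi> \<noteq> 0 \<and> norm \<xi> < 1")
    case True
    define k where "k = (LEAST k. (1/2::real) ^ k \<le> norm \<xi>)"
    have "\<exists>m. (1/2::real) ^ m < norm \<xi>"
      by (rule real_arch_pow_inv) (use True in simp_all)
    then obtain m where m: "(1/2::real) ^ m < norm \<xi>" ..
    have k: "(1/2::real) ^ k \<le> norm \<xi>"
      unfolding k_def by (rule LeastI[of _ m]) (rule less_imp_le[OF m])
    have "k \<noteq> 0" using k True by (cases k) auto
    then obtain i where i: "k = Suc i" by (cases k) auto
    have "\<not> (1/2::real) ^ i \<le> norm \<xi>" using not_less_Least[of i "\<lambda>k. (1/2::real) ^ k \<le> norm \<xi>"] i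
      unfolding k_def by simp
    then have in_ball: "\<xi> \<in> ball 0 ((1/2) ^ i)" by simp
    have "1 / norm \<xi> \<le> 2 ^ Suc i" using k True unfolding i
      by (simp add: field_simps power_one_over)
    then have "ennreal (1 / norm \<xi>) * indicator (ball 0 1) \<xi>
        \<le> ennreal (2 ^ Suc i) * indicator (ball 0 ((1/2) ^ i)) \<xi>"
      using True in_ball by (auto intro!: ennreal_leI)
    also have "\<dots> = (\<Sum>k\<in>{i}. ennreal (2 ^ Suc k) * indicator (ball 0 ((1/2) ^ k)) \<xi>)"
      by (simp only: sum.insert sum.empty finite.emptyI empty_iff not_False_eq_True add_0_right)
    also have "\<dots> \<le> (\<Sum>k. ennreal (2 ^ Suc k) * indicator (ball 0 ((1/2) ^ k)) \<xi>)"
      by (rule sum_le_suminf) (auto simp del: power_Suc)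
    finally show ?thesis .
  next
    case False
    then have "ennreal (1 / norm \<xi>) * indicator (ball 0 1) \<xi> = 0" by (auto simp: indicator_def)
    then show ?thesis by (simp only: zero_le)
  qed
  have "(\<integral>\<^sup>+\<xi>. ennreal (1 / norm \<xi>) * indicator (ball 0 1) (\<xi>::real^2) \<partial>lborel)
     \<le> (\<integral>\<^sup>+\<xi>. (\<Sum>k. ennreal (2 ^ Suc k) * indicator (ball 0 ((1/2) ^ k)) (\<xi>::real^2)) \<partial>lborel)"
    by (rule nn_integral_mono) (rule bnd)
  also have "\<dots> = (\<Sum>k. \<integral>\<^sup>+\<xi>. ennreal (2 ^ Suc k) * indicator (ball 0 ((1/2) ^ k)) (\<xi>::real^2) \<partial>lborel)"
    by (intro nn_integral_suminf borel_measurable_times_ennreal borel_measurable_const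
        borel_measurable_indicator) simp
  also have "\<dots> = (\<Sum>k. ennreal (2 * pi * (1/2) ^ k))"
  proof (rule suminf_cong)
    fix k :: nat
    have "(2::real) ^ Suc k * (pi * ((1/2) ^ k)\<^sup>2) = 2 * pi * (1/2) ^ k"
      by (simp add: power2_eq_square field_simps power_one_over)
    then show "(\<integral>\<^sup>+\<xi>. ennreal (2 ^ Suc k) * indicator (ball 0 ((1/2) ^ k)) (\<xi>::real^2) \<partial>lborel)
        = ennreal (2 * pi * (1/2) ^ k)"
      by (simp add: nn_integral_cmult_indicator emeasure_ball unit_ball_vol_2 flip: ennreal_mult)
  qed
  also have "\<dots> < \<infinity>"
    by (subst suminf_ennreal2) (auto intro!: summable_mult summable_geometric)
  finally show ?thesis .
qed

section \<open>Square integrable functions\<close>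

text \<open>Borel rather than Lebesgue measurability is part of the notion, so that compositions
  with shifts remain measurable on the product space.\<close>

definition sq_integrable :: "('a::euclidean_space \<Rightarrow> real) \<Rightarrow> bool" where
  "sq_integrable v \<longleftrightarrow> v \<in> borel_measurable borel \<and> integrable lborel (\<lambda>x. (v x)\<^sup>2)"

definition sq_norm :: "('a::euclidean_space \<Rightarrow> real) \<Rightarrow> real" where
  "sq_norm v = sqrt (\<integral>x. (v x)\<^sup>2 \<partial>lborel)"

lemma sq_integrableD:
  assumes "sq_integrable v"
  shows "v \<in> borel_measurable borel" "v \<in> borel_measurable lborel"
    "integrable lborel (\<lambda>x. (v x)\<^sup>2)"
  using assms by (auto simp: sq_integrable_def)

lemma sq_norm_nonneg [simp]: "0 \<le> sq_norm v"
  by (simp add: sq_norm_def)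

lemma sq_norm_power2: "(sq_norm v)\<^sup>2 = (\<integral>x. (v x)\<^sup>2 \<partial>lborel)"
  by (simp add: sq_norm_def)

lemma sq_integrable_scale: "sq_integrable v \<Longrightarrow> sq_integrable (\<lambda>x. c * v x)"
  by (auto simp: sq_integrable_def power_mult_distrib)

lemma sq_norm_scale: "sq_norm (\<lambda>x. c * v x) = \<bar>c\<bar> * sq_norm v"
  by (simp add: sq_norm_def power_mult_distrib real_sqrt_mult)

lemma integrable_mult_sq:
  assumes u: "sq_integrable u" and v: "sq_integrable v"
  shows "integrable lborel (\<lambda>x. u x * v x)"
proof (rule Bochner_Integration.integrable_bound)
  show "integrable lborel (\<lambda>x. (u x)\<^sup>2 + (v x)\<^sup>2)" using u v by (auto simp: sq_integrable_def)
  show "(\<lambda>x. u x * v x) \<in> borel_measurable lborel" using u v by (auto simp: sq_integrable_def)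
  show "AE x in lborel. norm (u x * v x) \<le> norm ((u x)\<^sup>2 + (v x)\<^sup>2)"
  proof (rule AE_I2)
    fix x
    have "2 * (\<bar>u x\<bar> * \<bar>v x\<bar>) \<le> (u x)\<^sup>2 + (v x)\<^sup>2"
      using sum_squares_bound[of "\<bar>u x\<bar>" "\<bar>v x\<bar>"] by simp
    moreover have "0 \<le> \<bar>u x\<bar> * \<bar>v x\<bar>" by simp
    ultimately show "norm (u x * v x) \<le> norm ((u x)\<^sup>2 + (v x)\<^sup>2)"
      unfolding real_norm_def abs_mult by linarith
  qed
qed

lemma sq_integrable_add:
  assumes u: "sq_integrable u" and v: "sq_integrable v"
  shows "sq_integrable (\<lambda>x. u x + v x)"
  using integrable_mult_sq[OF u v] u v by (auto simp: sq_integrable_def power2_sum mult.assoc)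

lemma sq_integrable_diff:
  assumes u: "sq_integrable u" and v: "sq_integrable v"
  shows "sq_integrable (\<lambda>x. u x - v x)"
  using sq_integrable_add[OF u sq_integrable_scale[OF v, of "-1"]] by simp

text \<open>The squared norm of u + t v is a nonnegative polynomial in \<open>t\<close>. If its
  leading coefficient vanishes it is affine in \<open>t\<close>, which forces the linear coefficient
  to vanish too.\<close>

lemma sq_norm_Cauchy_Schwarz:
  assumes u: "sq_integrable u" and v: "sq_integrable v"
  shows "\<bar>\<integral>x. u x * v x \<partial>lborel\<bar> \<le> sq_norm u * sq_norm v"
proof -
  let ?a = "\<integral>x. (u x)\<^sup>2 \<partial>lborel" and ?b = "\<integral>x. (v x)\<^sup>2 \<partial>lborel" and ?c = "\<integral>x. u x * v x \<partial>lborel"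
  have q: "0 \<le> ?a + 2 * t * ?c + t\<^sup>2 * ?b" for t
  proof -
    have "0 \<le> (\<integral>x. (u x + t * v x)\<^sup>2 \<partial>lborel)" by simp
    also have "\<dots> = (\<integral>x. (u x)\<^sup>2 + (2 * t) * (u x * v x) + t\<^sup>2 * (v x)\<^sup>2 \<partial>lborel)"
      by (simp add: power2_sum power_mult_distrib algebra_simps)
    also have "\<dots> = ?a + 2 * t * ?c + t\<^sup>2 * ?b"
      using integrable_mult_sq[OF u v] sq_integrableD[OF u] sq_integrableD[OF v] by simp
    finally show ?thesis .
  qed
  have a: "0 \<le> ?a" and b: "0 \<le> ?b" by simp_all
  have "?c\<^sup>2 \<le> ?a * ?b"
  proof (cases "?b = 0")
    case True
    have "?c = 0"
    proof (rule ccontr)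
      assume c: "?c \<noteq> 0"
      have "0 \<le> ?a + 2 * (- (?a + 1) / (2 * ?c)) * ?c" using q[of "- (?a + 1) / (2 * ?c)"] True by simp
      then show False using c by (simp add: field_simps)
    qed
    then show ?thesis using True by simp
  next
    case False
    then have "?b > 0" using b by linarith
    then show ?thesis using q[of "- ?c / ?b"] by (simp add: field_simps power2_eq_square)
  qed
  then have "sqrt (?c\<^sup>2) \<le> sqrt (?a * ?b)" by (rule real_sqrt_le_mono)
  then show ?thesis by (simp add: sq_norm_def real_sqrt_mult)
qed

lemma sq_norm_triangle:
  assumes u: "sq_integrable u" and v: "sq_integrable v"
  shows "sq_norm (\<lambda>x. u x + v x) \<le> sq_norm u + sq_norm v"
proof (rule power2_le_imp_le)
  have "(sq_norm (\<lambda>x. u x + v x))\<^sup>2 = (\<integral>x. (u x)\<^sup>2 + 2 * (u x * v x) + (v x)\<^sup>2 \<partial>lborel)"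
    by (simp add: sq_norm_power2 power2_sum algebra_simps)
  also have "\<dots> = (sq_norm u)\<^sup>2 + 2 * (\<integral>x. u x * v x \<partial>lborel) + (sq_norm v)\<^sup>2"
    using integrable_mult_sq[OF u v] sq_integrableD[OF u] sq_integrableD[OF v]
    by (simp add: sq_norm_power2)
  also have "\<dots> \<le> (sq_norm u + sq_norm v)\<^sup>2"
    using sq_norm_Cauchy_Schwarz[OF u v] by (simp add: power2_sum)
  finally show "(sq_norm (\<lambda>x. u x + v x))\<^sup>2 \<le> (sq_norm u + sq_norm v)\<^sup>2" .
qed simp

lemma sq_norm_diff_ge:
  assumes u: "sq_integrable u" and v: "sq_integrable v"
  shows "\<bar>sq_norm u - sq_norm v\<bar> \<le> sq_norm (\<lambda>x. u x - v x)"
  using sq_norm_triangle[OF sq_integrable_diff[OF u v] v] sq_norm_triangle[OF sq_integrable_diff[OF v u] u]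
    sq_norm_scale[of "-1" "\<lambda>x. u x - v x"] by simp

section \<open>A comparison principle\<close>

text \<open>At the last time \<open>t0\<close> with h + K not above the exponential, both sides have
  a common value y. With slack \<kappa> = y, h + K grows from there at rate at most 2 y, the slope
  of the exponential, which by convexity stays above its tangent; so the bound persists a little
  longer, a contradiction. The factor 2 in the exponent is the room taken by the slack.\<close>

lemma right_derivative_comparison:
  fixes h :: "real \<Rightarrow> real"
  assumes h: "continuous_on {0..T} h"
    and A: "A > 0" "h 0 + K < A"
    and deriv: "\<And>t \<kappa>. \<lbrakk>0 < t; t < T; \<kappa> > 0\<rbrakk> \<Longrightarrow>
      \<forall>\<^sub>F s in at_right t. h s \<le> h t + (s - t) * (K + h t + \<kappa>)"
    and t1: "t1 \<in> {0..T}"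
  shows "h t1 + K \<le> A * exp (2 * t1)"
proof (rule ccontr)
  assume neg: "\<not> h t1 + K \<le> A * exp (2 * t1)"
  define g where "g t = h t + K - A * exp (2 * t)" for t
  have g: "continuous_on {0..t1} g"
    unfolding g_def using t1 by (intro continuous_intros continuous_on_subset[OF h]) auto
  define S where "S = {0..t1} \<inter> g -` {..0}"
  have "closed S"
    unfolding S_def by (rule continuous_closed_preimage[OF g]) auto
  moreover have "bounded S"
    unfolding S_def by (rule bounded_subset[OF bounded_closed_interval]) auto
  ultimately have "compact S"
    unfolding compact_eq_bounded_closed by simp
  moreover have "0 \<in> S" using A t1 unfolding S_def g_def by simp
  ultimately obtain t0 where t0: "t0 \<in> S" "\<And>t. t \<in> S \<Longrightarrow> t \<le> t0"
    using compact_attains_sup[of S] by auto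
  have t01: "0 \<le> t0" "t0 \<le> t1" "g t0 \<le> 0" using t0(1) unfolding S_def by auto
  have "t0 \<noteq> t1" using neg t01 unfolding g_def by auto
  then have "t0 < t1" using t01 by simp
  have gpos: "g s > 0" if "t0 < s" "s \<le> t1" for s
    using t0(2)[of s] that t01 unfolding S_def by force
  have ev: "\<forall>\<^sub>F s in at_right t0. t0 < s \<and> s < t1"
    using \<open>t0 < t1\<close> by (auto simp: eventually_at_right)
  have "(g \<longlongrightarrow> g t0) (at_right t0)"
  proof -
    have "(g \<longlongrightarrow> g t0) (at t0 within {0..t1})" using g t01 by (auto simp: continuous_on_def)
    then have "(g \<longlongrightarrow> g t0) (at t0 within {t0..t1})"
      by (rule tendsto_within_subset) (use t01 in auto)
    then show ?thesis using \<open>t0 < t1\<close> by (simp add: at_within_Icc_at_right)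
  qed
  then have "0 \<le> g t0"
    by (rule tendsto_lowerbound) (use ev in eventually_elim, auto intro: less_imp_le gpos)
  then have g0: "g t0 = 0" using t01 by simp
  \<comment> \<open>Strictness of \<open>h 0 + K < A\<close> excludes the initial time, where no
    growth condition is assumed.\<close>
  have "t0 \<noteq> 0" using g0 A unfolding g_def by auto
  define y where "y = h t0 + K"
  have y: "y = A * exp (2 * t0)" "y > 0" using g0 A unfolding g_def y_def by auto
  have "\<forall>\<^sub>F s in at_right t0. h s \<le> h t0 + (s - t0) * (K + h t0 + y)"
    by (rule deriv) (use t01 \<open>t0 < t1\<close> \<open>t0 \<noteq> 0\<close> t1 y in auto)
  then obtain s where s: "h s \<le> h t0 + (s - t0) * (K + h t0 + y)" "t0 < s" "s < t1"
    using eventually_happens'[OF trivial_limit_at_right_real eventually_conj[OF _ ev]] by blast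
  have "h s + K \<le> y * (1 + 2 * (s - t0))"
    using s(1) unfolding y_def by (simp add: algebra_simps)
  also have "\<dots> \<le> y * exp (2 * (s - t0))"
    using y(2) exp_ge_add_one_self[of "2 * (s - t0)"] by (intro mult_left_mono) auto
  also have "\<dots> = A * exp (2 * s)"
    unfolding y(1) by (simp add: mult.assoc flip: exp_add)
  finally have "g s \<le> 0" unfolding g_def by simp
  then show False using gpos[of s] s by simp
qed

section \<open>Product integrals of a kernel and a shifted function\<close>

text \<open>For fixed \<xi>, translation invariance removes the shift from the inner integral, so
  the double integral factors for every \<open>s\<close>.\<close>

lemma integrable_kernel_shift:
  fixes k w :: "'a::euclidean_space \<Rightarrow> real"
  assumes k: "integrable lborel k" and w: "integrable lborel w"
  shows "integrable (lborel \<Otimes>\<^sub>M lborel) (\<lambda>p. k (fst p) * w (snd p + s *\<^sub>R fst p))"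
    "(\<integral>p. k (fst p) * w (snd p + s *\<^sub>R fst p) \<partial>(lborel \<Otimes>\<^sub>M lborel)) =
      (\<integral>\<xi>. k \<xi> \<partial>lborel) * (\<integral>x. w x \<partial>lborel)"
proof -
  have [measurable]: "k \<in> borel_measurable borel" "w \<in> borel_measurable borel"
    using k w by auto
  have t: "integrable lborel (\<lambda>x. w (x + a))" "(\<integral>x. w (x + a) \<partial>lborel) = (\<integral>x. w x \<partial>lborel)"
    "(\<integral>x. \<bar>w (x + a)\<bar> \<partial>lborel) = (\<integral>x. \<bar>w x\<bar> \<partial>lborel)" for a
    using integral_lborel_translate[OF w, of a] integral_lborel_translate[of "\<lambda>x. \<bar>w x\<bar>" a] w by auto
  show i: "integrable (lborel \<Otimes>\<^sub>M lborel) (\<lambda>p. k (fst p) * w (snd p + s *\<^sub>R fst p))"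
  proof (rule lborel_pair.Fubini_integrable)
    show "integrable lborel (\<lambda>x. \<integral>y. norm (k (fst (x, y)) * w (snd (x, y) + s *\<^sub>R fst (x, y))) \<partial>lborel)"
      using k by (simp add: abs_mult t)
  qed (auto intro!: integrable_mult_right t)
  show "(\<integral>p. k (fst p) * w (snd p + s *\<^sub>R fst p) \<partial>(lborel \<Otimes>\<^sub>M lborel)) =
      (\<integral>\<xi>. k \<xi> \<partial>lborel) * (\<integral>x. w x \<partial>lborel)"
    by (subst lborel_pair.integral_fst'[OF i, symmetric]) (simp add: t)
qed

section \<open>The potential energy of a bond model\<close>

text \<open>Concavity is recorded as the tangent inequality \<open>f_tangent\<close>, and
  \<open>c\<close> bounds the slope; it will be f'(0). The functions are total and Borel, but
  constrained only on the half-line, where all arguments lie. \<open>j\<close> stands for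
  J(|\<xi>|), cut off outside the unit disc.\<close>

locale bond_model =
  fixes f f' :: "real \<Rightarrow> real" and j :: "real^2 \<Rightarrow> real" and \<epsilon> c M :: real
  assumes f_meas [measurable]: "f \<in> borel_measurable borel"
    and f'_meas [measurable]: "f' \<in> borel_measurable borel"
    and j_meas [measurable]: "j \<in> borel_measurable borel"
    and eps: "\<epsilon> > 0"
    and j_bounds: "\<And>\<xi>. 0 \<le> j \<xi>" "\<And>\<xi>. j \<xi> \<le> M"
    and j_support: "\<And>\<xi>. norm \<xi> \<ge> 1 \<Longrightarrow> j \<xi> = 0"
    and f_bounds: "\<And>r. 0 \<le> r \<Longrightarrow> 0 \<le> f r" "\<And>r. 0 \<le> r \<Longrightarrow> f r \<le> c * r"
    and f'_bounds: "\<And>r. 0 \<le> r \<Longrightarrow> 0 \<le> f' r" "\<And>r. 0 \<le> r \<Longrightarrow> f' r \<le> c"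
    and f_tangent: "\<And>r s. 0 \<le> r \<Longrightarrow> 0 \<le> s \<Longrightarrow> f s \<le> f r + f' r * (s - r)"
begin

text \<open>Weight of the quadratic upper bound: f(r) \<le> c r bounds the density by c k \<eta>^2.
  Its singularity 1/|\<xi>| is integrable in the plane.\<close>

definition k :: "real^2 \<Rightarrow> real" where "k \<xi> = j \<xi> / (\<epsilon> * norm \<xi>)"

definition kint :: real where "kint = (\<integral>\<xi>. k \<xi> \<partial>lborel)"

definition bdiff :: "(real^2 \<Rightarrow> real) \<Rightarrow> real^2 \<Rightarrow> real^2 \<Rightarrow> real" where
  "bdiff v \<xi> x = v (x + \<epsilon> *\<^sub>R \<xi>) - v x"

definition dens :: "(real^2 \<Rightarrow> real) \<Rightarrow> real^2 \<Rightarrow> real^2 \<Rightarrow> real" where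
  "dens v \<xi> x = j \<xi> * f ((bdiff v \<xi> x)\<^sup>2 / (\<epsilon> * norm \<xi>))"

definition energy :: "(real^2 \<Rightarrow> real) \<Rightarrow> real" where
  "energy v = (1 / \<epsilon>) * (\<integral>p. dens v (fst p) (snd p) \<partial>(lborel \<Otimes>\<^sub>M lborel))"

text \<open>Derivative of the bond density with respect to the increment
  \<open>bdiff v \<xi> x\<close>.\<close>

definition force :: "(real^2 \<Rightarrow> real) \<Rightarrow> real^2 \<Rightarrow> real^2 \<Rightarrow> real" where
  "force v \<xi> x = 2 * k \<xi> * f' ((bdiff v \<xi> x)\<^sup>2 / (\<epsilon> * norm \<xi>)) * bdiff v \<xi> x"

text \<open>The adjoint of the bond difference applied to \<open>force\<close>. It will be
  identified with \<open>grad_PD\<close> almost everywhere on \<open>D\<close>.\<close>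

definition grad :: "(real^2 \<Rightarrow> real) \<Rightarrow> real^2 \<Rightarrow> real" where
  "grad v x = (1 / \<epsilon>) * (\<integral>\<xi>. force v \<xi> (x - \<epsilon> *\<^sub>R \<xi>) - force v \<xi> x \<partial>lborel)"

lemma k_meas [measurable]: "k \<in> borel_measurable borel"
  unfolding k_def[abs_def] by measurable

lemma k_nonneg: "0 \<le> k \<xi>"
  using eps j_bounds(1)[of \<xi>] by (simp add: k_def)

lemma c_nonneg: "0 \<le> c"
  using f'_bounds[of 0] by simp

lemma M_nonneg: "0 \<le> M"
  using j_bounds[of 0] by simp

lemma k_integrable: "integrable lborel k"
proof (rule integrableI_bounded)
  have "(\<integral>\<^sup>+\<xi>. ennreal (norm (k \<xi>)) \<partial>lborel)
      \<le> (\<integral>\<^sup>+\<xi>. ennreal (M / \<epsilon>) * (ennreal (1 / norm \<xi>) * indicator (ball 0 1) (\<xi> :: real^2)) \<partial>lborel)"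
  proof (rule nn_integral_mono)
    fix \<xi> :: "real^2"
    have "k \<xi> \<le> (M / \<epsilon>) * (1 / norm \<xi>)"
      unfolding k_def using j_bounds(2)[of \<xi>] eps by (simp add: divide_right_mono)
    moreover have "k \<xi> = 0" if "norm \<xi> \<ge> 1" using that by (simp add: k_def j_support)
    ultimately show "ennreal (norm (k \<xi>)) \<le> ennreal (M / \<epsilon>) * (ennreal (1 / norm \<xi>) * indicator (ball 0 1) \<xi>)"
      using k_nonneg[of \<xi>] M_nonneg eps
      by (cases "norm \<xi> < 1") (auto simp: indicator_def simp flip: ennreal_mult' intro!: ennreal_leI)
  qed
  also have "\<dots> = ennreal (M / \<epsilon>) * (\<integral>\<^sup>+\<xi>. ennreal (1 / norm \<xi>) * indicator (ball 0 1) (\<xi> :: real^2) \<partial>lborel)"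
    by (intro nn_integral_cmult borel_measurable_times_ennreal borel_measurable_indicator) simp_all
  also have "\<dots> < \<infinity>"
    using nn_integral_inverse_norm_ball by (simp add: ennreal_mult_less_top)
  finally show "(\<integral>\<^sup>+\<xi>. ennreal (norm (k \<xi>)) \<partial>lborel) < \<infinity>" .
qed measurable

lemma kint_nonneg: "0 \<le> kint"
  unfolding kint_def by (simp add: k_nonneg)

lemma integrable_k_shift:
  assumes "sq_integrable v"
  shows "integrable (lborel \<Otimes>\<^sub>M lborel) (\<lambda>p. k (fst p) * (v (snd p + s *\<^sub>R fst p))\<^sup>2)"
    "(\<integral>p. k (fst p) * (v (snd p + s *\<^sub>R fst p))\<^sup>2 \<partial>(lborel \<Otimes>\<^sub>M lborel)) = kint * (sq_norm v)\<^sup>2"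
  using integrable_kernel_shift[OF k_integrable sq_integrableD(3)[OF assms], of s]
  by (simp_all add: kint_def sq_norm_power2)

lemmas integrable_k = integrable_k_shift[where s=0, simplified]

lemma bdiff_meas [measurable (raw)]:
  assumes [measurable]: "v \<in> borel_measurable borel" "g \<in> N \<rightarrow>\<^sub>M borel" "h \<in> N \<rightarrow>\<^sub>M borel"
  shows "(\<lambda>p. bdiff v (g p) (h p)) \<in> borel_measurable N"
  unfolding bdiff_def[abs_def] by measurable

lemma dens_meas [measurable (raw)]:
  assumes [measurable]: "v \<in> borel_measurable borel" "g \<in> N \<rightarrow>\<^sub>M borel" "h \<in> N \<rightarrow>\<^sub>M borel"
  shows "(\<lambda>p. dens v (g p) (h p)) \<in> borel_measurable N"
  unfolding dens_def[abs_def] by measurable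

lemma force_meas [measurable (raw)]:
  assumes [measurable]: "v \<in> borel_measurable borel" "g \<in> N \<rightarrow>\<^sub>M borel" "h \<in> N \<rightarrow>\<^sub>M borel"
  shows "(\<lambda>p. force v (g p) (h p)) \<in> borel_measurable N"
  unfolding force_def[abs_def] by measurable

text \<open>The crude inequality (a - b)^2 \<le> 2 a^2 + 2 b^2 suffices. The constant degenerates as
  \<epsilon> tends to 0, but it serves only at a fixed horizon, for integrability and for remainders
  that vanish in the time limit.\<close>

lemma k_bdiff:
  assumes v: "sq_integrable v"
  shows "integrable (lborel \<Otimes>\<^sub>M lborel) (\<lambda>p. k (fst p) * (bdiff v (fst p) (snd p))\<^sup>2)"
    "(\<integral>p. k (fst p) * (bdiff v (fst p) (snd p))\<^sup>2 \<partial>(lborel \<Otimes>\<^sub>M lborel)) \<le> 4 * kint * (sq_norm v)\<^sup>2"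
proof -
  note [measurable] = sq_integrableD(1)[OF v]
  let ?g = "\<lambda>p. 2 * (k (fst p) * (v (snd p + \<epsilon> *\<^sub>R fst p))\<^sup>2) + 2 * (k (fst p) * (v (snd p))\<^sup>2)"
  have i: "integrable (lborel \<Otimes>\<^sub>M lborel) ?g"
    using integrable_k_shift[OF v, of \<epsilon>] integrable_k[OF v] by simp
  have le: "k (fst p) * (bdiff v (fst p) (snd p))\<^sup>2 \<le> ?g p" for p
  proof -
    have "(bdiff v (fst p) (snd p))\<^sup>2 \<le> 2 * (v (snd p + \<epsilon> *\<^sub>R fst p))\<^sup>2 + 2 * (v (snd p))\<^sup>2"
      using sum_squares_bound[of "v (snd p + \<epsilon> *\<^sub>R fst p)" "- v (snd p)"]
      by (simp add: bdiff_def power2_diff)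
    from mult_left_mono[OF this k_nonneg[of "fst p"]] show ?thesis by (simp add: algebra_simps)
  qed
  show i2: "integrable (lborel \<Otimes>\<^sub>M lborel) (\<lambda>p. k (fst p) * (bdiff v (fst p) (snd p))\<^sup>2)"
    by (rule Bochner_Integration.integrable_bound[OF i])
      (measurable, use le k_nonneg in \<open>auto intro!: order_trans[OF le abs_ge_self]\<close>)
  show "(\<integral>p. k (fst p) * (bdiff v (fst p) (snd p))\<^sup>2 \<partial>(lborel \<Otimes>\<^sub>M lborel)) \<le> 4 * kint * (sq_norm v)\<^sup>2"
    using integral_mono[OF i2 i le] integrable_k_shift[OF v, of \<epsilon>] integrable_k[OF v] by simp
qed

lemma bond_nonneg: "0 \<le> (bdiff v \<xi> x)\<^sup>2 / (\<epsilon> * norm \<xi>)"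
  using eps by simp

lemma dens_bounds: "0 \<le> dens v \<xi> x" "dens v \<xi> x \<le> c * (k \<xi> * (bdiff v \<xi> x)\<^sup>2)"
proof -
  show "0 \<le> dens v \<xi> x"
    unfolding dens_def using j_bounds(1) f_bounds(1)[OF bond_nonneg] by simp
  show "dens v \<xi> x \<le> c * (k \<xi> * (bdiff v \<xi> x)\<^sup>2)"
    using mult_left_mono[OF f_bounds(2)[OF bond_nonneg] j_bounds(1)[of \<xi>]]
    by (simp add: dens_def k_def mult_ac)
qed

lemma dens_integrable:
  assumes v: "sq_integrable v"
  shows "integrable (lborel \<Otimes>\<^sub>M lborel) (\<lambda>p. dens v (fst p) (snd p))"
proof -
  note [measurable] = sq_integrableD(1)[OF v]
  have "integrable (lborel \<Otimes>\<^sub>M lborel) (\<lambda>p. c * (k (fst p) * (bdiff v (fst p) (snd p))\<^sup>2))"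
    using k_bdiff[OF v] by simp
  then show ?thesis
    by (rule Bochner_Integration.integrable_bound)
      (measurable, use dens_bounds in \<open>auto intro!: order_trans[OF _ abs_ge_self]\<close>)
qed

lemma energy_nonneg: "0 \<le> energy v"
  unfolding energy_def using eps by (simp add: dens_bounds)

lemma force_bound: "\<bar>force v \<xi> x\<bar> \<le> 2 * c * (k \<xi> * \<bar>bdiff v \<xi> x\<bar>)"
proof -
  have "\<bar>force v \<xi> x\<bar> = 2 * k \<xi> * f' ((bdiff v \<xi> x)\<^sup>2 / (\<epsilon> * norm \<xi>)) * \<bar>bdiff v \<xi> x\<bar>"
    unfolding force_def using k_nonneg f'_bounds(1)[OF bond_nonneg] by (simp add: abs_mult)
  also have "\<dots> \<le> 2 * k \<xi> * c * \<bar>bdiff v \<xi> x\<bar>"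
    using k_nonneg f'_bounds(2)[OF bond_nonneg] by (intro mult_right_mono mult_left_mono) auto
  finally show ?thesis by (simp add: mult_ac)
qed

text \<open>Young's inequality. The weight \<theta> is left free because continuity of the energy
  needs it small, while the term divided by \<theta> tends to zero.\<close>

lemma force_mult_bound:
  assumes "\<theta> > 0"
  shows "\<bar>force v \<xi> x * a\<bar> \<le> c * (\<theta> * (k \<xi> * (bdiff v \<xi> x)\<^sup>2)) + c * (k \<xi> * a\<^sup>2) / \<theta>"
proof -
  have "0 \<le> (\<theta> * \<bar>bdiff v \<xi> x\<bar> - \<bar>a\<bar>)\<^sup>2 / \<theta>" using assms by simp
  also have "\<dots> = \<theta> * (bdiff v \<xi> x)\<^sup>2 - 2 * \<bar>bdiff v \<xi> x\<bar> * \<bar>a\<bar> + a\<^sup>2 / \<theta>"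
    using assms by (simp add: power2_eq_square field_simps)
  finally have "2 * (\<bar>bdiff v \<xi> x\<bar> * \<bar>a\<bar>) \<le> \<theta> * (bdiff v \<xi> x)\<^sup>2 + a\<^sup>2 / \<theta>" by simp
  from mult_left_mono[OF this, of "c * k \<xi>"]
  have "2 * c * (k \<xi> * \<bar>bdiff v \<xi> x\<bar>) * \<bar>a\<bar> \<le> c * (\<theta> * (k \<xi> * (bdiff v \<xi> x)\<^sup>2)) + c * (k \<xi> * a\<^sup>2) / \<theta>"
    using c_nonneg k_nonneg by (simp add: algebra_simps)
  with mult_right_mono[OF force_bound[of v \<xi> x] abs_ge_zero[of a]] show ?thesis
    by (simp add: abs_mult)
qed

text \<open>The two values of \<open>s\<close> correspond to the two terms
  \<open>force u \<xi> x\<close> and \<open>force u \<xi> (x - \<epsilon> *\<^sub>R \<xi>)\<close>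
  of \<open>grad\<close>.\<close>

lemma force_mult_integrable:
  assumes u: "sq_integrable u"
    and a: "(\<lambda>p. a (fst p) (snd p)) \<in> borel_measurable (lborel \<Otimes>\<^sub>M lborel)"
      "integrable (lborel \<Otimes>\<^sub>M lborel) (\<lambda>p. k (fst p) * (a (fst p) (snd p))\<^sup>2)"
    and y: "s = 0 \<or> s = - \<epsilon>"
  shows "integrable (lborel \<Otimes>\<^sub>M lborel) (\<lambda>p. force u (fst p) (snd p + s *\<^sub>R fst p) * a (fst p) (snd p))"
proof -
  note [measurable] = sq_integrableD(1)[OF u] a(1)
  have i: "integrable (lborel \<Otimes>\<^sub>M lborel) (\<lambda>p. k (fst p) * (bdiff u (fst p) (snd p + s *\<^sub>R fst p))\<^sup>2)"
  proof -
    let ?g = "\<lambda>p. 2 * (k (fst p) * (u (snd p + (s + \<epsilon>) *\<^sub>R fst p))\<^sup>2) + 2 * (k (fst p) * (u (snd p + s *\<^sub>R fst p))\<^sup>2)"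
    have "integrable (lborel \<Otimes>\<^sub>M lborel) ?g"
      using integrable_k_shift[OF u] by simp
    moreover have le: "k (fst p) * (bdiff u (fst p) (snd p + s *\<^sub>R fst p))\<^sup>2 \<le> ?g p" for p
    proof -
      have "(bdiff u (fst p) (snd p + s *\<^sub>R fst p))\<^sup>2
          \<le> 2 * (u (snd p + (s + \<epsilon>) *\<^sub>R fst p))\<^sup>2 + 2 * (u (snd p + s *\<^sub>R fst p))\<^sup>2"
        using sum_squares_bound[of "u (snd p + (s + \<epsilon>) *\<^sub>R fst p)" "- u (snd p + s *\<^sub>R fst p)"]
        by (simp add: bdiff_def power2_diff scaleR_add_left add.assoc)
      from mult_left_mono[OF this k_nonneg[of "fst p"]] show ?thesis by (simp add: algebra_simps)
    qed
    ultimately show ?thesis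
      by (elim Bochner_Integration.integrable_bound)
        (measurable, use le k_nonneg in \<open>auto intro!: order_trans[OF le abs_ge_self]\<close>)
  qed
  let ?h = "\<lambda>p. c * (1 * (k (fst p) * (bdiff u (fst p) (snd p + s *\<^sub>R fst p))\<^sup>2)) + c * (k (fst p) * (a (fst p) (snd p))\<^sup>2) / 1"
  have "integrable (lborel \<Otimes>\<^sub>M lborel) ?h" using i a(2) by simp
  then show ?thesis
  proof (rule Bochner_Integration.integrable_bound)
    show "AE p in lborel \<Otimes>\<^sub>M lborel. norm (force u (fst p) (snd p + s *\<^sub>R fst p) * a (fst p) (snd p)) \<le> norm (?h p)"
      by (rule AE_I2, unfold real_norm_def, rule order_trans[OF force_mult_bound[of 1] abs_ge_self]) simp
  qed measurable
qed

text \<open>First variation of \<open>energy\<close> at \<open>u\<close> in the direction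
  \<open>v\<close>.\<close>

definition pairing :: "(real^2 \<Rightarrow> real) \<Rightarrow> (real^2 \<Rightarrow> real) \<Rightarrow> real" where
  "pairing u v = (1 / \<epsilon>) * (\<integral>p. force u (fst p) (snd p) * bdiff v (fst p) (snd p) \<partial>(lborel \<Otimes>\<^sub>M lborel))"

lemma force_bdiff_integrable:
  assumes u: "sq_integrable u" and v: "sq_integrable v"
  shows "integrable (lborel \<Otimes>\<^sub>M lborel) (\<lambda>p. force u (fst p) (snd p) * bdiff v (fst p) (snd p))"
proof -
  note [measurable] = sq_integrableD(1)[OF v]
  show ?thesis
    using force_mult_integrable[OF u _ k_bdiff(1)[OF v], of 0] by simp
qed

lemma pairing_bound:
  assumes u: "sq_integrable u" and v: "sq_integrable v" and \<theta>: "\<theta> > 0"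
  shows "\<bar>pairing u v\<bar> \<le> 4 * c * kint / \<epsilon> * (\<theta> * (sq_norm u)\<^sup>2 + (sq_norm v)\<^sup>2 / \<theta>)"
proof -
  let ?M = "lborel \<Otimes>\<^sub>M lborel :: ((real^2) \<times> (real^2)) measure"
  let ?a = "\<integral>p. k (fst p) * (bdiff u (fst p) (snd p))\<^sup>2 \<partial>?M"
  let ?b = "\<integral>p. k (fst p) * (bdiff v (fst p) (snd p))\<^sup>2 \<partial>?M"
  have "\<bar>\<integral>p. force u (fst p) (snd p) * bdiff v (fst p) (snd p) \<partial>?M\<bar>
     \<le> (\<integral>p. c * (\<theta> * (k (fst p) * (bdiff u (fst p) (snd p))\<^sup>2))
          + c * (k (fst p) * (bdiff v (fst p) (snd p))\<^sup>2) / \<theta> \<partial>?M)"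
    using force_bdiff_integrable[OF u v] k_bdiff(1)[OF u] k_bdiff(1)[OF v]
    by (intro order_trans[OF integral_abs_bound] integral_mono force_mult_bound \<theta>) auto
  also have "\<dots> = c * (\<theta> * ?a) + c * ?b / \<theta>"
    using k_bdiff(1)[OF u] k_bdiff(1)[OF v] by simp
  also have "\<dots> \<le> c * (\<theta> * (4 * kint * (sq_norm u)\<^sup>2)) + c * (4 * kint * (sq_norm v)\<^sup>2) / \<theta>"
    using k_bdiff(2)[OF u] k_bdiff(2)[OF v] c_nonneg \<theta>
    by (intro add_mono mult_left_mono divide_right_mono) auto
  finally show ?thesis
    unfolding pairing_def using eps \<theta> by (simp add: abs_mult field_simps)
qed

text \<open>Concavity of \<open>f\<close> bounds the energy from above by its quadratic expansion; the derivative of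
  \<open>\<eta> \<mapsto> f (\<eta>\<^sup>2)\<close> need not be Lipschitz, so no matching lower bound is available.\<close>

lemma energy_semiconcave:
  assumes u: "sq_integrable u" and w: "sq_integrable w"
  shows "energy w \<le> energy u + pairing u (\<lambda>x. w x - u x) + 4 * c * kint / \<epsilon> * (sq_norm (\<lambda>x. w x - u x))\<^sup>2"
proof -
  let ?M = "lborel \<Otimes>\<^sub>M lborel :: ((real^2) \<times> (real^2)) measure"
  let ?d = "\<lambda>x. w x - u x"
  have d: "sq_integrable ?d" by (rule sq_integrable_diff[OF w u])
  have pw: "dens w \<xi> x \<le> dens u \<xi> x + force u \<xi> x * bdiff ?d \<xi> x + c * (k \<xi> * (bdiff ?d \<xi> x)\<^sup>2)" for \<xi> x
  proof (cases "\<xi> = 0")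
    case True
    then show ?thesis using c_nonneg k_nonneg by (simp add: dens_def force_def bdiff_def k_def)
  next
    case False
    let ?a = "bdiff u \<xi> x" and ?e = "bdiff ?d \<xi> x" and ?c = "\<epsilon> * norm \<xi>"
    have cpos: "?c > 0" using False eps by simp
    have wa: "bdiff w \<xi> x = ?a + ?e" by (simp add: bdiff_def)
    have "f ((?a + ?e)\<^sup>2 / ?c) \<le> f (?a\<^sup>2 / ?c) + f' (?a\<^sup>2 / ?c) * ((?a + ?e)\<^sup>2 / ?c - ?a\<^sup>2 / ?c)"
      by (rule f_tangent) (use cpos in auto)
    \<comment> \<open>The part linear in \<open>?e\<close> is the force term; the square is kept
      separate and paid for with f' \<le> c.\<close>
    also have "(?a + ?e)\<^sup>2 / ?c - ?a\<^sup>2 / ?c = 2 * ?a * ?e / ?c + ?e\<^sup>2 / ?c"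
      by (simp add: power2_sum add_divide_distrib)
    also have "f' (?a\<^sup>2 / ?c) * (2 * ?a * ?e / ?c + ?e\<^sup>2 / ?c)
        \<le> f' (?a\<^sup>2 / ?c) * (2 * ?a * ?e / ?c) + c * (?e\<^sup>2 / ?c)"
      unfolding distrib_left using cpos by (intro add_left_mono mult_right_mono f'_bounds) auto
    finally have "f ((?a + ?e)\<^sup>2 / ?c) \<le> f (?a\<^sup>2 / ?c) + (f' (?a\<^sup>2 / ?c) * (2 * ?a * ?e / ?c) + c * (?e\<^sup>2 / ?c))"
      by simp
    from mult_left_mono[OF this j_bounds(1)[of \<xi>]] show ?thesis
      unfolding dens_def wa by (simp add: force_def k_def algebra_simps)
  qed
  have "(\<integral>p. dens w (fst p) (snd p) \<partial>?M) \<le> (\<integral>p. dens u (fst p) (snd p)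
      + force u (fst p) (snd p) * bdiff ?d (fst p) (snd p) + c * (k (fst p) * (bdiff ?d (fst p) (snd p))\<^sup>2) \<partial>?M)"
    using dens_integrable[OF w] dens_integrable[OF u] force_bdiff_integrable[OF u d] k_bdiff(1)[OF d]
    by (intro integral_mono pw) auto
  also have "\<dots> = (\<integral>p. dens u (fst p) (snd p) \<partial>?M) + (\<integral>p. force u (fst p) (snd p) * bdiff ?d (fst p) (snd p) \<partial>?M)
      + c * (\<integral>p. k (fst p) * (bdiff ?d (fst p) (snd p))\<^sup>2 \<partial>?M)"
    using dens_integrable[OF u] force_bdiff_integrable[OF u d] k_bdiff(1)[OF d] by simp
  also have "\<dots> \<le> (\<integral>p. dens u (fst p) (snd p) \<partial>?M) + (\<integral>p. force u (fst p) (snd p) * bdiff ?d (fst p) (snd p) \<partial>?M)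
      + c * (4 * kint * (sq_norm ?d)\<^sup>2)"
    using k_bdiff(2)[OF d] c_nonneg by (intro add_left_mono mult_left_mono) auto
  finally have "(1 / \<epsilon>) * (\<integral>p. dens w (fst p) (snd p) \<partial>?M) \<le> (1 / \<epsilon>) * \<dots>"
    using eps by (intro mult_left_mono) auto
  then show ?thesis
    unfolding energy_def pairing_def by (simp add: algebra_simps)
qed

text \<open>Semiconcavity is used from \<open>u\<close> to \<open>w\<close> and from
  \<open>w\<close> to \<open>u\<close>; with the Young bound on \<open>pairing\<close> this gives a
  two-sided estimate.\<close>

lemma energy_diff_bound:
  assumes u: "sq_integrable u" and w: "sq_integrable w" and \<theta>: "\<theta> > 0"
  shows "\<bar>energy w - energy u\<bar> \<le> 4 * c * kint / \<epsilon> *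
    (\<theta> * ((sq_norm u)\<^sup>2 + (sq_norm w)\<^sup>2) + (1 / \<theta> + 1) * (sq_norm (\<lambda>x. w x - u x))\<^sup>2)"
proof -
  let ?C = "4 * c * kint / \<epsilon>"
  have C: "?C \<ge> 0" using c_nonneg kint_nonneg eps by simp
  have one: "energy w - energy u \<le> ?C *
    (\<theta> * ((sq_norm u)\<^sup>2 + (sq_norm w)\<^sup>2) + (1 / \<theta> + 1) * (sq_norm (\<lambda>x. w x - u x))\<^sup>2)"
    if u: "sq_integrable u" and w: "sq_integrable w" for u w
  proof -
    let ?d = "sq_norm (\<lambda>x. w x - u x)"
    have "energy w - energy u \<le> pairing u (\<lambda>x. w x - u x) + ?C * ?d\<^sup>2"
      using energy_semiconcave[OF u w] by simp
    also have "\<dots> \<le> ?C * (\<theta> * (sq_norm u)\<^sup>2 + ?d\<^sup>2 / \<theta>) + ?C * ?d\<^sup>2"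
      using pairing_bound[OF u sq_integrable_diff[OF w u] \<theta>] by linarith
    also have "\<dots> = ?C * (\<theta> * (sq_norm u)\<^sup>2 + (1 / \<theta> + 1) * ?d\<^sup>2)"
      by (simp add: algebra_simps)
    also have "\<dots> \<le> ?C * (\<theta> * ((sq_norm u)\<^sup>2 + (sq_norm w)\<^sup>2) + (1 / \<theta> + 1) * ?d\<^sup>2)"
      using \<theta> by (intro mult_left_mono[OF _ C] add_right_mono mult_left_mono) auto
    finally show ?thesis .
  qed
  have "sq_norm (\<lambda>x. u x - w x) = sq_norm (\<lambda>x. w x - u x)"
    using sq_norm_scale[of "-1" "\<lambda>x. w x - u x"] by simp
  then show ?thesis using one[OF u w] one[OF w u] by (simp add: abs_le_iff add.commute)
qed

text \<open>Discrete integration by parts: translating \<open>x\<close> along the bond moves the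
  shift in \<open>bdiff v\<close> onto the force, and exchanging the order of integration leaves
  \<open>grad u\<close> in front of \<open>v\<close>.\<close>

lemma pairing_eq_grad:
  assumes u: "sq_integrable u" and v: "sq_integrable v"
  shows "integrable lborel (\<lambda>x. grad u x * v x)" "pairing u v = (\<integral>x. grad u x * v x \<partial>lborel)"
proof -
  let ?M = "lborel \<Otimes>\<^sub>M lborel :: ((real^2) \<times> (real^2)) measure"
  note [measurable] = sq_integrableD(1)[OF u] sq_integrableD(1)[OF v]
  let ?F = "\<lambda>\<xi> x. force u \<xi> (x - \<epsilon> *\<^sub>R \<xi>) * v x"
  let ?G = "\<lambda>\<xi> x. force u \<xi> x * v x"
  have F: "integrable ?M (case_prod ?F)"
    using force_mult_integrable[OF u, of "\<lambda>_. v" "- \<epsilon>"] integrable_k(1)[OF v] by (simp add: split_beta')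
  have G: "integrable ?M (case_prod ?G)"
    using force_mult_integrable[OF u, of "\<lambda>_. v" 0] integrable_k(1)[OF v] by (simp add: split_beta')
  have H: "integrable ?M (\<lambda>p. force u (fst p) (snd p) * v (snd p + \<epsilon> *\<^sub>R fst p))"
    using force_mult_integrable[OF u, of "\<lambda>\<xi> x. v (x + \<epsilon> *\<^sub>R \<xi>)" 0] integrable_k_shift(1)[OF v] by simp
  have "(\<integral>p. force u (fst p) (snd p) * v (snd p + \<epsilon> *\<^sub>R fst p) \<partial>?M)
      = (\<integral>\<xi>. \<integral>x. force u \<xi> x * v (x + \<epsilon> *\<^sub>R \<xi>) \<partial>lborel \<partial>lborel)"
    using lborel_pair.integral_fst'[OF H] by simp
  also have "\<dots> = (\<integral>\<xi>. \<integral>x. ?F \<xi> x \<partial>lborel \<partial>lborel)"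
  proof (rule Bochner_Integration.integral_cong[OF refl])
    fix \<xi> :: "real^2"
    show "(\<integral>x. force u \<xi> x * v (x + \<epsilon> *\<^sub>R \<xi>) \<partial>lborel) = (\<integral>x. ?F \<xi> x \<partial>lborel)"
      using integral_lborel_affine[of "?F \<xi>" 1 "\<epsilon> *\<^sub>R \<xi>"] by (simp add: add.commute)
  qed
  also have "\<dots> = (\<integral>p. case_prod ?F p \<partial>?M)"
    using lborel_pair.integral_fst'[OF F] by simp
  finally have HF: "(\<integral>p. force u (fst p) (snd p) * v (snd p + \<epsilon> *\<^sub>R fst p) \<partial>?M) = (\<integral>p. case_prod ?F p \<partial>?M)" .
  have FG: "integrable ?M (case_prod (\<lambda>\<xi> x. ?F \<xi> x - ?G \<xi> x))"
    using Bochner_Integration.integrable_diff[OF F G] by (simp add: split_beta')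
  have eq: "AE x in lborel. (\<integral>\<xi>. ?F \<xi> x - ?G \<xi> x \<partial>lborel) = \<epsilon> * (grad u x * v x)"
  proof (rule AE_I2)
    fix x
    have "(\<integral>\<xi>. ?F \<xi> x - ?G \<xi> x \<partial>lborel) = (\<integral>\<xi>. (force u \<xi> (x - \<epsilon> *\<^sub>R \<xi>) - force u \<xi> x) * v x \<partial>lborel)"
      by (simp add: algebra_simps)
    also have "\<dots> = (\<integral>\<xi>. (force u \<xi> (x - \<epsilon> *\<^sub>R \<xi>) - force u \<xi> x) \<partial>lborel) * v x"
      by (rule integral_mult_left_zero)
    finally show "(\<integral>\<xi>. ?F \<xi> x - ?G \<xi> x \<partial>lborel) = \<epsilon> * (grad u x * v x)"
      using eps by (simp add: grad_def)
  qed
  have gm: "(\<lambda>x. \<epsilon> * (grad u x * v x)) \<in> borel_measurable lborel"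
    unfolding grad_def[abs_def] by measurable
  have im: "integrable lborel (\<lambda>x. \<integral>\<xi>. ?F \<xi> x - ?G \<xi> x \<partial>lborel)"
    using lborel_pair.integrable_snd[OF FG] .
  then have "integrable lborel (\<lambda>x. \<epsilon> * (grad u x * v x))"
    using integrable_cong_AE[OF _ gm eq] by auto
  then show "integrable lborel (\<lambda>x. grad u x * v x)" using eps by simp
  have "(\<integral>p. force u (fst p) (snd p) * bdiff v (fst p) (snd p) \<partial>?M)
     = (\<integral>p. force u (fst p) (snd p) * v (snd p + \<epsilon> *\<^sub>R fst p) - case_prod ?G p \<partial>?M)"
    by (simp add: bdiff_def algebra_simps split_beta')
  also have "\<dots> = (\<integral>p. case_prod ?F p \<partial>?M) - (\<integral>p. case_prod ?G p \<partial>?M)"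
    using H G HF by simp
  also have "\<dots> = (\<integral>p. case_prod (\<lambda>\<xi> x. ?F \<xi> x - ?G \<xi> x) p \<partial>?M)"
    using F G by (simp add: split_beta')
  also have "\<dots> = (\<integral>x. \<integral>\<xi>. ?F \<xi> x - ?G \<xi> x \<partial>lborel \<partial>lborel)"
    using lborel_pair.integral_snd[OF FG] by simp
  also have "\<dots> = (\<integral>x. \<epsilon> * (grad u x * v x) \<partial>lborel)"
    using im by (intro integral_cong_AE gm eq) auto
  finally show "pairing u v = (\<integral>x. grad u x * v x \<partial>lborel)"
    unfolding pairing_def using eps by simp
qed

end

section \<open>Differentiable curves of square integrable functions\<close>

definition sq_has_derivative ::
  "real \<Rightarrow> (real \<Rightarrow> 'a::euclidean_space \<Rightarrow> real) \<Rightarrow> (real \<Rightarrow> 'a \<Rightarrow> real) \<Rightarrow> bool" where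
  "sq_has_derivative T U U' \<longleftrightarrow>
     (\<forall>t\<in>{0..T}. ((\<lambda>s. sq_norm (\<lambda>x. (U s x - U t x) / (s - t) - U' t x)) \<longlongrightarrow> 0) (at t within {0..T}))"

lemma sq_has_derivative_imp_continuous:
  assumes U: "\<And>t. t \<in> {0..T} \<Longrightarrow> sq_integrable (U t)" "\<And>t. t \<in> {0..T} \<Longrightarrow> sq_integrable (U' t)"
    and d: "sq_has_derivative T U U'" and t: "t \<in> {0..T}"
  shows "((\<lambda>s. sq_norm (\<lambda>x. U s x - U t x)) \<longlongrightarrow> 0) (at t within {0..T})"
proof -
  let ?q = "\<lambda>s x. (U s x - U t x) / (s - t) - U' t x"
  have q: "sq_integrable (?q s)" if "s \<in> {0..T}" for s
    using sq_integrable_diff[OF sq_integrable_scale[OF sq_integrable_diff[OF U(1)[OF that] U(1)[OF t]], of "1 / (s - t)"] U(2)[OF t]]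
    by simp
  have lim: "((\<lambda>s. \<bar>s - t\<bar> * (sq_norm (U' t) + sq_norm (?q s))) \<longlongrightarrow> \<bar>t - t\<bar> * (sq_norm (U' t) + 0)) (at t within {0..T})"
    using d t unfolding sq_has_derivative_def by (intro tendsto_intros) auto
  show ?thesis
  proof (rule tendsto_sandwich[OF _ _ tendsto_const])
    show "\<forall>\<^sub>F s in at t within {0..T}. sq_norm (\<lambda>x. U s x - U t x) \<le> \<bar>s - t\<bar> * (sq_norm (U' t) + sq_norm (?q s))"
      unfolding eventually_at_filter
    proof (rule always_eventually, intro allI impI)
      fix s assume s: "s \<noteq> t" "s \<in> {0..T}"
      have "(\<lambda>x. U s x - U t x) = (\<lambda>x. (s - t) * (U' t x + ?q s x))" using s by (auto simp: fun_eq_iff field_simps)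
      then have "sq_norm (\<lambda>x. U s x - U t x) = sq_norm (\<lambda>x. (s - t) * (U' t x + ?q s x))"
        by (rule arg_cong)
      also have "\<dots> = \<bar>s - t\<bar> * sq_norm (\<lambda>x. U' t x + ?q s x)"
        by (rule sq_norm_scale)
      also have "\<dots> \<le> \<bar>s - t\<bar> * (sq_norm (U' t) + sq_norm (?q s))"
        by (intro mult_left_mono sq_norm_triangle U t q s) auto
      finally show "sq_norm (\<lambda>x. U s x - U t x) \<le> \<bar>s - t\<bar> * (sq_norm (U' t) + sq_norm (?q s))" .
    qed
    show "((\<lambda>s. \<bar>s - t\<bar> * (sq_norm (U' t) + sq_norm (?q s))) \<longlongrightarrow> 0) (at t within {0..T})"
      using lim by simp
  qed simp
qed

lemma sq_norm_continuous_on: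
  assumes U: "\<And>t. t \<in> {0..T} \<Longrightarrow> sq_integrable (U t)"
    and c: "\<And>t. t \<in> {0..T} \<Longrightarrow> ((\<lambda>s. sq_norm (\<lambda>x. U s x - U t x)) \<longlongrightarrow> 0) (at t within {0..T})"
  shows "continuous_on {0..T} (\<lambda>t. sq_norm (U t))"
  unfolding continuous_on_def
proof
  fix t assume t: "t \<in> {0..T}"
  show "((\<lambda>t. sq_norm (U t)) \<longlongrightarrow> sq_norm (U t)) (at t within {0..T})"
  proof (rule LIM_zero_cancel, rule Lim_null_comparison[OF _ c[OF t]])
    show "\<forall>\<^sub>F s in at t within {0..T}. norm (sq_norm (U s) - sq_norm (U t)) \<le> sq_norm (\<lambda>x. U s x - U t x)"
      unfolding eventually_at_filter
      by (rule always_eventually) (auto intro!: sq_norm_diff_ge U t[simplified])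
  qed
qed

section \<open>Energy along a curve and along the evolution\<close>

context bond_model
begin

lemma energy_continuous_on:
  assumes U: "\<And>t. t \<in> {0..T} \<Longrightarrow> sq_integrable (U t)"
    and c: "\<And>t. t \<in> {0..T} \<Longrightarrow> ((\<lambda>s. sq_norm (\<lambda>x. U s x - U t x)) \<longlongrightarrow> 0) (at t within {0..T})"
  shows "continuous_on {0..T} (\<lambda>t. energy (U t))"
  unfolding continuous_on_def
proof
  fix t assume t: "t \<in> {0..T}"
  let ?F = "at t within {0..T}"
  let ?C = "4 * c * kint / \<epsilon>"
  have C: "?C \<ge> 0" using c_nonneg kint_nonneg eps by simp
  have nt: "((\<lambda>s. sq_norm (U s)) \<longlongrightarrow> sq_norm (U t)) ?F"
    using sq_norm_continuous_on[OF U c] t by (auto simp: continuous_on_def)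
  show "((\<lambda>t. energy (U t)) \<longlongrightarrow> energy (U t)) ?F"
  proof (rule tendstoI)
    fix e :: real assume e: "e > 0"
    define R where "R = (sq_norm (U t))\<^sup>2 + ((sq_norm (U t))\<^sup>2)"
    have R: "R \<ge> 0" unfolding R_def by simp
    \<comment> \<open>\<theta> is fixed before the limit: it pushes the term that survives as
      \<open>s\<close> tends to \<open>t\<close>, of value \<open>?C * (\<theta> * R)\<close>, below
      \<open>e\<close>; the term with 1 / \<theta> vanishes in the limit.\<close>
    define \<theta> where "\<theta> = e / (2 * (?C * R + 1))"
    have CR: "?C * R \<ge> 0" using C R by (rule mult_nonneg_nonneg)
    have \<theta>: "\<theta> > 0" using e CR unfolding \<theta>_def by simp
    have small: "?C * (\<theta> * R) < e"
    proof -
      have "?C * (\<theta> * R) = e * (?C * R / (2 * (?C * R + 1)))" unfolding \<theta>_def by simp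
      also have "\<dots> < e * 1"
      proof (rule mult_strict_left_mono[OF _ e])
        have "X / (2 * (X + 1)) < 1" if "X \<ge> 0" for X :: real using that by (simp add: field_simps)
        from this[OF CR] show "?C * R / (2 * (?C * R + 1)) < 1" .
      qed
      finally show ?thesis by simp
    qed
    let ?g = "\<lambda>s. ?C * (\<theta> * ((sq_norm (U t))\<^sup>2 + (sq_norm (U s))\<^sup>2) + (1 / \<theta> + 1) * (sq_norm (\<lambda>x. U s x - U t x))\<^sup>2)"
    have "(?g \<longlongrightarrow> ?C * (\<theta> * ((sq_norm (U t))\<^sup>2 + (sq_norm (U t))\<^sup>2) + (1 / \<theta> + 1) * 0\<^sup>2)) ?F"
      by (intro tendsto_intros nt c[OF t])
    then have "(?g \<longlongrightarrow> ?C * (\<theta> * R)) ?F" unfolding R_def by simp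
    from order_tendstoD(2)[OF this small]
    have "\<forall>\<^sub>F s in ?F. ?g s < e" .
    moreover have "\<forall>\<^sub>F s in ?F. s \<in> {0..T}" by (simp add: eventually_at_filter)
    ultimately show "\<forall>\<^sub>F s in ?F. dist (energy (U s)) (energy (U t)) < e"
    proof eventually_elim
      case (elim s)
      show ?case
        unfolding dist_real_def
        by (rule le_less_trans[OF energy_diff_bound[OF U[OF t] U[OF elim(2)] \<theta>] elim(1)])
    qed
  qed
qed

text \<open>Inserting the equation into the first variation produces -\<rho> times the integral of
  U2 U1, which cancels against the growth of the kinetic energy. What remains is the power of the
  load, at most K + h. The horizon enters the bound only through the initial energy, because
  \<open>?C\<close> is multiplied by s - t before the limit.\<close>

lemma evolution_energy_bound:
  assumes T: "T > 0" and \<rho>: "\<rho> > 0"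
    and U: "\<And>t. t \<in> {0..T} \<Longrightarrow> sq_integrable (U t)"
    and U1: "\<And>t. t \<in> {0..T} \<Longrightarrow> sq_integrable (U1 t)"
    and U2: "\<And>t. t \<in> {0..T} \<Longrightarrow> sq_integrable (U2 t)"
    and F: "\<And>t. t \<in> {0..T} \<Longrightarrow> sq_integrable (F t)"
    and F_bound: "\<And>t. t \<in> {0..T} \<Longrightarrow> sq_norm (F t) \<le> B"
    and dU: "sq_has_derivative T U U1" and dU1: "sq_has_derivative T U1 U2"
    and U_outside: "\<And>t x. x \<notin> D \<Longrightarrow> U t x = 0"
    and eq: "\<And>t. 0 < t \<Longrightarrow> t \<le> T \<Longrightarrow> AE x in lborel. x \<in> D \<longrightarrow> \<rho> * U2 t x = - grad (U t) x + F t x"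
    and t: "t \<in> {0..T}"
  shows "energy (U t) \<le> (\<rho> / 2 * (sq_norm (U1 0))\<^sup>2 + energy (U 0) + B\<^sup>2 / (2 * \<rho>) + 1) * exp (2 * T)"
proof -
  let ?C = "4 * c * kint / \<epsilon>"
  have C: "?C \<ge> 0" using c_nonneg kint_nonneg eps by simp
  define h where "h t = \<rho> / 2 * (sq_norm (U1 t))\<^sup>2 + energy (U t)" for t
  define K where "K = B\<^sup>2 / (2 * \<rho>)"
  define A where "A = \<rho> / 2 * (sq_norm (U1 0))\<^sup>2 + energy (U 0) + K + 1"
  have K: "K \<ge> 0" using \<rho> by (simp add: K_def)
  have cont: "continuous_on {0..T} h"
    unfolding h_def
    by (intro continuous_intros sq_norm_continuous_on energy_continuous_on U U1
        sq_has_derivative_imp_continuous[OF U U1 dU] sq_has_derivative_imp_continuous[OF U1 U2 dU1])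
  have "h t + K \<le> A * exp (2 * t)"
  proof (rule right_derivative_comparison[OF cont _ _ _ t])
    show "A > 0" "h 0 + K < A"
      using K \<rho> energy_nonneg[of "U 0"] unfolding A_def h_def
      by (auto intro!: add_nonneg_pos add_nonneg_nonneg)
    fix t \<kappa> :: real assume t: "0 < t" "t < T" and \<kappa>: "\<kappa> > 0"
    have t': "t \<in> {0..T}" using t by simp
    let ?q = "\<lambda>s x. (U s x - U t x) / (s - t) - U1 t x"
    let ?q1 = "\<lambda>s x. (U1 s x - U1 t x) / (s - t) - U2 t x"
    let ?g = "\<lambda>x. F t x - \<rho> * U2 t x"
    have g: "sq_integrable ?g" by (intro sq_integrable_diff sq_integrable_scale F U2 t')
    \<comment> \<open>Upper bound for the difference quotient of \<open>h\<close>; every term but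
      the first tends to 0 as \<open>s\<close> decreases to \<open>t\<close>.\<close>
    let ?R = "\<lambda>s. B * sq_norm (U1 t) + sq_norm ?g * sq_norm (?q s) + \<rho> * (sq_norm (U1 t) * sq_norm (?q1 s))
       + (s - t) * (?C * (sq_norm (U1 t) + sq_norm (?q s))\<^sup>2 + \<rho> / 2 * (sq_norm (U2 t) + sq_norm (?q1 s))\<^sup>2)"
    have step: "h s \<le> h t + (s - t) * ?R s" if s: "t < s" "s < T" for s
    proof -
      have s': "s \<in> {0..T}" using s t by simp
      define \<tau> where "\<tau> = s - t"
      have \<tau>: "\<tau> > 0" using s by (simp add: \<tau>_def)
      define q where "q = ?q s"
      define q1 where "q1 = ?q1 s"
      have Us: "U s x - U t x = \<tau> * (U1 t x + q x)" for x using \<tau> by (simp add: q_def \<tau>_def field_simps)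
      have U1s: "U1 s x - U1 t x = \<tau> * (U2 t x + q1 x)" for x using \<tau> by (simp add: q1_def \<tau>_def field_simps)
      have q: "sq_integrable q"
        using sq_integrable_diff[OF sq_integrable_scale[OF sq_integrable_diff[OF U[OF s'] U[OF t']], of "1 / \<tau>"] U1[OF t']]
        by (simp add: q_def \<tau>_def)
      have q1: "sq_integrable q1"
        using sq_integrable_diff[OF sq_integrable_scale[OF sq_integrable_diff[OF U1[OF s'] U1[OF t']], of "1 / \<tau>"] U2[OF t']]
        by (simp add: q1_def \<tau>_def)
      note sq = U1[OF t'] U2[OF t'] F[OF t']
      have dd: "sq_integrable (\<lambda>x. U s x - U t x)" by (intro sq_integrable_diff U s' t')
      have "energy (U s) \<le> energy (U t) + pairing (U t) (\<lambda>x. U s x - U t x) + ?C * (sq_norm (\<lambda>x. U s x - U t x))\<^sup>2"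
        by (rule energy_semiconcave) (intro U s' t')+
      also have "pairing (U t) (\<lambda>x. U s x - U t x) = (\<integral>x. grad (U t) x * (U s x - U t x) \<partial>lborel)"
        by (rule pairing_eq_grad(2)[OF U[OF t'] dd])
      \<comment> \<open>The equation is available on \<open>D\<close> only; outside \<open>D\<close>
        the increment of \<open>U\<close> vanishes.\<close>
      also have "\<dots> = (\<integral>x. ?g x * (U s x - U t x) \<partial>lborel)"
      proof (rule integral_cong_AE)
        show "AE x in lborel. grad (U t) x * (U s x - U t x) = ?g x * (U s x - U t x)"
        proof (rule eventually_mono[OF eq])
          fix x assume "x \<in> D \<longrightarrow> \<rho> * U2 t x = - grad (U t) x + F t x"
          then show "grad (U t) x * (U s x - U t x) = ?g x * (U s x - U t x)"
            by (cases "x \<in> D") (simp_all add: U_outside)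
        qed (use t in simp_all)
        show "(\<lambda>x. grad (U t) x * (U s x - U t x)) \<in> borel_measurable lborel"
          using pairing_eq_grad(1)[OF U[OF t'] dd] by (rule borel_measurable_integrable)
        show "(\<lambda>x. ?g x * (U s x - U t x)) \<in> borel_measurable lborel"
          using integrable_mult_sq[OF g dd] by (rule borel_measurable_integrable)
      qed
      also have "\<dots> = \<tau> * (\<integral>x. ?g x * (U1 t x + q x) \<partial>lborel)"
        unfolding Us by (subst integral_mult_right_zero[symmetric]) (simp add: mult_ac)
      also have "(\<integral>x. ?g x * (U1 t x + q x) \<partial>lborel) =
          (\<integral>x. F t x * U1 t x \<partial>lborel) - \<rho> * (\<integral>x. U2 t x * U1 t x \<partial>lborel) + (\<integral>x. ?g x * q x \<partial>lborel)"
        using integrable_mult_sq[OF sq(3,1)] integrable_mult_sq[OF sq(2,1)] integrable_mult_sq[OF g q]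
        by (simp add: distrib_left left_diff_distrib mult.assoc)
      finally have e1: "energy (U s) \<le> energy (U t) + \<tau> * ((\<integral>x. F t x * U1 t x \<partial>lborel)
          - \<rho> * (\<integral>x. U2 t x * U1 t x \<partial>lborel) + (\<integral>x. ?g x * q x \<partial>lborel)) + ?C * (sq_norm (\<lambda>x. U s x - U t x))\<^sup>2" .
      have n1: "sq_norm (\<lambda>x. U s x - U t x) \<le> \<tau> * (sq_norm (U1 t) + sq_norm q)"
        unfolding Us sq_norm_scale using \<tau> by (auto intro!: mult_left_mono sq_norm_triangle sq q)
      have n2: "sq_norm (\<lambda>x. U1 s x - U1 t x) \<le> \<tau> * (sq_norm (U2 t) + sq_norm q1)"
        unfolding U1s sq_norm_scale using \<tau> by (auto intro!: mult_left_mono sq_norm_triangle sq q1)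
      have d1: "sq_integrable (\<lambda>x. U1 s x - U1 t x)" by (intro sq_integrable_diff U1 s' t')
      have "(sq_norm (U1 s))\<^sup>2 = (\<integral>x. (U1 t x)\<^sup>2 + 2 * (U1 t x * (U1 s x - U1 t x)) + (U1 s x - U1 t x)\<^sup>2 \<partial>lborel)"
        unfolding sq_norm_power2 by (rule Bochner_Integration.integral_cong) (simp_all add: power2_eq_square algebra_simps)
      also have "\<dots> = (sq_norm (U1 t))\<^sup>2 + 2 * (\<integral>x. U1 t x * (U1 s x - U1 t x) \<partial>lborel) + (sq_norm (\<lambda>x. U1 s x - U1 t x))\<^sup>2"
        using integrable_mult_sq[OF sq(1) d1] sq_integrableD(3)[OF sq(1)] sq_integrableD(3)[OF d1]
        by (simp add: sq_norm_power2)
      also have "(\<integral>x. U1 t x * (U1 s x - U1 t x) \<partial>lborel) = \<tau> * (\<integral>x. U1 t x * (U2 t x + q1 x) \<partial>lborel)"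
        unfolding U1s by (subst integral_mult_right_zero[symmetric]) (simp add: mult_ac)
      also have "(\<integral>x. U1 t x * (U2 t x + q1 x) \<partial>lborel) = (\<integral>x. U2 t x * U1 t x \<partial>lborel) + (\<integral>x. U1 t x * q1 x \<partial>lborel)"
        using integrable_mult_sq[OF sq(1) sq(2)] integrable_mult_sq[OF sq(1) q1] by (simp add: distrib_left mult.commute)
      finally have e2: "(sq_norm (U1 s))\<^sup>2 = (sq_norm (U1 t))\<^sup>2 + 2 * (\<tau> * ((\<integral>x. U2 t x * U1 t x \<partial>lborel) + (\<integral>x. U1 t x * q1 x \<partial>lborel)))
          + (sq_norm (\<lambda>x. U1 s x - U1 t x))\<^sup>2" .
      have i1: "(\<integral>x. F t x * U1 t x \<partial>lborel) \<le> B * sq_norm (U1 t)"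
        using sq_norm_Cauchy_Schwarz[OF sq(3,1)] mult_right_mono[OF F_bound[OF t'] sq_norm_nonneg[of "U1 t"]] by linarith
      have i2: "(\<integral>x. ?g x * q x \<partial>lborel) \<le> sq_norm ?g * sq_norm q"
        using sq_norm_Cauchy_Schwarz[OF g q] by linarith
      have i3: "(\<integral>x. U1 t x * q1 x \<partial>lborel) \<le> sq_norm (U1 t) * sq_norm q1"
        using sq_norm_Cauchy_Schwarz[OF sq(1) q1] by linarith
      have p1: "(sq_norm (\<lambda>x. U s x - U t x))\<^sup>2 \<le> \<tau>\<^sup>2 * (sq_norm (U1 t) + sq_norm q)\<^sup>2"
        using power_mono[OF n1, of 2] by (simp add: power_mult_distrib)
      have p2: "(sq_norm (\<lambda>x. U1 s x - U1 t x))\<^sup>2 \<le> \<tau>\<^sup>2 * (sq_norm (U2 t) + sq_norm q1)\<^sup>2"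
        using power_mono[OF n2, of 2] by (simp add: power_mult_distrib)
      have "h s = \<rho> / 2 * (sq_norm (U1 s))\<^sup>2 + energy (U s)" by (simp add: h_def)
      also have "\<dots> \<le> \<rho> / 2 * ((sq_norm (U1 t))\<^sup>2 + 2 * (\<tau> * ((\<integral>x. U2 t x * U1 t x \<partial>lborel) + (\<integral>x. U1 t x * q1 x \<partial>lborel)))
            + \<tau>\<^sup>2 * (sq_norm (U2 t) + sq_norm q1)\<^sup>2) +
          (energy (U t) + \<tau> * ((\<integral>x. F t x * U1 t x \<partial>lborel)
          - \<rho> * (\<integral>x. U2 t x * U1 t x \<partial>lborel) + (\<integral>x. ?g x * q x \<partial>lborel)) + ?C * (\<tau>\<^sup>2 * (sq_norm (U1 t) + sq_norm q)\<^sup>2))"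
        unfolding e2 using \<rho> p2 by (intro add_mono mult_left_mono order_trans[OF e1] p1 C order_refl) auto
      \<comment> \<open>Here the two integrals of U2 U1, kinetic and potential, cancel.\<close>
      also have "\<dots> = h t + \<tau> * ((\<integral>x. F t x * U1 t x \<partial>lborel) + (\<integral>x. ?g x * q x \<partial>lborel) + \<rho> * (\<integral>x. U1 t x * q1 x \<partial>lborel)
          + \<tau> * (?C * (sq_norm (U1 t) + sq_norm q)\<^sup>2 + \<rho> / 2 * (sq_norm (U2 t) + sq_norm q1)\<^sup>2))"
        by (simp add: h_def field_simps power2_eq_square)
      also have "\<dots> \<le> h t + \<tau> * (B * sq_norm (U1 t) + sq_norm ?g * sq_norm q + \<rho> * (sq_norm (U1 t) * sq_norm q1)
          + \<tau> * (?C * (sq_norm (U1 t) + sq_norm q)\<^sup>2 + \<rho> / 2 * (sq_norm (U2 t) + sq_norm q1)\<^sup>2))"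
        using \<rho> \<tau> by (intro add_left_mono mult_left_mono add_mono i1 i2 i3 order_refl) auto
      finally show ?thesis unfolding q_def q1_def \<tau>_def .
    qed
    have sub: "at_right t \<le> at t within {0..T}"
    proof -
      have "at_right t = at t within {t..T}" using t by (simp add: at_within_Icc_at_right)
      also have "\<dots> \<le> at t within {0..T}" using t by (intro at_le) auto
      finally show ?thesis .
    qed
    have l1: "((\<lambda>s. sq_norm (?q s)) \<longlongrightarrow> 0) (at_right t)"
      using dU t' tendsto_mono[OF sub] unfolding sq_has_derivative_def by blast
    have l2: "((\<lambda>s. sq_norm (?q1 s)) \<longlongrightarrow> 0) (at_right t)"
      using dU1 t' tendsto_mono[OF sub] unfolding sq_has_derivative_def by blast
    have "(?R \<longlongrightarrow> B * sq_norm (U1 t) + sq_norm ?g * 0 + \<rho> * (sq_norm (U1 t) * 0)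
       + (t - t) * (?C * (sq_norm (U1 t) + 0)\<^sup>2 + \<rho> / 2 * (sq_norm (U2 t) + 0)\<^sup>2)) (at_right t)"
      by (intro tendsto_intros l1 l2)
    then have lim: "(?R \<longlongrightarrow> B * sq_norm (U1 t)) (at_right t)" by simp
    have "B * sq_norm (U1 t) \<le> K + h t"
    proof -
      have "0 \<le> (B - \<rho> * sq_norm (U1 t))\<^sup>2 / (2 * \<rho>)" using \<rho> by simp
      also have "\<dots> = K - B * sq_norm (U1 t) + \<rho> / 2 * (sq_norm (U1 t))\<^sup>2"
        using \<rho> by (simp add: K_def power2_eq_square field_simps)
      finally show ?thesis using energy_nonneg[of "U t"] by (simp add: h_def)
    qed
    then have "B * sq_norm (U1 t) < K + h t + \<kappa>" using \<kappa> by simp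
    from order_tendstoD(2)[OF lim this]
    have "\<forall>\<^sub>F s in at_right t. ?R s < K + h t + \<kappa>" .
    moreover have "\<forall>\<^sub>F s in at_right t. t < s \<and> s < T" using t by (auto simp: eventually_at_right)
    ultimately show "\<forall>\<^sub>F s in at_right t. h s \<le> h t + (s - t) * (K + h t + \<kappa>)"
    proof eventually_elim
      case (elim s)
      have "h s \<le> h t + (s - t) * ?R s" using step elim by blast
      also have "\<dots> \<le> h t + (s - t) * (K + h t + \<kappa>)"
        using elim by (intro add_left_mono mult_left_mono) auto
      finally show ?case .
    qed
  qed
  also have "\<dots> \<le> A * exp (2 * T)"
  proof (rule mult_left_mono)
    show "0 \<le> A" using K \<rho> energy_nonneg[of "U 0"] unfolding A_def by simp
  qed (use t in simp)
  finally have "h t + K \<le> A * exp (2 * T)" .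
  moreover have "energy (U t) \<le> h t + K" using K \<rho> by (simp add: h_def)
  ultimately show ?thesis unfolding A_def K_def by simp
qed

end

section \<open>Boundary layers and tubes around a set of finite length\<close>

text \<open>Contract \<open>D\<close> by the factor 1 - s towards the centre of an inscribed ball of
  radius r. By convexity each point of the contracted set is surrounded by the ball scaled by s, of
  radius s r, and s = 2 h / r makes this 2 h. The area lost is at most 2 s |D|. If s \<ge> 1 the
  empty set serves, since the claimed bound is then at least |D|.\<close>

lemma convex_inner_set:
  fixes D :: "(real^2) set"
  assumes D: "open D" "D \<noteq> {}" "convex D" "bounded D"
  obtains \<Lambda> where "\<Lambda> \<ge> 0" "\<And>h. h > 0 \<Longrightarrow> \<exists>D'. open D' \<and> D' \<subseteq> D \<and> (\<forall>x\<in>D'. cball x (2 * h) \<subseteq> D) \<and>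
    emeasure lborel (D - D') \<le> ennreal (\<Lambda> * h)"
proof -
  obtain x0 r where r: "r > 0" "cball x0 r \<subseteq> D"
    using D(1,2) open_contains_cball by blast
  define V where "V = measure lborel D"
  have V: "emeasure lborel D = ennreal V" "V \<ge> 0"
    unfolding V_def using emeasure_bounded_finite[OF D(4)] by (simp_all add: emeasure_eq_ennreal_measure less_top)
  show ?thesis
  proof (rule that[of "4 * V / r"])
    show "0 \<le> 4 * V / r" using V r by simp
    fix h :: real assume h: "h > 0"
    define s where "s = 2 * h / r"
    have s: "s > 0" "s * r = 2 * h" using h r by (simp_all add: s_def)
    show "\<exists>D'. open D' \<and> D' \<subseteq> D \<and> (\<forall>x\<in>D'. cball x (2 * h) \<subseteq> D) \<and>
      emeasure lborel (D - D') \<le> ennreal (4 * V / r * h)"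
    proof (cases "s < 1")
      case False
      have "V * 1 \<le> V * (2 * s)" using False V by (intro mult_left_mono) auto
      also have "\<dots> = 4 * V / r * h" by (simp add: s_def)
      finally show ?thesis using V by (intro exI[of _ "{}"]) (auto intro!: ennreal_leI)
    next
      case True
      define a where "a = x0 - (1 - s) *\<^sub>R x0"
      define D' where "D' = (\<lambda>y. (1 - s) *\<^sub>R y + a) ` D"
      have sub: "cball x (2 * h) \<subseteq> D" if xD: "x \<in> D'" for x
      proof
        fix z assume z: "z \<in> cball x (2 * h)"
        obtain y where y: "y \<in> D" "x = (1 - s) *\<^sub>R y + a" using xD unfolding D'_def by auto
        \<comment> \<open>The point of the inscribed ball whose convex combination with
          \<open>y\<close> is \<open>z\<close>.\<close>
        define w where "w = x0 + (1 / s) *\<^sub>R (z - x)"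
        have "norm (z - x) \<le> s * r" using z s by (simp add: dist_norm norm_minus_commute)
        then have "norm ((1 / s) *\<^sub>R (z - x)) \<le> r"
          using s(1) by (simp add: pos_divide_le_eq mult.commute del: scaleR_diff_right)
        moreover have "x0 - w = - ((1 / s) *\<^sub>R (z - x))" unfolding w_def by simp
        ultimately have "w \<in> cball x0 r" by (simp only: mem_cball dist_norm norm_minus_cancel)
        then have "w \<in> D" using r by auto
        then have "(1 - s) *\<^sub>R y + s *\<^sub>R w \<in> D"
          using D(3) y(1) s(1) True unfolding convex_alt by auto
        moreover have "(1 - s) *\<^sub>R y + s *\<^sub>R w = z"
          using s(1) unfolding w_def y(2) a_def by (simp add: algebra_simps)
        ultimately show "z \<in> D" by simp
      qed
      have "open D'"
        using open_affinity[OF D(1), of "1 - s" a] True unfolding D'_def by (simp add: add.commute)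
      have "D' \<subseteq> D" using sub h by (force simp: subset_eq)
      have "emeasure lborel D' = emeasure lebesgue D'" using \<open>open D'\<close> by simp
      also have "\<dots> = ennreal ((1 - s)\<^sup>2) * emeasure lebesgue D"
        unfolding D'_def emeasure_lebesgue_affine using True by (simp add: ennreal_power)
      also have "\<dots> = ennreal ((1 - s)\<^sup>2 * V)" using V D(1) by (simp add: ennreal_mult)
      finally have D'V: "emeasure lborel D' = ennreal ((1 - s)\<^sup>2 * V)" .
      have "emeasure lborel (D - D') = emeasure lborel D - emeasure lborel D'"
        using \<open>open D'\<close> D(1) \<open>D' \<subseteq> D\<close> D'V by (intro emeasure_Diff) auto
      also have "\<dots> = ennreal (V - (1 - s)\<^sup>2 * V)"
        unfolding D'V V(1) using V by (simp add: ennreal_minus)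
      also have "\<dots> \<le> ennreal (4 * V / r * h)"
      proof (rule ennreal_leI)
        have "V - (1 - s)\<^sup>2 * V = 2 * s * V - s\<^sup>2 * V" by (simp add: power2_eq_square algebra_simps)
        also have "\<dots> \<le> 2 * s * V" using V by simp
        also have "\<dots> = 4 * V / r * h" by (simp add: s_def)
        finally show "V - (1 - s)\<^sup>2 * V \<le> 4 * V / r * h" .
      qed
      finally show ?thesis using \<open>open D'\<close> \<open>D' \<subseteq> D\<close> sub by blast
    qed
  qed
qed

text \<open>Swept backwards, hence the minus sign: these are the points \<open>x\<close> whose
  segment to \<open>x + \<zeta>\<close> meets the ball.\<close>

definition tube :: "real^2 \<Rightarrow> real^2 \<Rightarrow> real \<Rightarrow> (real^2) set" where
  "tube \<zeta> y r = (\<Union>\<tau>\<in>{0..1}. ball (y - \<tau> *\<^sub>R \<zeta>) r)"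

lemma open_tube: "open (tube \<zeta> y r)"
  unfolding tube_def by auto

text \<open>Cover the axis by \<open>n + 1\<close> balls of doubled radius with consecutive centres
  at most \<open>r\<close> apart. Their total area is at most 4 pi r (|\<zeta>| + 2 r), and r \<le>
  2 |\<zeta>| bounds the bracket by 5 |\<zeta>|.\<close>

lemma emeasure_tube:
  assumes r: "0 < r" "r \<le> 2 * norm \<zeta>"
  shows "emeasure lborel (tube \<zeta> y r) \<le> ennreal (20 * pi * norm \<zeta> * r)"
proof -
  let ?h = "norm \<zeta>"
  have h: "?h > 0" using r by linarith
  define n where "n = nat \<lceil>?h / r\<rceil>"
  have hr: "?h / r > 0" using h r by simp
  have nc: "real n = of_int \<lceil>?h / r\<rceil>" using hr unfolding n_def by (simp add: of_nat_nat)
  have n: "?h / r \<le> real n" "real n \<le> ?h / r + 1" unfolding nc by linarith+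
  have n0: "n > 0" using n(1) hr by linarith
  have sub: "tube \<zeta> y r \<subseteq> (\<Union>k\<in>{..n}. ball (y - (real k / real n) *\<^sub>R \<zeta>) (2 * r))"
  proof
    fix x assume "x \<in> tube \<zeta> y r"
    then obtain \<tau> where \<tau>: "0 \<le> \<tau>" "\<tau> \<le> 1" "dist (y - \<tau> *\<^sub>R \<zeta>) x < r" unfolding tube_def by auto
    define m where "m = nat \<lfloor>\<tau> * n\<rfloor>"
    have tn: "0 \<le> \<tau> * n" "\<tau> * n \<le> n" using \<tau> n0 by (auto intro: mult_left_le_one_le)
    have mf: "real m = of_int \<lfloor>\<tau> * n\<rfloor>" using tn unfolding m_def by (simp add: of_nat_nat)
    have m: "real m \<le> \<tau> * n" "\<tau> * n < real m + 1" unfolding mf by linarith+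
    have "m \<le> n" using m(1) tn(2) by linarith
    have "\<tau> - real m / real n = (\<tau> * n - real m) / real n" using n0 by (simp add: field_simps)
    moreover have "\<bar>\<tau> * n - real m\<bar> \<le> 1" using m by simp
    ultimately have "\<bar>\<tau> - real m / real n\<bar> \<le> 1 / real n" using n0 by (simp add: divide_right_mono)
    then have "norm ((\<tau> - real m / real n) *\<^sub>R \<zeta>) \<le> 1 / real n * ?h"
      by (simp only: norm_scaleR mult_right_mono norm_ge_zero)
    also have "\<dots> \<le> r" using n n0 r by (simp add: field_simps)
    finally have "norm ((\<tau> - real m / real n) *\<^sub>R \<zeta>) \<le> r" .
    moreover have "dist (y - (real m / real n) *\<^sub>R \<zeta>) x \<le> dist (y - \<tau> *\<^sub>R \<zeta>) x + norm ((\<tau> - real m / real n) *\<^sub>R \<zeta>)"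
      using norm_triangle_ineq[of "y - \<tau> *\<^sub>R \<zeta> - x" "(\<tau> - real m / real n) *\<^sub>R \<zeta>"]
      by (simp add: dist_norm algebra_simps)
    ultimately have "x \<in> ball (y - (real m / real n) *\<^sub>R \<zeta>) (2 * r)" using \<tau>(3) by simp
    then show "x \<in> (\<Union>k\<in>{..n}. ball (y - (real k / real n) *\<^sub>R \<zeta>) (2 * r))" using \<open>m \<le> n\<close> by blast
  qed
  have "emeasure lborel (tube \<zeta> y r) \<le> emeasure lborel (\<Union>k\<in>{..n}. ball (y - (real k / real n) *\<^sub>R \<zeta>) (2 * r))"
    by (rule emeasure_mono[OF sub]) auto
  also have "\<dots> \<le> (\<Sum>k\<in>{..n}. emeasure lborel (ball (y - (real k / real n) *\<^sub>R \<zeta>) (2 * r)))"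
    by (rule emeasure_subadditive_finite) auto
  also have "\<dots> = of_nat (Suc n) * ennreal (pi * (2 * r)\<^sup>2)"
    using r by (simp add: emeasure_ball unit_ball_vol_2)
  also have "\<dots> = ennreal (real (Suc n) * (pi * (2 * r)\<^sup>2))"
    by (simp add: ennreal_mult ennreal_of_nat_eq_real_of_nat)
  also have "\<dots> \<le> ennreal (20 * pi * ?h * r)"
  proof (rule ennreal_leI)
    have "real (Suc n) * (pi * (2 * r)\<^sup>2) \<le> (?h / r + 2) * (pi * (2 * r)\<^sup>2)"
      using n by (intro mult_right_mono) auto
    also have "\<dots> = 4 * pi * r * (?h + 2 * r)" using r by (simp add: power2_eq_square field_simps)
    also have "\<dots> \<le> 4 * pi * r * (5 * ?h)" using r by (intro mult_left_mono) auto
    finally show "real (Suc n) * (pi * (2 * r)\<^sup>2) \<le> 20 * pi * ?h * r" by (simp add: mult_ac)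
  qed
  finally show ?thesis .
qed

text \<open>A covering by sets of diameter at most |\<zeta>| and total diameter below H + 1 exists,
  since \<open>hausdorff1_delta\<close> never exceeds \<open>hausdorff1\<close>. Each set is
  enclosed in an open ball, whose tube costs a multiple of |\<zeta>| times its radius. The
  neighbourhood \<open>Q\<close> may change with \<open>\<zeta>\<close>; only \<open>L\<close> is
  uniform.\<close>

lemma hausdorff1_tube:
  fixes S :: "(real^2) set"
  assumes fin: "hausdorff1 S < \<infinity>"
  obtains L where "L \<ge> 0" "\<And>\<zeta>. \<zeta> \<noteq> 0 \<Longrightarrow> \<exists>Q B. open Q \<and> S \<subseteq> Q \<and> open B \<and>
    emeasure lborel B \<le> ennreal (L * norm \<zeta>) \<and> (\<forall>x. \<forall>\<tau>\<in>{0..1}. x + \<tau> *\<^sub>R \<zeta> \<in> Q \<longrightarrow> x \<in> B)"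
proof -
  define H where "H = enn2real (hausdorff1 S)"
  have H: "hausdorff1 S = ennreal H" "H \<ge> 0"
    using fin unfolding H_def by (simp_all add: less_top)
  show ?thesis
  proof (rule that[of "20 * pi * (H + 2)"])
    show "0 \<le> 20 * pi * (H + 2)" using H by simp
    fix \<zeta> :: "real^2" assume "\<zeta> \<noteq> 0"
    define h where "h = norm \<zeta>"
    have h: "h > 0" using \<open>\<zeta> \<noteq> 0\<close> by (simp add: h_def)
    have "hausdorff1_delta h S \<le> hausdorff1 S"
      unfolding hausdorff1_def by (rule SUP_upper) (use h in simp)
    also have "\<dots> < ennreal (H + 1)" unfolding H(1) using H(2) by (simp add: ennreal_less_iff)
    finally obtain U :: "nat \<Rightarrow> (real^2) set" where U: "S \<subseteq> (\<Union>i. U i)" "\<And>i. bounded (U i)" "\<And>i. diameter (U i) \<le> h"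
      "(\<Sum>i. ennreal (diameter (U i))) < ennreal (H + 1)"
      unfolding hausdorff1_delta_def INF_less_iff by auto
    \<comment> \<open>Size of the enlargements that make the radii positive and the balls open.
      Being at most \<open>h\<close>, they keep the radii below 2 |\<zeta>|; their sum is
      \<open>m\<close>, at most 1, whence H + 2 in the constant.\<close>
    define m where "m = min h 1"
    have m: "m > 0" "m \<le> h" "m \<le> 1" using h by (auto simp: m_def)
    define r where "r i = diameter (U i) + m * (1/2) ^ Suc i" for i
    \<comment> \<open>For empty \<open>U i\<close> the centre is arbitrary; the inclusion is then
      trivial, and the area bound does not depend on the centre.\<close>
    define y where "y i = (SOME y. y \<in> U i)" for i
    have pw: "0 < m * (1/2) ^ Suc i" "m * (1/2) ^ Suc i \<le> h" for i
    proof -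
      show "0 < m * (1/2) ^ Suc i" using m by simp
      have "m * (1/2) ^ Suc i \<le> m * 1" using m by (intro mult_left_mono power_le_one) auto
      then show "m * (1/2) ^ Suc i \<le> h" using m by linarith
    qed
    have r: "0 < r i" "r i \<le> 2 * norm \<zeta>" for i
      using pw[of i] U(3)[of i] diameter_ge_0[OF U(2)[of i]] unfolding r_def h_def by linarith+
    have U_ball: "U i \<subseteq> ball (y i) (r i)" for i
    proof
      fix x assume x: "x \<in> U i"
      then have "y i \<in> U i" unfolding y_def by (rule someI)
      then have "dist (y i) x \<le> diameter (U i)" using diameter_bounded_bound[OF U(2)] x by blast
      then show "x \<in> ball (y i) (r i)" using pw[of i] unfolding r_def by simp
    qed
    define Q where "Q = (\<Union>i. ball (y i) (r i))"
    define B where "B = (\<Union>i. tube \<zeta> (y i) (r i))"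
    have "emeasure lborel B \<le> (\<Sum>i. emeasure lborel (tube \<zeta> (y i) (r i)))"
      unfolding B_def by (rule emeasure_subadditive_countably) (auto simp: open_tube)
    also have "\<dots> \<le> (\<Sum>i. ennreal (20 * pi * h * r i))"
      unfolding h_def by (intro suminf_le emeasure_tube r) auto
    also have "\<dots> = (\<Sum>i. ennreal (20 * pi * h) * ennreal (r i))"
      using h r by (simp add: ennreal_mult' less_imp_le)
    also have "\<dots> = ennreal (20 * pi * h) * (\<Sum>i. ennreal (r i))"
      by (rule ennreal_suminf_cmult)
    also have "(\<Sum>i. ennreal (r i)) = (\<Sum>i. ennreal (diameter (U i)) + ennreal (m * (1/2) ^ Suc i))"
      unfolding r_def using pw diameter_ge_0[OF U(2)] by (simp add: ennreal_plus less_imp_le del: power_Suc)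
    also have "\<dots> = (\<Sum>i. ennreal (diameter (U i))) + (\<Sum>i. ennreal (m * (1/2) ^ Suc i))"
      by (rule suminf_add[symmetric]) auto
    also have "(\<Sum>i. ennreal (m * (1/2) ^ Suc i)) = ennreal m"
    proof -
      have "(\<lambda>i. m * (1/2) ^ Suc i) sums (m * 1)" by (intro sums_mult power_half_series)
      then show ?thesis using pw by (intro sums_unique[symmetric] sums_ennreal[THEN iffD2]) (auto simp: less_imp_le m)
    qed
    also have "ennreal (20 * pi * h) * ((\<Sum>i. ennreal (diameter (U i))) + ennreal m)
        \<le> ennreal (20 * pi * h) * (ennreal (H + 1) + ennreal 1)"
      using U(4) m by (intro mult_left_mono add_mono ennreal_leI) auto
    also have "\<dots> = ennreal (20 * pi * (H + 2) * norm \<zeta>)"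
    proof -
      have "ennreal (H + 1) + ennreal 1 = ennreal (H + 2)" using H by (subst ennreal_plus[symmetric]) auto
      then have "ennreal (20 * pi * h) * (ennreal (H + 1) + ennreal 1) = ennreal (20 * pi * h) * ennreal (H + 2)"
        by (simp only:)
      also have "\<dots> = ennreal (20 * pi * h * (H + 2))"
        using H h by (intro ennreal_mult[symmetric]) auto
      finally show ?thesis by (simp only: h_def mult_ac)
    qed
    finally have "emeasure lborel B \<le> ennreal (20 * pi * (H + 2) * norm \<zeta>)" .
    moreover have "x \<in> B" if \<tau>: "\<tau> \<in> {0..1}" and xQ: "x + \<tau> *\<^sub>R \<zeta> \<in> Q" for x \<tau>
    proof -
      obtain i where "dist (y i) (x + \<tau> *\<^sub>R \<zeta>) < r i" using xQ unfolding Q_def by auto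
      then have "dist (y i - \<tau> *\<^sub>R \<zeta>) x < r i" by (simp add: dist_norm algebra_simps)
      then show ?thesis using \<tau> unfolding B_def tube_def by (intro UN_I[of i] UN_I[of \<tau>]) auto
    qed
    moreover have "open Q" "open B" unfolding Q_def B_def by (auto simp: open_tube)
    moreover have "S \<subseteq> Q" using U(1) U_ball unfolding Q_def by blast
    ultimately show "\<exists>Q B. open Q \<and> S \<subseteq> Q \<and> open B \<and>
      emeasure lborel B \<le> ennreal (20 * pi * (H + 2) * norm \<zeta>) \<and> (\<forall>x. \<forall>\<tau>\<in>{0..1}. x + \<tau> *\<^sub>R \<zeta> \<in> Q \<longrightarrow> x \<in> B)"
      by blast
  qed
qed

section \<open>Mollified segments\<close>

text \<open>Only the kink at 0 needs an argument: there the difference quotient is at most |h|. The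
  square of the positive part is what makes the bump function below continuously
  differentiable.\<close>

lemma has_real_derivative_max0_power2:
  "((\<lambda>t::real. (max 0 t)\<^sup>2) has_real_derivative 2 * max 0 t) (at t)"
proof -
  consider "t > 0" | "t < 0" | "t = 0" by linarith
  then show ?thesis
  proof cases
    case 1
    have "((\<lambda>t::real. t\<^sup>2) has_real_derivative 2 * max 0 t) (at t)"
      using 1 by (auto intro!: derivative_eq_intros)
    then show ?thesis
      by (rule has_field_derivative_transform_within_open[of _ _ _ "{0<..}"]) (use 1 in auto)
  next
    case 2
    have "((\<lambda>t::real. 0) has_real_derivative 2 * max 0 t) (at t)"
      using 2 by (auto intro!: derivative_eq_intros)
    then show ?thesis
      by (rule has_field_derivative_transform_within_open[of _ _ _ "{..<0}"]) (use 2 in auto)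
  next
    case 3
    have "((\<lambda>h. ((max 0 (0 + h))\<^sup>2 - (max 0 0)\<^sup>2) / h) \<longlongrightarrow> (0::real)) (at 0)"
    proof (rule Lim_null_comparison)
      show "\<forall>\<^sub>F h in at (0::real). norm (((max 0 (0 + h))\<^sup>2 - (max 0 0)\<^sup>2) / h) \<le> \<bar>h\<bar>"
        by (rule always_eventually) (auto simp: max_def power2_eq_square)
      show "((\<lambda>h::real. \<bar>h\<bar>) \<longlongrightarrow> 0) (at 0)"
        using tendsto_rabs[OF tendsto_ident_at, of "0::real" UNIV] by simp
    qed
    then show ?thesis unfolding 3 DERIV_def by simp
  qed
qed

definition mollifier :: "real \<Rightarrow> (real^2 \<Rightarrow> real) \<Rightarrow> (real^2 \<Rightarrow> real^2) \<Rightarrow> bool" where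
  "mollifier \<eta> \<phi> \<phi>' \<longleftrightarrow> (\<forall>x. (\<phi> has_derivative (\<lambda>h. \<phi>' x \<bullet> h)) (at x)) \<and> continuous_on UNIV \<phi>' \<and>
     (\<forall>x. 0 \<le> \<phi> x) \<and> (\<forall>x. norm x \<ge> \<eta> \<longrightarrow> \<phi> x = 0) \<and> (\<integral>\<^sup>+x. ennreal (\<phi> x) \<partial>lborel) = 1"

text \<open>The bump is the normalised square of the positive part of 1 - |x|^2 / \<eta>^2. It is of
  class C^1, which is the regularity that \<open>test_function\<close> asks for.\<close>

lemma ex_mollifier:
  assumes \<eta>: "\<eta> > 0"
  shows "\<exists>\<phi> \<phi>'. mollifier \<eta> \<phi> \<phi>'"
proof -
  define g where "g x = 1 - (x \<bullet> x) / \<eta>\<^sup>2" for x :: "real^2"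
  define p where "p x = (max 0 (g x))\<^sup>2" for x
  define p' where "p' x = (- 4 / \<eta>\<^sup>2 * max 0 (g x)) *\<^sub>R x" for x
  have g: "continuous_on UNIV g" unfolding g_def by (intro continuous_intros) (use \<eta> in auto)
  have pc: "continuous_on UNIV p" unfolding p_def by (intro continuous_intros g)
  then have [measurable]: "p \<in> borel_measurable borel" by (rule borel_measurable_continuous_onI)
  have p0: "0 \<le> p x" "norm x \<ge> \<eta> \<Longrightarrow> p x = 0" "p x \<le> 1" for x
  proof -
    show "0 \<le> p x" by (simp add: p_def)
    show "p x = 0" if "norm x \<ge> \<eta>"
    proof -
      have "\<eta>\<^sup>2 \<le> x \<bullet> x" using power_mono[OF that, of 2] \<eta> by (simp add: power2_norm_eq_inner)
      then have "g x \<le> 0" using \<eta> unfolding g_def by simp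
      then show ?thesis by (simp add: p_def max_def)
    qed
    have "g x \<le> 1" unfolding g_def by simp
    then show "p x \<le> 1" unfolding p_def by (intro power_le_one) auto
  qed
  have dp: "(p has_derivative (\<lambda>h. p' x \<bullet> h)) (at x)" for x
  proof -
    have dg: "(g has_derivative (\<lambda>h. - (2 * (x \<bullet> h)) / \<eta>\<^sup>2)) (at x)"
      unfolding g_def
      by (rule derivative_eq_intros refl | simp)+ (use \<eta> in \<open>auto simp: inner_commute\<close>)
    have "((\<lambda>t. (max 0 t)\<^sup>2) has_derivative (*) (2 * max 0 (g x))) (at (g x))"
      using has_real_derivative_max0_power2[of "g x"] by (simp add: has_field_derivative_def)
    from has_derivative_compose[OF dg this]
    have "(p has_derivative (\<lambda>h. 2 * max 0 (g x) * (- (2 * (x \<bullet> h)) / \<eta>\<^sup>2))) (at x)"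
      unfolding p_def .
    then show ?thesis by (rule has_derivative_eq_rhs) (auto simp: p'_def)
  qed
  have p'c: "continuous_on UNIV p'" unfolding p'_def by (intro continuous_intros g)
  define Z where "Z = (\<integral>x. p x \<partial>lborel)"
  have pi: "integrable lborel p"
  proof (rule Bochner_Integration.integrable_bound)
    show "integrable lborel (\<lambda>x. indicator (cball (0::real^2) \<eta>) x :: real)"
      using emeasure_lborel_cball_finite[of "0::real^2" \<eta>] by (simp add: less_top)
    show "AE x in lborel. norm (p x) \<le> norm (indicator (cball 0 \<eta>) x :: real)"
      using p0 by (auto simp: indicator_def not_le intro!: AE_I2) 
  qed simp
  have Zpos: "Z > 0"
  proof -
    have "Z \<noteq> 0"
    proof
      assume "Z = 0"
      then have ae: "AE x in lborel. p x = 0"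
        unfolding Z_def using integral_nonneg_eq_0_iff_AE[OF pi] p0 by auto
      have "AE x in lborel. x \<notin> ball (0::real^2) \<eta>"
        using ae
      proof eventually_elim
        case (elim x)
        show ?case
        proof
          assume "x \<in> ball 0 \<eta>"
          then have "norm x < \<eta>" by simp
          then have "x \<bullet> x < \<eta>\<^sup>2" using power_strict_mono[of "norm x" \<eta> 2] \<eta> by (simp add: power2_norm_eq_inner)
          then have "g x > 0" using \<eta> unfolding g_def by simp
          then show False using elim by (simp add: p_def)
        qed
      qed
      then have "ball (0::real^2) \<eta> \<in> null_sets lborel"
        by (subst AE_iff_null_sets) auto
      then have "emeasure lborel (ball (0::real^2) \<eta>) = 0" by (rule null_setsD1)
      then show False using \<eta> mult_pos_pos[OF pi_gt_zero, of "\<eta>\<^sup>2"]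
        by (simp add: emeasure_ball unit_ball_vol_2 ennreal_eq_0_iff not_le[symmetric])
    qed
    moreover have "Z \<ge> 0" unfolding Z_def using p0 by simp
    ultimately show ?thesis by simp
  qed
  have "mollifier \<eta> (\<lambda>x. p x / Z) (\<lambda>x. (1 / Z) *\<^sub>R p' x)"
    unfolding mollifier_def
  proof (intro conjI allI impI)
    show "((\<lambda>x. p x / Z) has_derivative (\<lambda>h. (1 / Z) *\<^sub>R p' x \<bullet> h)) (at x)" for x
      using has_derivative_mult_right[OF dp[of x], of "1 / Z"] by simp
    show "continuous_on UNIV (\<lambda>x. (1 / Z) *\<^sub>R p' x)" by (intro continuous_intros p'c)
    have "(\<integral>\<^sup>+x. ennreal (p x / Z) \<partial>lborel) = ennreal (\<integral>x. p x / Z \<partial>lborel)"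
      using pi p0 Zpos by (intro nn_integral_eq_integral) auto
    also have "\<dots> = 1" using Zpos by (simp add: Z_def)
    finally show "(\<integral>\<^sup>+x. ennreal (p x / Z) \<partial>lborel) = 1" .
  qed (use p0 Zpos in auto)
  then show ?thesis by blast
qed

text \<open>Tested against the distributional derivative, this function yields the increment of a
  mollified function along \<open>\<zeta>\<close>.\<close>

lemma ex_segment_mollifier:
  assumes m: "mollifier \<eta> \<phi> \<phi>'"
  obtains P P' where "\<And>x. (P has_derivative (\<lambda>h. P' x \<bullet> h)) (at x)" "continuous_on UNIV P'"
    "\<And>x. 0 \<le> P x" "\<And>x. P x \<noteq> 0 \<Longrightarrow> \<exists>\<tau>\<in>{0..1}. norm (x - \<tau> *\<^sub>R \<zeta>) < \<eta>"
    "(\<integral>\<^sup>+x. ennreal (P x) \<partial>lborel) = 1" "\<And>x. P' x \<bullet> \<zeta> = \<phi> x - \<phi> (x - \<zeta>)"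
proof -
  have d: "\<And>x. (\<phi> has_derivative (\<lambda>h. \<phi>' x \<bullet> h)) (at x)" and c': "continuous_on UNIV \<phi>'"
    and nn: "\<And>x. 0 \<le> \<phi> x" and supp: "\<And>x. norm x \<ge> \<eta> \<Longrightarrow> \<phi> x = 0"
    and int: "(\<integral>\<^sup>+x. ennreal (\<phi> x) \<partial>lborel) = 1"
    using m by (simp_all add: mollifier_def)
  have c: "continuous_on UNIV \<phi>"
    using d by (intro has_derivative_continuous_on) auto
  have [measurable]: "\<phi> \<in> borel_measurable borel" by (rule borel_measurable_continuous_onI[OF c])
  note cc = continuous_on_compose2[OF c] continuous_on_compose2[OF c']
  \<comment> \<open>Convolution of \<phi> with the uniform distribution on the segment from 0 to
    \<zeta>; sign and mass are inherited.\<close>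
  define P where "P x = integral (cbox 0 1) (\<lambda>\<tau>::real. \<phi> (x - \<tau> *\<^sub>R \<zeta>))" for x
  define P' where "P' x = integral (cbox 0 1) (\<lambda>\<tau>::real. \<phi>' (x - \<tau> *\<^sub>R \<zeta>))" for x
  have i: "(\<lambda>\<tau>::real. \<phi> (x - \<tau> *\<^sub>R \<zeta>)) integrable_on cbox 0 1" for x
    by (intro integrable_continuous cc continuous_intros) auto
  have i': "(\<lambda>\<tau>::real. \<phi>' (x - \<tau> *\<^sub>R \<zeta>)) integrable_on cbox 0 1" for x
    by (intro integrable_continuous cc continuous_intros) auto
  show ?thesis
  proof (rule that[of P P'])
    fix x
    \<comment> \<open>The Leibniz rule expects derivatives as bounded linear functions, so the
      gradient is turned into one by the inner product.\<close>
    let ?B = "\<lambda>y (\<tau>::real). blinfun_inner_right (\<phi>' (y - \<tau> *\<^sub>R \<zeta>))"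
    have "((\<lambda>x. integral (cbox 0 1) (\<lambda>\<tau>::real. \<phi> (x - \<tau> *\<^sub>R \<zeta>))) has_derivative
        blinfun_apply (integral (cbox 0 1) (?B x))) (at x within UNIV)"
    proof (rule leibniz_rule)
      fix y and \<tau> :: real
      have "((\<lambda>x. \<phi> (x - \<tau> *\<^sub>R \<zeta>)) has_derivative (\<lambda>h. \<phi>' (y - \<tau> *\<^sub>R \<zeta>) \<bullet> h)) (at y)"
        by (rule has_derivative_compose[OF _ d, of "\<lambda>x. x - \<tau> *\<^sub>R \<zeta>" "\<lambda>h. h"]) (auto intro!: derivative_eq_intros)
      then show "((\<lambda>x. \<phi> (x - \<tau> *\<^sub>R \<zeta>)) has_derivative blinfun_apply (?B y \<tau>)) (at y)"
        by (simp add: blinfun_inner_right.rep_eq)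
    next
      have "continuous_on (UNIV \<times> cbox (0::real) 1) (\<lambda>p. blinfun_inner_right (\<phi>' (fst p - snd p *\<^sub>R \<zeta>)))"
        by (intro bounded_linear.continuous_on[OF bounded_linear_blinfun_inner_right] cc continuous_intros) auto
      then show "continuous_on (UNIV \<times> cbox 0 1) (\<lambda>(x, \<tau>). ?B x \<tau>)" by (simp add: split_beta')
    qed (use i in auto)
    moreover have "integral (cbox 0 1) (?B x) = blinfun_inner_right (P' x)"
      unfolding P'_def using integral_linear[OF i' bounded_linear_blinfun_inner_right, of x] by (simp add: o_def)
    ultimately show "(P has_derivative (\<lambda>h. P' x \<bullet> h)) (at x)"
      unfolding P_def[abs_def] by (simp add: blinfun_inner_right.rep_eq)
  next
    have "continuous_on (UNIV \<times> cbox (0::real) 1) (\<lambda>p. \<phi>' (fst p - snd p *\<^sub>R \<zeta>))"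
      by (intro cc continuous_intros) auto
    then have "continuous_on UNIV (\<lambda>x. integral (cbox 0 1) (\<lambda>\<tau>::real. \<phi>' (x - \<tau> *\<^sub>R \<zeta>)))"
      by (intro integral_continuous_on_param) (simp add: split_beta')
    then show "continuous_on UNIV P'" unfolding P'_def[abs_def] .
  next
    show "0 \<le> P x" for x unfolding P_def by (intro integral_nonneg i nn)
  next
    fix x assume "P x \<noteq> 0"
    show "\<exists>\<tau>\<in>{0..1}. norm (x - \<tau> *\<^sub>R \<zeta>) < \<eta>"
    proof (rule ccontr)
      assume "\<not> ?thesis"
      then have "P x = integral (cbox 0 1) (\<lambda>\<tau>::real. 0)"
        unfolding P_def by (intro integral_cong supp) (auto simp: not_less)
      then show False using \<open>P x \<noteq> 0\<close> by simp
    qed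
  next
    have P: "ennreal (P x) = (\<integral>\<^sup>+\<tau>. ennreal (\<phi> (x - \<tau> *\<^sub>R \<zeta>)) * indicator {0..1} \<tau> \<partial>lborel)" for x
    proof -
      have "((\<lambda>\<tau>. \<phi> (x - \<tau> *\<^sub>R \<zeta>)) has_integral P x) {0..1}"
        using integrable_integral[OF i[of x]] by (simp add: P_def)
      then have "(\<integral>\<^sup>+\<tau>. ennreal (\<phi> (x - \<tau> *\<^sub>R \<zeta>)) * indicator {0..1} \<tau> \<partial>lborel) = ennreal (P x)"
        by (rule nn_integral_has_integral_lebesgue'[OF nn])
      then show ?thesis by (rule sym)
    qed
    have "(\<integral>\<^sup>+x. ennreal (P x) \<partial>lborel)
        = (\<integral>\<^sup>+x. \<integral>\<^sup>+\<tau>. ennreal (\<phi> (x - \<tau> *\<^sub>R \<zeta>)) * indicator {0..1} \<tau> \<partial>lborel \<partial>lborel)"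
      unfolding P ..
    also have "\<dots> = (\<integral>\<^sup>+\<tau>. \<integral>\<^sup>+x. ennreal (\<phi> (x - \<tau> *\<^sub>R \<zeta>)) * indicator {0..1} (\<tau>::real) \<partial>lborel \<partial>lborel)"
      by (rule lborel_pair.Fubini') measurable
    also have "\<dots> = (\<integral>\<^sup>+\<tau>. (\<integral>\<^sup>+x. ennreal (\<phi> (x - \<tau> *\<^sub>R \<zeta>)) \<partial>lborel) * indicator {0..1} (\<tau>::real) \<partial>lborel)"
      by (intro nn_integral_cong nn_integral_multc) measurable
    also have "\<dots> = (\<integral>\<^sup>+\<tau>. 1 * indicator {0..1} (\<tau>::real) \<partial>lborel)"
      using nn_integral_lborel_translate[of "\<lambda>x. ennreal (\<phi> x)" "- \<tau> *\<^sub>R \<zeta>" for \<tau>] int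
      by simp
    also have "\<dots> = 1" by simp
    finally show "(\<integral>\<^sup>+x. ennreal (P x) \<partial>lborel) = 1" .
  next
    fix x
    \<comment> \<open>Averaged over the segment, the derivative of \<phi> in the direction \<zeta>
      telescopes to the difference of the values at its ends.\<close>
    have "((\<lambda>\<tau>. - (\<phi>' (x - \<tau> *\<^sub>R \<zeta>) \<bullet> \<zeta>)) has_integral (\<phi> (x - 1 *\<^sub>R \<zeta>) - \<phi> (x - 0 *\<^sub>R \<zeta>))) {0..1::real}"
    proof (rule fundamental_theorem_of_calculus)
      fix \<tau> :: real assume "\<tau> \<in> {0..1}"
      have "((\<lambda>\<tau>. \<phi> (x - \<tau> *\<^sub>R \<zeta>)) has_derivative (\<lambda>h. \<phi>' (x - \<tau> *\<^sub>R \<zeta>) \<bullet> (- (h *\<^sub>R \<zeta>)))) (at \<tau> within {0..1})"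
        by (rule has_derivative_compose[OF _ d, of "\<lambda>\<tau>. x - \<tau> *\<^sub>R \<zeta>" "\<lambda>h. - (h *\<^sub>R \<zeta>)"])
          (auto intro!: derivative_eq_intros)
      then show "((\<lambda>\<tau>. \<phi> (x - \<tau> *\<^sub>R \<zeta>)) has_vector_derivative - (\<phi>' (x - \<tau> *\<^sub>R \<zeta>) \<bullet> \<zeta>)) (at \<tau> within {0..1})"
        unfolding has_vector_derivative_def by (rule has_derivative_eq_rhs) auto
    qed simp
    from integral_unique[OF has_integral_neg[OF this]]
    have "integral {0..1} (\<lambda>\<tau>::real. \<phi>' (x - \<tau> *\<^sub>R \<zeta>) \<bullet> \<zeta>) = \<phi> x - \<phi> (x - \<zeta>)" by simp
    moreover have "integral {0..1} (\<lambda>\<tau>::real. \<phi>' (x - \<tau> *\<^sub>R \<zeta>) \<bullet> \<zeta>) = P' x \<bullet> \<zeta>"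
      unfolding P'_def using integral_linear[OF i'[of x] bounded_linear_inner_left[of \<zeta>]] by (simp add: o_def)
    ultimately show "P' x \<bullet> \<zeta> = \<phi> x - \<phi> (x - \<zeta>)" by simp
  qed
qed

section \<open>Increments of functions of bounded variation\<close>

text \<open>For non-integrable \<open>f\<close> the left-hand side is 0 by convention of the Bochner
  integral.\<close>

lemma norm_integral_le_nn_integral:
  fixes f :: "'a \<Rightarrow> 'b::{banach, second_countable_topology}"
  shows "ennreal (norm (integral\<^sup>L M f)) \<le> (\<integral>\<^sup>+x. ennreal (norm (f x)) \<partial>M)"
  by (cases "integrable M f") (auto simp: integral_norm_bound_ennreal not_integrable_integral_eq)

lemma sets_hausdorff1_measure [measurable_cong, simp]: "sets hausdorff1_measure = sets borel"
  unfolding hausdorff1_measure_def by (simp add: sets_measure_of_conv sets.sigma_sets_eq[of borel, simplified])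

lemma space_hausdorff1_measure [simp]: "space hausdorff1_measure = UNIV"
  unfolding hausdorff1_measure_def by (simp add: space_measure_of_conv)

text \<open>The vector identity for the distributional derivative is reduced to one scalar
  inequality with a Borel gradient bound \<open>G\<close> and the total variation
  \<open>\<nu>\<close> of the jump part. As the density of an integrable function
  \<open>\<nu>\<close> is finite, although length on the plane is not \<sigma>-finite; Fubini and
  inner regularity thereby become available.\<close>

lemma SBV_weak_bound:
  fixes D :: "(real^2) set"
  assumes D: "open D" "bounded D" and u: "u \<in> SBV D"
    and v: "v \<in> borel_measurable borel" "\<And>x. x \<notin> D \<Longrightarrow> v x = 0" "AE x in lborel. x \<in> D \<longrightarrow> u x = v x"
  obtains G :: "real^2 \<Rightarrow> real" and \<nu> :: "(real^2) measure" and S where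
    "G \<in> borel_measurable borel" "\<And>x. 0 \<le> G x" "\<And>x. x \<notin> D \<Longrightarrow> G x = 0"
    "AE x in lborel. x \<in> D \<longrightarrow> G x = norm (approx_gradient u x)"
    "finite_measure \<nu>" "sets \<nu> = sets borel" "S \<in> sets borel" "S \<subseteq> jump_set D u" "emeasure \<nu> (- S) = 0"
    "\<And>\<Phi> \<Phi>' \<zeta>. \<lbrakk>test_function D \<Phi> \<Phi>'; \<And>x. 0 \<le> \<Phi> x\<rbrakk> \<Longrightarrow>
       ennreal \<bar>\<integral>y. v y * (\<Phi>' y \<bullet> \<zeta>) \<partial>lborel\<bar> \<le> ennreal (norm \<zeta>) *
         ((\<integral>\<^sup>+y. ennreal (\<Phi> y) * ennreal (G y) \<partial>lborel) + (\<integral>\<^sup>+y. ennreal (\<Phi> y) \<partial>\<nu>))"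
proof -
  let ?H = "hausdorff1_measure :: (real^2) measure"
  let ?J = "jump_set D u"
  define w where "w x = indicator ?J x *\<^sub>R jump_vector u x" for x
  have u_int: "set_integrable lebesgue D u"
    and g_int: "set_integrable lebesgue D (approx_gradient u)"
    and w_int: "integrable ?H w"
    and weak: "\<And>\<phi> \<phi>'. test_function D \<phi> \<phi>' \<Longrightarrow> (LINT x:D|lebesgue. u x *\<^sub>R \<phi>' x) =
        - ((LINT x:D|lebesgue. \<phi> x *\<^sub>R approx_gradient u x) + (LINT x:?J|?H. \<phi> x *\<^sub>R jump_vector u x))"
    using u unfolding SBV_def w_def set_integrable_def by auto
  have [measurable]: "w \<in> borel_measurable ?H" using w_int by simp
  have [measurable]: "w \<in> borel_measurable borel" using w_int[THEN borel_measurable_integrable]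
    by (simp cong: measurable_cong_sets)
  have "set_borel_measurable lebesgue D (\<lambda>x. norm (approx_gradient u x))"
  proof -
    have "(\<lambda>x. indicator D x *\<^sub>R approx_gradient u x) \<in> borel_measurable lebesgue"
      using g_int unfolding set_integrable_def by (rule borel_measurable_integrable)
    from measurable_compose[OF this borel_measurable_norm] show ?thesis
      unfolding set_borel_measurable_def by simp
  qed
  then obtain G0 where G0: "G0 \<in> borel_measurable borel" "\<And>x. x \<notin> D \<Longrightarrow> G0 x = 0"
    "AE x in lborel. x \<in> D \<longrightarrow> norm (approx_gradient u x) = G0 x"
    using ex_borel_version[of D "\<lambda>x. norm (approx_gradient u x)"] D(1) by auto
  define G where "G x = \<bar>G0 x\<bar>" for x
  have G: "AE x in lborel. x \<in> D \<longrightarrow> G x = norm (approx_gradient u x)"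
    using G0(3) unfolding G_def by eventually_elim (metis abs_norm_cancel)
  have Gm [measurable]: "G \<in> borel_measurable borel" using G0(1) unfolding G_def by measurable
  define \<nu> where "\<nu> = density ?H (\<lambda>x. ennreal (norm (w x)))"
  \<comment> \<open>A Borel set standing in for the jump set, of which only the product of its
    indicator with the jump vector is known to be measurable.\<close>
  define S where "S = {x. w x \<noteq> 0}"
  have S: "S \<in> sets borel" unfolding S_def by measurable
  show ?thesis
  proof (rule that[of G \<nu> S])
    show "G \<in> borel_measurable borel" "\<And>x. 0 \<le> G x" "\<And>x. x \<notin> D \<Longrightarrow> G x = 0"
      using G0(2) by (simp_all add: Gm) (simp_all add: G_def)
    show "AE x in lborel. x \<in> D \<longrightarrow> G x = norm (approx_gradient u x)" by (rule G)
    show "sets \<nu> = sets borel" by (simp add: \<nu>_def)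
    show "S \<in> sets borel" by (rule S)
    show "S \<subseteq> ?J" unfolding S_def w_def by (auto simp: indicator_def)
    show "finite_measure \<nu>"
    proof
      have "emeasure \<nu> (space \<nu>) = (\<integral>\<^sup>+x. ennreal (norm (w x)) \<partial>?H)"
        unfolding \<nu>_def by (subst emeasure_density) auto
      also have "\<dots> < \<infinity>" using w_int unfolding integrable_iff_bounded by simp
      finally show "emeasure \<nu> (space \<nu>) \<noteq> \<infinity>" by simp
    qed
    show "emeasure \<nu> (- S) = 0"
    proof -
      have "emeasure \<nu> (- S) = (\<integral>\<^sup>+x. ennreal (norm (w x)) * indicator (- S) x \<partial>?H)"
        unfolding \<nu>_def using S by (subst emeasure_density) auto
      also have "\<dots> = (\<integral>\<^sup>+x. 0 \<partial>?H)" by (intro nn_integral_cong) (auto simp: S_def indicator_def)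
      finally show ?thesis by simp
    qed
    fix \<Phi> \<Phi>' and \<zeta> :: "real^2"
    assume \<Phi>: "test_function D \<Phi> \<Phi>'" and pos: "\<And>x. 0 \<le> \<Phi> x"
    have dPhi: "\<And>x. (\<Phi> has_derivative (\<lambda>h. \<Phi>' x \<bullet> h)) (at x)" and cont': "continuous_on UNIV \<Phi>'"
      using \<Phi> unfolding test_function_def by auto
    have "continuous_on UNIV \<Phi>" using dPhi by (intro has_derivative_continuous_on) auto
    then have [measurable]: "\<Phi> \<in> borel_measurable borel" by (rule borel_measurable_continuous_onI)
    have [measurable]: "\<Phi>' \<in> borel_measurable borel" using cont' by (rule borel_measurable_continuous_onI)
    note [measurable] = v(1)
    have vi: "integrable lborel v"
    proof -
      have "AE x in lborel. indicator D x *\<^sub>R u x = v x" using v(2,3) by (auto simp: indicator_def)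
      from AE_eq_imp_integral_lebesgue_eq(2)[OF v(1) this] show ?thesis
        using u_int unfolding set_integrable_def by simp
    qed
    have "compact (closure D)" using D(2) by simp
    then have "bounded (\<Phi>' ` closure D)"
      by (intro compact_imp_bounded compact_continuous_image continuous_on_subset[OF cont']) auto
    then obtain b where b: "\<And>x. x \<in> closure D \<Longrightarrow> norm (\<Phi>' x) \<le> b"
      unfolding bounded_iff by auto
    have vP: "integrable lborel (\<lambda>y. v y *\<^sub>R \<Phi>' y)"
    proof (rule Bochner_Integration.integrable_bound)
      show "integrable lborel (\<lambda>y. b * v y)" using vi by simp
      show "AE y in lborel. norm (v y *\<^sub>R \<Phi>' y) \<le> norm (b * v y)"
      proof (rule AE_I2)
        fix y show "norm (v y *\<^sub>R \<Phi>' y) \<le> norm (b * v y)"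
        proof (cases "y \<in> D")
          case True
          then have "norm (\<Phi>' y) \<le> \<bar>b\<bar>" using b[of y] closure_subset[of D] by force
          then have "\<bar>v y\<bar> * norm (\<Phi>' y) \<le> \<bar>v y\<bar> * \<bar>b\<bar>" by (intro mult_left_mono) auto
          then show ?thesis by (simp add: abs_mult mult.commute)
        qed (simp add: v(2))
      qed
    qed measurable
    have "(\<integral>y. v y *\<^sub>R \<Phi>' y \<partial>lborel) = (LINT x:D|lebesgue. u x *\<^sub>R \<Phi>' x)"
    proof -
      have "AE x in lborel. indicator D x *\<^sub>R u x *\<^sub>R \<Phi>' x = v x *\<^sub>R \<Phi>' x"
        using v(2,3) by (auto simp: indicator_def)
      then show ?thesis unfolding set_lebesgue_integral_def
        by (intro AE_eq_imp_integral_lebesgue_eq(1)[symmetric]) measurable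
    qed
    also have "\<dots> = - ((LINT x:D|lebesgue. \<Phi> x *\<^sub>R approx_gradient u x) + (LINT x:?J|?H. \<Phi> x *\<^sub>R jump_vector u x))"
      by (rule weak[OF \<Phi>])
    finally have eq: "norm (\<integral>y. v y *\<^sub>R \<Phi>' y \<partial>lborel) \<le>
        norm (LINT x:D|lebesgue. \<Phi> x *\<^sub>R approx_gradient u x) + norm (LINT x:?J|?H. \<Phi> x *\<^sub>R jump_vector u x)"
      by (simp only: norm_minus_cancel norm_triangle_ineq)
    have "ennreal (norm (LINT x:D|lebesgue. \<Phi> x *\<^sub>R approx_gradient u x))
        \<le> (\<integral>\<^sup>+x. ennreal (norm (indicator D x *\<^sub>R \<Phi> x *\<^sub>R approx_gradient u x)) \<partial>lebesgue)"
      unfolding set_lebesgue_integral_def by (rule norm_integral_le_nn_integral)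
    also have "\<dots> = (\<integral>\<^sup>+x. ennreal (\<Phi> x) * ennreal (G x) \<partial>lebesgue)"
    proof (rule nn_integral_cong_AE)
      have "AE x in lborel. ennreal (norm (indicator D x *\<^sub>R \<Phi> x *\<^sub>R approx_gradient u x)) = ennreal (\<Phi> x) * ennreal (G x)"
        using G by eventually_elim
          (use G0(2) pos in \<open>auto simp: indicator_def G_def simp flip: ennreal_mult\<close>)
      then show "AE x in lebesgue. ennreal (norm (indicator D x *\<^sub>R \<Phi> x *\<^sub>R approx_gradient u x)) = ennreal (\<Phi> x) * ennreal (G x)"
        by (simp only: AE_lebesgue_iff)
    qed
    also have "\<dots> = (\<integral>\<^sup>+x. ennreal (\<Phi> x) * ennreal (G x) \<partial>lborel)"
      by (rule nn_integral_completion)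
    finally have p1: "ennreal (norm (LINT x:D|lebesgue. \<Phi> x *\<^sub>R approx_gradient u x)) \<le> \<dots>" .
    have "ennreal (norm (LINT x:?J|?H. \<Phi> x *\<^sub>R jump_vector u x))
        \<le> (\<integral>\<^sup>+x. ennreal (norm (indicator ?J x *\<^sub>R \<Phi> x *\<^sub>R jump_vector u x)) \<partial>?H)"
      unfolding set_lebesgue_integral_def by (rule norm_integral_le_nn_integral)
    also have "\<dots> = (\<integral>\<^sup>+x. ennreal (norm (w x)) * ennreal (\<Phi> x) \<partial>?H)"
      using pos by (intro nn_integral_cong) (auto simp: w_def indicator_def mult.commute simp flip: ennreal_mult)
    also have "\<dots> = (\<integral>\<^sup>+x. ennreal (\<Phi> x) \<partial>\<nu>)"
      unfolding \<nu>_def by (subst nn_integral_density) auto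
    finally have p2: "ennreal (norm (LINT x:?J|?H. \<Phi> x *\<^sub>R jump_vector u x)) \<le> (\<integral>\<^sup>+x. ennreal (\<Phi> x) \<partial>\<nu>)" .
    have "\<bar>\<integral>y. v y * (\<Phi>' y \<bullet> \<zeta>) \<partial>lborel\<bar> = \<bar>(\<integral>y. v y *\<^sub>R \<Phi>' y \<partial>lborel) \<bullet> \<zeta>\<bar>"
      using integral_inner_left[of \<zeta> lborel "\<lambda>y. v y *\<^sub>R \<Phi>' y"] vP by simp
    also have "\<dots> \<le> norm \<zeta> * norm (\<integral>y. v y *\<^sub>R \<Phi>' y \<partial>lborel)"
      by (subst mult.commute) (rule Cauchy_Schwarz_ineq2)
    also have "\<dots> \<le> norm \<zeta> * (norm (LINT x:D|lebesgue. \<Phi> x *\<^sub>R approx_gradient u x) + norm (LINT x:?J|?H. \<Phi> x *\<^sub>R jump_vector u x))"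
      by (intro mult_left_mono eq) simp
    finally have "ennreal \<bar>\<integral>y. v y * (\<Phi>' y \<bullet> \<zeta>) \<partial>lborel\<bar> \<le> ennreal (norm \<zeta>) *
       (ennreal (norm (LINT x:D|lebesgue. \<Phi> x *\<^sub>R approx_gradient u x)) + ennreal (norm (LINT x:?J|?H. \<Phi> x *\<^sub>R jump_vector u x)))"
      by (simp add: ennreal_leI flip: ennreal_mult ennreal_plus)
    also have "\<dots> \<le> ennreal (norm \<zeta>) * ((\<integral>\<^sup>+x. ennreal (\<Phi> x) * ennreal (G x) \<partial>lborel) + (\<integral>\<^sup>+x. ennreal (\<Phi> x) \<partial>\<nu>))"
      by (intro mult_left_mono add_mono p1 p2) simp
    finally show "ennreal \<bar>\<integral>y. v y * (\<Phi>' y \<bullet> \<zeta>) \<partial>lborel\<bar> \<le> ennreal (norm \<zeta>) *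
       ((\<integral>\<^sup>+y. ennreal (\<Phi> y) * ennreal (G y) \<partial>lborel) + (\<integral>\<^sup>+y. ennreal (\<Phi> y) \<partial>\<nu>))" .
  qed
qed

section \<open>Kernel averages and truncated quadratic growth\<close>

text \<open>Tonelli, since for each \<open>y\<close> the kernel has mass 1 in \<open>x\<close>. It
  is applied to the squared gradient and to what is left of the jump measure.\<close>

lemma nn_integral_kernel_convolution:
  fixes P :: "real^2 \<Rightarrow> real" and w :: "real^2 \<Rightarrow> ennreal" and \<nu> :: "(real^2) measure"
  assumes [measurable]: "P \<in> borel_measurable borel" "w \<in> borel_measurable borel"
    and P: "(\<integral>\<^sup>+x. ennreal (P x) \<partial>lborel) = 1"
    and \<nu>: "sigma_finite_measure \<nu>" and [measurable_cong]: "sets \<nu> = sets borel"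
  shows "(\<integral>\<^sup>+x. (\<integral>\<^sup>+y. ennreal (P (y - x)) * w y \<partial>\<nu>) \<partial>lborel) = (\<integral>\<^sup>+y. w y \<partial>\<nu>)"
proof -
  interpret \<nu>: sigma_finite_measure \<nu> by (rule \<nu>)
  interpret pair_sigma_finite lborel \<nu> ..
  have P': "(\<integral>\<^sup>+x. ennreal (P (y - x)) \<partial>lborel) = 1" for y
    using nn_integral_lborel_affine[of "\<lambda>x. ennreal (P x)" "-1" y] P by simp
  have "(\<integral>\<^sup>+x. (\<integral>\<^sup>+y. ennreal (P (y - x)) * w y \<partial>\<nu>) \<partial>lborel)
      = (\<integral>\<^sup>+y. (\<integral>\<^sup>+x. ennreal (P (y - x)) * w y \<partial>lborel) \<partial>\<nu>)"
    by (rule Fubini'[symmetric]) measurable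
  also have "\<dots> = (\<integral>\<^sup>+y. w y \<partial>\<nu>)"
    by (intro nn_integral_cong) (simp add: nn_integral_multc P')
  finally show ?thesis .
qed

text \<open>Cauchy-Schwarz after splitting the kernel into two square roots.\<close>

lemma nn_integral_kernel_Jensen:
  fixes P G :: "real^2 \<Rightarrow> real"
  assumes [measurable]: "P \<in> borel_measurable borel" "G \<in> borel_measurable borel"
    and P: "(\<integral>\<^sup>+x. ennreal (P x) \<partial>lborel) = 1" "\<And>x. 0 \<le> P x" and G: "\<And>x. 0 \<le> G x"
  shows "(\<integral>\<^sup>+y. ennreal (P (y - x)) * ennreal (G y) \<partial>lborel)\<^sup>2 \<le> (\<integral>\<^sup>+y. ennreal (P (y - x)) * ennreal ((G y)\<^sup>2) \<partial>lborel)"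
proof -
  let ?s = "\<lambda>y. ennreal (sqrt (P (y - x)))"
  have s2: "(?s y)\<^sup>2 = ennreal (P (y - x))" for y using P(2) by (simp add: ennreal_power)
  have t: "(\<integral>\<^sup>+y. ennreal (P (y - x)) \<partial>lborel) = 1"
    using nn_integral_lborel_translate[of "\<lambda>x. ennreal (P x)" "- x"] P by simp
  have "(\<integral>\<^sup>+y. ?s y * (?s y * ennreal (G y)) \<partial>lborel)\<^sup>2
      \<le> (\<integral>\<^sup>+y. (?s y)\<^sup>2 \<partial>lborel) * (\<integral>\<^sup>+y. (?s y * ennreal (G y))\<^sup>2 \<partial>lborel)"
    by (rule Cauchy_Schwarz_nn_integral) measurable
  moreover have "?s y * (?s y * ennreal (G y)) = ennreal (P (y - x)) * ennreal (G y)" for y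
    unfolding s2[symmetric] by (simp add: power2_eq_square mult.assoc)
  moreover have "(?s y * ennreal (G y))\<^sup>2 = ennreal (P (y - x)) * ennreal ((G y)\<^sup>2)" for y
    using G by (simp add: power_mult_distrib s2 ennreal_power)
  ultimately show ?thesis by (simp add: s2 t)
qed

text \<open>Let X = (2 B / h) c^2 be the cost of \<open>c\<close> in the quadratic bound.
  Boundedness of \<open>f\<close> replaces X by the minimum of A and X, which is at most the
  geometric mean sqrt (A X), and this is linear in \<open>c\<close>. Thus \<open>c\<close> has to be
  controlled only in L^1.\<close>

lemma truncated_quadratic_split:
  assumes f: "\<And>r. 0 \<le> r \<Longrightarrow> f r \<le> A" "\<And>r. 0 \<le> r \<Longrightarrow> f r \<le> B * r" and AB: "A > 0" "B > 0" and h: "h > 0"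
    and s: "ennreal \<bar>s\<bar> \<le> a + c"
  shows "ennreal (f (s\<^sup>2 / h)) \<le> ennreal (2 * B / h) * a\<^sup>2 + ennreal (sqrt (2 * A * B / h)) * c"
proof (cases "a = top \<or> c = top")
  case True
  have top: "p * a\<^sup>2 = top \<or> q * c = top" if "p \<noteq> 0" "q \<noteq> 0" for p q :: ennreal
    using that True by (auto simp: power2_eq_square ennreal_mult_eq_top_iff)
  have "ennreal (2 * B / h) \<noteq> 0" "ennreal (sqrt (2 * A * B / h)) \<noteq> 0" using AB h by auto
  then have "ennreal (2 * B / h) * a\<^sup>2 = top \<or> ennreal (sqrt (2 * A * B / h)) * c = top"
    by (rule top)
  then show ?thesis by (elim disjE) (simp_all only: add_top_left_ennreal add_top_right_ennreal top_greatest)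
next
  case False
  then obtain a' c' where a': "a = ennreal a'" "a' \<ge> 0" and c': "c = ennreal c'" "c' \<ge> 0"
    by (metis ennreal_cases)
  have s': "\<bar>s\<bar> \<le> a' + c'" using s a' c' by (simp flip: ennreal_plus)
  define X where "X = 2 * B / h * c'\<^sup>2"
  have X: "X \<ge> 0" using AB h unfolding X_def by simp
  have "s\<^sup>2 \<le> (a' + c')\<^sup>2" using power_mono[OF s', of 2] by simp
  also have "\<dots> \<le> 2 * a'\<^sup>2 + 2 * c'\<^sup>2" using sum_squares_bound[of a' c'] by (simp add: power2_sum)
  finally have "B * (s\<^sup>2 / h) \<le> B * ((2 * a'\<^sup>2 + 2 * c'\<^sup>2) / h)"
    using AB h by (intro mult_left_mono divide_right_mono) auto
  then have 1: "f (s\<^sup>2 / h) \<le> 2 * B / h * a'\<^sup>2 + X"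
    using f(2)[of "s\<^sup>2 / h"] h unfolding X_def by (simp add: field_simps)
  have 2: "f (s\<^sup>2 / h) \<le> A" using f(1)[of "s\<^sup>2 / h"] h by simp
  have sq: "sqrt (2 * A * B / h) * c' = sqrt (A * X)"
    using c' unfolding X_def by (simp add: real_sqrt_mult real_sqrt_divide)
  have a2: "0 \<le> 2 * B / h * a'\<^sup>2" using AB h by simp
  have "f (s\<^sup>2 / h) \<le> 2 * B / h * a'\<^sup>2 + sqrt (A * X)"
  proof (cases "X \<le> A")
    case True
    have "X = sqrt (X * X)" using X by simp
    also have "\<dots> \<le> sqrt (A * X)" using True X by (intro real_sqrt_le_mono mult_right_mono)
    finally show ?thesis using 1 by simp
  next
    case False
    have "A = sqrt (A * A)" using AB by simp
    also have "\<dots> \<le> sqrt (A * X)" using False AB by (intro real_sqrt_le_mono mult_left_mono) auto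
    finally show ?thesis using 2 a2 by simp
  qed
  then show ?thesis
    unfolding a'(1) c'(1) using AB h a' c' a2 X
    by (simp add: ennreal_leI sq[symmetric] ennreal_power flip: ennreal_mult ennreal_plus)
qed

text \<open>The support lies within \<eta> \<le> |\<zeta>| of a segment of length |\<zeta>|, hence
  in a ball of radius 2 |\<zeta>|. This is the distance to the boundary that
  \<open>convex_inner_set\<close> provides.\<close>

lemma test_function_segment:
  fixes D :: "(real^2) set"
  assumes P: "\<And>x. (P has_derivative (\<lambda>h. P' x \<bullet> h)) (at x)" "continuous_on UNIV P'"
    and supp: "\<And>x. P x \<noteq> 0 \<Longrightarrow> \<exists>\<tau>\<in>{0..1}. norm (x - \<tau> *\<^sub>R \<zeta>) < \<eta>"
    and \<eta>: "\<eta> \<le> norm \<zeta>" and x: "cball x (2 * norm \<zeta>) \<subseteq> D"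
  shows "test_function D (\<lambda>y. P (y - x)) (\<lambda>y. P' (y - x))"
  unfolding test_function_def
proof (intro conjI allI)
  show "((\<lambda>y. P (y - x)) has_derivative (\<lambda>h. P' (y - x) \<bullet> h)) (at y)" for y
    by (rule has_derivative_compose[OF _ P(1), of "\<lambda>y. y - x" "\<lambda>h. h"]) (auto intro!: derivative_eq_intros)
  show "continuous_on UNIV (\<lambda>y. P' (y - x))"
    by (intro continuous_on_compose2[OF P(2)] continuous_intros) auto
  show "\<exists>K. compact K \<and> K \<subseteq> D \<and> (\<forall>y. y \<notin> K \<longrightarrow> P (y - x) = 0)"
  proof (intro exI[of _ "cball x (2 * norm \<zeta>)"] conjI allI impI)
    fix y assume y: "y \<notin> cball x (2 * norm \<zeta>)"
    show "P (y - x) = 0"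
    proof (rule ccontr)
      assume "P (y - x) \<noteq> 0"
      then obtain \<tau> where \<tau>: "0 \<le> \<tau>" "\<tau> \<le> 1" "norm (y - x - \<tau> *\<^sub>R \<zeta>) < \<eta>" using supp by force
      have "norm (y - x) \<le> norm (y - x - \<tau> *\<^sub>R \<zeta>) + norm (\<tau> *\<^sub>R \<zeta>)"
        using norm_triangle_ineq[of "y - x - \<tau> *\<^sub>R \<zeta>" "\<tau> *\<^sub>R \<zeta>"] by simp
      also have "norm (\<tau> *\<^sub>R \<zeta>) \<le> norm \<zeta>" using \<tau> by (simp add: mult_left_le_one_le)
      finally have "norm (y - x) \<le> 2 * norm \<zeta>" using \<tau> \<eta> by simp
      then show False using y by (simp add: dist_norm norm_minus_commute)
    qed
  qed (use x in auto)
qed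

text \<open>The error is dominated by a kernel average of translation differences, so by Tonelli its
  integral inherits the L^1 modulus of continuity at scale \<eta>.\<close>

lemma mollification_error:
  fixes v :: "real^2 \<Rightarrow> real"
  assumes m: "mollifier \<eta> \<phi> \<phi>'" and [measurable]: "v \<in> borel_measurable borel" and K: "\<And>x. \<bar>v x\<bar> \<le> K"
  defines "err \<equiv> \<lambda>x. \<integral>\<^sup>+y. ennreal (\<phi> y) * ennreal \<bar>v (x + y) - v x\<bar> \<partial>lborel"
  shows "integrable lborel (\<lambda>y. v y * \<phi> (y - x))"
    "ennreal \<bar>(\<integral>y. v y * \<phi> (y - x) \<partial>lborel) - v x\<bar> \<le> err x"
    "err \<in> borel_measurable borel"
    "(\<And>y. norm y < \<eta> \<Longrightarrow> (\<integral>\<^sup>+x. ennreal \<bar>v (x + y) - v x\<bar> \<partial>lborel) \<le> e) \<Longrightarrow> (\<integral>\<^sup>+x. err x \<partial>lborel) \<le> e"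
proof -
  have d: "\<And>x. (\<phi> has_derivative (\<lambda>h. \<phi>' x \<bullet> h)) (at x)"
    and nn: "\<And>x. 0 \<le> \<phi> x" and supp: "\<And>x. norm x \<ge> \<eta> \<Longrightarrow> \<phi> x = 0"
    and int: "(\<integral>\<^sup>+x. ennreal (\<phi> x) \<partial>lborel) = 1"
    using m by (simp_all add: mollifier_def)
  have "continuous_on UNIV \<phi>" using d by (intro has_derivative_continuous_on) auto
  then have [measurable]: "\<phi> \<in> borel_measurable borel" by (rule borel_measurable_continuous_onI)
  have \<phi>i: "integrable lborel \<phi>" "(\<integral>x. \<phi> x \<partial>lborel) = 1"
    using nn int by (auto intro!: integrableI_nonneg simp: integral_eq_nn_integral)
  have K0: "K \<ge> 0" using K[of 0] by linarith
  have iv: "integrable lborel (\<lambda>y. v (x + y) * \<phi> y)" for x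
  proof (rule Bochner_Integration.integrable_bound)
    show "integrable lborel (\<lambda>y. K * \<phi> y)" using \<phi>i by simp
    show "AE y in lborel. norm (v (x + y) * \<phi> y) \<le> norm (K * \<phi> y)"
      using K nn K0 by (intro AE_I2) (simp add: abs_mult mult_right_mono)
  qed measurable
  show "integrable lborel (\<lambda>y. v y * \<phi> (y - x))"
    using integral_lborel_translate(1)[OF iv[of x], of "- x"] by simp
  have "(\<integral>y. v y * \<phi> (y - x) \<partial>lborel) = (\<integral>y. v (x + y) * \<phi> y \<partial>lborel)"
    using integral_lborel_translate(2)[OF iv[of x], of "- x"] by simp
  then have "(\<integral>y. v y * \<phi> (y - x) \<partial>lborel) - v x
      = (\<integral>y. v (x + y) * \<phi> y \<partial>lborel) - (\<integral>y. v x * \<phi> y \<partial>lborel)"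
    using \<phi>i by simp
  also have "\<dots> = (\<integral>y. v (x + y) * \<phi> y - v x * \<phi> y \<partial>lborel)"
    using iv \<phi>i by (subst Bochner_Integration.integral_diff) auto
  finally have "ennreal \<bar>(\<integral>y. v y * \<phi> (y - x) \<partial>lborel) - v x\<bar> = ennreal (norm (\<integral>y. v (x + y) * \<phi> y - v x * \<phi> y \<partial>lborel))"
    by simp
  also have "\<dots> \<le> (\<integral>\<^sup>+y. ennreal (norm (v (x + y) * \<phi> y - v x * \<phi> y)) \<partial>lborel)"
    by (rule norm_integral_le_nn_integral)
  also have "\<dots> = err x"
    unfolding err_def
  proof (rule nn_integral_cong)
    fix y
    have "norm (v (x + y) * \<phi> y - v x * \<phi> y) = \<phi> y * \<bar>v (x + y) - v x\<bar>"
      using nn[of y] by (simp add: abs_mult flip: left_diff_distrib)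
    then show "ennreal (norm (v (x + y) * \<phi> y - v x * \<phi> y)) = ennreal (\<phi> y) * ennreal \<bar>v (x + y) - v x\<bar>"
      using nn[of y] by (simp add: ennreal_mult)
  qed
  finally show "ennreal \<bar>(\<integral>y. v y * \<phi> (y - x) \<partial>lborel) - v x\<bar> \<le> err x" .
  show "err \<in> borel_measurable borel"
    unfolding err_def by measurable
  assume e: "\<And>y. norm y < \<eta> \<Longrightarrow> (\<integral>\<^sup>+x. ennreal \<bar>v (x + y) - v x\<bar> \<partial>lborel) \<le> e"
  have "(\<integral>\<^sup>+x. err x \<partial>lborel) = (\<integral>\<^sup>+y. \<integral>\<^sup>+x. ennreal (\<phi> y) * ennreal \<bar>v (x + y) - v x\<bar> \<partial>lborel \<partial>lborel)"
    unfolding err_def by (rule lborel_pair.Fubini') measurable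
  also have "\<dots> = (\<integral>\<^sup>+y. ennreal (\<phi> y) * (\<integral>\<^sup>+x. ennreal \<bar>v (x + y) - v x\<bar> \<partial>lborel) \<partial>lborel)"
    by (intro nn_integral_cong nn_integral_cmult) measurable
  also have "\<dots> \<le> (\<integral>\<^sup>+y. ennreal (\<phi> y) * e \<partial>lborel)"
  proof (rule nn_integral_mono)
    fix y show "ennreal (\<phi> y) * (\<integral>\<^sup>+x. ennreal \<bar>v (x + y) - v x\<bar> \<partial>lborel) \<le> ennreal (\<phi> y) * e"
      using e[of y] supp[of y] by (cases "norm y < \<eta>") (auto intro: mult_left_mono)
  qed
  also have "\<dots> = e" using int by (simp add: nn_integral_multc)
  finally show "(\<integral>\<^sup>+x. err x \<partial>lborel) \<le> e" .
qed

text \<open>Inner regularity of a finite Borel measure on the plane, rephrased for the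
  complement.\<close>

lemma compact_inner_approximation:
  fixes \<nu> :: "(real^2) measure"
  assumes fin: "finite_measure \<nu>" and sets: "sets \<nu> = sets borel" and S: "S \<in> sets borel" "emeasure \<nu> (- S) = 0"
    and \<kappa>: "\<kappa> > 0"
  obtains K where "compact K" "K \<subseteq> S" "emeasure \<nu> (- K) \<le> ennreal \<kappa>"
proof -
  interpret finite_measure \<nu> by (rule fin)
  have sp: "space \<nu> = UNIV" using sets_eq_imp_space_eq[OF sets] by simp
  have finS: "emeasure \<nu> S \<noteq> \<infinity>" by simp
  have reg: "emeasure \<nu> S = (SUP K \<in> {K. K \<subseteq> S \<and> compact K}. emeasure \<nu> K)"
    by (rule inner_regular[OF sets _ S(1)]) simp
  show ?thesis
  \<comment> \<open>Subtracting \<kappa> gives a strictly smaller number only if the measure of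
    \<open>S\<close> is positive, so the null case is separate.\<close>
  proof (cases "emeasure \<nu> S = 0")
    case True
    have "emeasure \<nu> (- {}) \<le> emeasure \<nu> S + emeasure \<nu> (- S)"
      using emeasure_subadditive[of S \<nu> "- S"] S sets by (simp add: sets Compl_partition)
    then have "emeasure \<nu> (- {}) = 0" using True S by simp
    then show ?thesis by (intro that[of "{}"]) auto
  next
    case False
    have "emeasure \<nu> S - ennreal \<kappa> < emeasure \<nu> S"
      using False \<kappa> by (intro ennreal_between) (auto simp: zero_less_iff_neq_zero less_top[symmetric])
    then obtain K where K: "K \<subseteq> S" "compact K" "emeasure \<nu> S - ennreal \<kappa> < emeasure \<nu> K"
      unfolding less_SUP_iff reg[symmetric] using reg by (metis (no_types, lifting) less_SUP_iff mem_Collect_eq)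
    have KB: "K \<in> sets borel" using K(2) by (rule borel_compact)
    have "emeasure \<nu> (- K) \<le> emeasure \<nu> (S - K) + emeasure \<nu> (- S)"
      using emeasure_mono[of "- K" "(S - K) \<union> - S" \<nu>] emeasure_subadditive[of "S - K" \<nu> "- S"] S KB
      by (auto simp: sets intro: order_trans)
    also have "\<dots> = emeasure \<nu> S - emeasure \<nu> K"
      using K(1) KB S by (subst emeasure_Diff) (auto simp: sets)
    also have "\<dots> \<le> ennreal \<kappa>"
    proof -
      have "measure \<nu> S \<le> \<kappa> + measure \<nu> K"
      proof (rule ccontr)
        assume "\<not> ?thesis"
        then have "ennreal (measure \<nu> K) \<le> ennreal (measure \<nu> S) - ennreal \<kappa>"
          using \<kappa> by (subst ennreal_minus) (auto intro!: ennreal_leI)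
        then show False using K(3) by (simp add: emeasure_eq_measure)
      qed
      then show ?thesis
        unfolding emeasure_eq_measure by (subst ennreal_minus) (auto intro!: ennreal_leI)
    qed
    finally show ?thesis using K by (intro that[of K]) auto
  qed
qed

section \<open>The increment estimate for SBV functions\<close>

text \<open>Only \<open>C\<close> has to be independent of \<open>\<zeta>\<close>. The auxiliary
  sets and the mollification radius are chosen anew for each \<open>\<zeta>\<close>, and nothing of
  them reaches the constant but areas of exceptional sets and masses of errors.\<close>

lemma SBV_increment_bound:
  fixes D :: "(real^2) set" and v :: "real^2 \<Rightarrow> real" and f :: "real \<Rightarrow> real"
  assumes D: "open D" "D \<noteq> {}" "convex D" "bounded D" and u: "u \<in> SBV D"
    and v [measurable]: "v \<in> borel_measurable borel" and v0: "\<And>x. x \<notin> D \<Longrightarrow> v x = 0"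
    and uv: "AE x in lborel. x \<in> D \<longrightarrow> u x = v x" and K: "\<And>x. \<bar>v x\<bar> \<le> K"
    and grad: "(\<integral>\<^sup>+x. ennreal ((norm (approx_gradient u x))\<^sup>2) * indicator D x \<partial>lebesgue) < \<infinity>"
    and jump: "hausdorff1 (jump_set D u) < \<infinity>"
    and f [measurable]: "f \<in> borel_measurable borel" and f0: "f 0 = 0"
    and fA: "\<And>r. 0 \<le> r \<Longrightarrow> f r \<le> A" "\<And>r. 0 \<le> r \<Longrightarrow> f r \<le> B * r" and AB: "A > 0" "B > 0"
  obtains C where "C \<ge> 0" "\<And>\<zeta>. \<zeta> \<noteq> 0 \<Longrightarrow>
    (\<integral>\<^sup>+x. ennreal (f ((v (x + \<zeta>) - v x)\<^sup>2 / norm \<zeta>)) \<partial>lborel) \<le> ennreal (C * norm \<zeta>)"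
proof -
  obtain \<Lambda> where \<Lambda>: "\<Lambda> \<ge> 0" "\<And>h. h > 0 \<Longrightarrow> \<exists>D'. open D' \<and> D' \<subseteq> D \<and> (\<forall>x\<in>D'. cball x (2 * h) \<subseteq> D) \<and>
    emeasure lborel (D - D') \<le> ennreal (\<Lambda> * h)"
    using convex_inner_set[OF D] by blast
  obtain L where L: "L \<ge> 0" "\<And>\<zeta>. \<zeta> \<noteq> 0 \<Longrightarrow> \<exists>Q E. open Q \<and> jump_set D u \<subseteq> Q \<and> open E \<and>
    emeasure lborel E \<le> ennreal (L * norm \<zeta>) \<and> (\<forall>x. \<forall>\<tau>\<in>{0..1}. x + \<tau> *\<^sub>R \<zeta> \<in> Q \<longrightarrow> x \<in> E)"
    using hausdorff1_tube[OF jump] by blast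
  obtain G \<nu> S where G [measurable]: "G \<in> borel_measurable borel" and G0: "\<And>x. 0 \<le> G x" and GD: "\<And>x. x \<notin> D \<Longrightarrow> G x = 0"
    and Ggrad: "AE x in lborel. x \<in> D \<longrightarrow> G x = norm (approx_gradient u x)"
    and \<nu>: "finite_measure \<nu>" "sets \<nu> = sets borel" "S \<in> sets borel" "S \<subseteq> jump_set D u" "emeasure \<nu> (- S) = 0"
    and weak: "\<And>\<Phi> \<Phi>' \<zeta>. \<lbrakk>test_function D \<Phi> \<Phi>'; \<And>x. 0 \<le> \<Phi> x\<rbrakk> \<Longrightarrow>
       ennreal \<bar>\<integral>y. v y * (\<Phi>' y \<bullet> \<zeta>) \<partial>lborel\<bar> \<le> ennreal (norm \<zeta>) *
         ((\<integral>\<^sup>+y. ennreal (\<Phi> y) * ennreal (G y) \<partial>lborel) + (\<integral>\<^sup>+y. ennreal (\<Phi> y) \<partial>\<nu>))"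
    using SBV_weak_bound[OF D(1,4) u v v0 uv] by blast
  note [measurable_cong] = \<nu>(2)
  interpret \<nu>: finite_measure \<nu> by (rule \<nu>(1))
  have [measurable]: "D \<in> sets borel" using D(1) by simp
  define g2 where "g2 = enn2real (\<integral>\<^sup>+x. ennreal ((G x)\<^sup>2) \<partial>lborel)"
  have g2: "(\<integral>\<^sup>+x. ennreal ((G x)\<^sup>2) \<partial>lborel) = ennreal g2" "g2 \<ge> 0"
  proof -
    have "(\<integral>\<^sup>+x. ennreal ((norm (approx_gradient u x))\<^sup>2) * indicator D x \<partial>lebesgue) = (\<integral>\<^sup>+x. ennreal ((G x)\<^sup>2) \<partial>lebesgue)"
    proof (rule nn_integral_cong_AE)
      have "AE x in lborel. ennreal ((norm (approx_gradient u x))\<^sup>2) * indicator D x = ennreal ((G x)\<^sup>2)"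
        using Ggrad by eventually_elim (auto simp: indicator_def GD)
      then show "AE x in lebesgue. ennreal ((norm (approx_gradient u x))\<^sup>2) * indicator D x = ennreal ((G x)\<^sup>2)"
        by (simp only: AE_lebesgue_iff)
    qed
    then have "(\<integral>\<^sup>+x. ennreal ((G x)\<^sup>2) \<partial>lborel) < \<infinity>" using grad by (simp add: nn_integral_completion)
    then show "(\<integral>\<^sup>+x. ennreal ((G x)\<^sup>2) \<partial>lborel) = ennreal g2" "g2 \<ge> 0"
      unfolding g2_def by (simp_all add: less_top)
  qed
  \<comment> \<open>In order: the tubes around the jump set; the boundary layer, once for
    \<open>x\<close> and once for \<open>x + \<zeta>\<close>; the gradient; three errors of size h
    sqrt h.\<close>
  define C where "C = A * L + 2 * (A * \<Lambda>) + 2 * B * g2 + 3 * sqrt (2 * A * B)"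
  show ?thesis
  proof (rule that[of C])
    show "C \<ge> 0" unfolding C_def using AB L \<Lambda> g2 by simp
    fix \<zeta> :: "real^2" assume "\<zeta> \<noteq> 0"
    define h where "h = norm \<zeta>"
    have h: "h > 0" using \<open>\<zeta> \<noteq> 0\<close> by (simp add: h_def)
    obtain D' where D': "open D'" "D' \<subseteq> D" "\<And>x. x \<in> D' \<Longrightarrow> cball x (2 * h) \<subseteq> D"
      "emeasure lborel (D - D') \<le> ennreal (\<Lambda> * h)"
      using \<Lambda>(2)[OF h] by blast
    obtain Q E where Q: "open Q" "jump_set D u \<subseteq> Q" and E: "open E" "emeasure lborel E \<le> ennreal (L * h)"
      and QE: "\<And>x \<tau>. \<tau> \<in> {0..1} \<Longrightarrow> x + \<tau> *\<^sub>R \<zeta> \<in> Q \<Longrightarrow> x \<in> E"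
      using L(2)[OF \<open>\<zeta> \<noteq> 0\<close>] unfolding h_def by blast
    have [measurable]: "D' \<in> sets borel" "E \<in> sets borel" using D'(1) E(1) by auto
    \<comment> \<open>Up to mass \<open>\<surd>h\<close> the jump part lives on a compact set, from which all segments
      starting outside \<open>E\<close> keep a positive distance; what is left enters the energy only through
      its total mass.\<close>
    obtain Z where Z: "compact Z" "Z \<subseteq> S" "emeasure \<nu> (- Z) \<le> ennreal (sqrt h)"
      using compact_inner_approximation[OF \<nu>(1,2,3,5), of "sqrt h"] h by auto
    have [measurable]: "Z \<in> sets borel" using Z(1) by (rule borel_compact)
    obtain \<eta>1 where \<eta>1: "\<eta>1 > 0" "(\<Union>x\<in>Z. ball x \<eta>1) \<subseteq> Q"
      using compact_subset_open_imp_ball_epsilon_subset[OF Z(1) Q(1)] Z(2) \<nu>(4) Q(2) by blast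
    \<comment> \<open>The tolerance h sqrt h is what the weight of order 1 / sqrt h in front of the
      L^1 error turns into order h.\<close>
    obtain \<eta>2 where \<eta>2: "\<eta>2 > 0"
      "\<And>y. norm y < \<eta>2 \<Longrightarrow> (\<integral>\<^sup>+x. ennreal \<bar>v (x + y) - v x\<bar> \<partial>lborel) \<le> ennreal (h * sqrt h)"
      using L1_continuous_translation[OF v K D(4) v0, of "h * sqrt h"] h by auto
    \<comment> \<open>\<open>\<eta> \<le> h\<close> confines the test function to \<open>D\<close>,
      \<open>\<eta> \<le> \<eta>1\<close> keeps it off \<open>Z\<close> when \<open>x\<close> is
      outside \<open>E\<close>, and \<open>\<eta> \<le> \<eta>2\<close> makes the mollification
      error small.\<close>
    define \<eta> where "\<eta> = min h (min \<eta>1 \<eta>2)"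
    have \<eta>: "\<eta> > 0" "\<eta> \<le> h" "\<eta> \<le> \<eta>1" "\<eta> \<le> \<eta>2" using h \<eta>1 \<eta>2 unfolding \<eta>_def by auto
    obtain \<phi> \<phi>' where m: "mollifier \<eta> \<phi> \<phi>'" using ex_mollifier[OF \<eta>(1)] by blast
    obtain P P' where P: "\<And>x. (P has_derivative (\<lambda>h. P' x \<bullet> h)) (at x)" "continuous_on UNIV P'"
      and P0: "\<And>x. 0 \<le> P x" and Psupp: "\<And>x. P x \<noteq> 0 \<Longrightarrow> \<exists>\<tau>\<in>{0..1}. norm (x - \<tau> *\<^sub>R \<zeta>) < \<eta>"
      and P1: "(\<integral>\<^sup>+x. ennreal (P x) \<partial>lborel) = 1" and PP: "\<And>x. P' x \<bullet> \<zeta> = \<phi> x - \<phi> (x - \<zeta>)"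
      using ex_segment_mollifier[OF m] by blast
    have "continuous_on UNIV P" using P(1) by (intro has_derivative_continuous_on) auto
    then have [measurable]: "P \<in> borel_measurable borel" by (rule borel_measurable_continuous_onI)
    define err where "err x = (\<integral>\<^sup>+y. ennreal (\<phi> y) * ennreal \<bar>v (x + y) - v x\<bar> \<partial>lborel)" for x
    note moll = mollification_error[OF m v K, folded err_def]
    have [measurable]: "err \<in> borel_measurable borel" using moll(3) unfolding err_def[abs_def] .
    have err_int: "(\<integral>\<^sup>+x. err x \<partial>lborel) \<le> ennreal (h * sqrt h)"
      unfolding err_def by (rule mollification_error(4)[OF m v K]) (use \<eta> \<eta>2 in auto)
    define a where "a x = ennreal h * (\<integral>\<^sup>+y. ennreal (P (y - x)) * ennreal (G y) \<partial>lborel)" for x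
    define b where "b x = ennreal h * (\<integral>\<^sup>+y. ennreal (P (y - x)) * indicator (- Z) y \<partial>\<nu>)" for x
    \<comment> \<open>Leftover jump mass and the mollification errors at the two ends of the
      segment.\<close>
    define c where "c x = b x + err x + err (x + \<zeta>)" for x
    have [measurable]: "a \<in> borel_measurable borel" unfolding a_def[abs_def] by measurable
    have [measurable]: "b \<in> borel_measurable borel" unfolding b_def[abs_def] by measurable
    have [measurable]: "c \<in> borel_measurable borel" unfolding c_def[abs_def] by measurable
    have main: "ennreal \<bar>v (x + \<zeta>) - v x\<bar> \<le> a x + c x" if xD: "x \<in> D'" and xE: "x \<notin> E" for x
    proof -
      let ?m = "\<lambda>x. \<integral>y. v y * \<phi> (y - x) \<partial>lborel"
      have tf: "test_function D (\<lambda>y. P (y - x)) (\<lambda>y. P' (y - x))"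
        by (rule test_function_segment[OF P Psupp]) (use \<eta>(2) D'(3)[OF xD] h_def in auto)
      have "(\<integral>y. v y * (P' (y - x) \<bullet> \<zeta>) \<partial>lborel) = (\<integral>y. v y * \<phi> (y - x) - v y * \<phi> (y - (x + \<zeta>)) \<partial>lborel)"
        by (simp add: PP algebra_simps)
      also have "\<dots> = ?m x - ?m (x + \<zeta>)"
        by (intro Bochner_Integration.integral_diff moll(1))
      finally have "ennreal \<bar>?m x - ?m (x + \<zeta>)\<bar> \<le> ennreal h *
         ((\<integral>\<^sup>+y. ennreal (P (y - x)) * ennreal (G y) \<partial>lborel) + (\<integral>\<^sup>+y. ennreal (P (y - x)) \<partial>\<nu>))"
        using weak[OF tf P0, of \<zeta>] by (simp add: h_def)
      \<comment> \<open>If the test function charged a point of \<open>Z\<close>, the segment would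
        come within \<open>\<eta>1\<close> of \<open>Z\<close> and so meet \<open>Q\<close>, and
        \<open>x\<close> would belong to \<open>E\<close>.\<close>
      also have "(\<integral>\<^sup>+y. ennreal (P (y - x)) \<partial>\<nu>) = (\<integral>\<^sup>+y. ennreal (P (y - x)) * indicator (- Z) y \<partial>\<nu>)"
      proof (rule nn_integral_cong)
        fix y
        have "P (y - x) = 0" if yZ: "y \<in> Z"
        proof (rule ccontr)
          assume "P (y - x) \<noteq> 0"
          then obtain \<tau> where \<tau>: "\<tau> \<in> {0..1}" "norm (y - x - \<tau> *\<^sub>R \<zeta>) < \<eta>" using Psupp by blast
          then have "x + \<tau> *\<^sub>R \<zeta> \<in> ball y \<eta>1" using \<eta>(3) by (simp add: dist_norm algebra_simps)
          then have "x + \<tau> *\<^sub>R \<zeta> \<in> Q" using \<eta>1(2) yZ by blast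
          then show False using QE[OF \<tau>(1)] xE by blast
        qed
        then show "ennreal (P (y - x)) = ennreal (P (y - x)) * indicator (- Z) y"
          by (auto simp: indicator_def)
      qed
      finally have mm: "ennreal \<bar>?m x - ?m (x + \<zeta>)\<bar> \<le> a x + b x"
        unfolding a_def b_def by (simp add: distrib_left)
      have "ennreal \<bar>v (x + \<zeta>) - v x\<bar> \<le> ennreal (\<bar>?m x - ?m (x + \<zeta>)\<bar> + \<bar>?m x - v x\<bar> + \<bar>?m (x + \<zeta>) - v (x + \<zeta>)\<bar>)"
        by (rule ennreal_leI) linarith
      also have "\<dots> = ennreal \<bar>?m x - ?m (x + \<zeta>)\<bar> + ennreal \<bar>?m x - v x\<bar> + ennreal \<bar>?m (x + \<zeta>) - v (x + \<zeta>)\<bar>"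
        by (simp only: ennreal_plus abs_ge_zero add_nonneg_nonneg)
      also have "\<dots> \<le> (a x + b x) + err x + err (x + \<zeta>)"
        using mollification_error(2)[OF m v K] unfolding err_def by (intro add_mono mm)
      also have "\<dots> = a x + c x" unfolding c_def by (simp only: add.assoc)
      finally show ?thesis .
    qed
    let ?k = "sqrt (2 * A * B / h)"
    have pw: "ennreal (f ((v (x + \<zeta>) - v x)\<^sup>2 / norm \<zeta>)) \<le>
       ennreal A * indicator E x + ennreal A * indicator (D - D') x + ennreal A * indicator (D - D') (x + \<zeta>)
       + (ennreal (2 * B / h) * (a x)\<^sup>2 + ennreal ?k * c x)" for x
    proof -
      have le_A: "ennreal (f ((v (x + \<zeta>) - v x)\<^sup>2 / norm \<zeta>)) \<le> ennreal A"
        by (intro ennreal_leI fA) simp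
      \<comment> \<open>If both points are outside \<open>D\<close>, both values vanish. The last
        case is impossible, because points of \<open>D'\<close> are surrounded by balls of radius 2
        h inside \<open>D\<close>.\<close>
      consider "x \<in> D'" "x \<notin> E" | "x \<in> E" | "x \<in> D - D'" | "x + \<zeta> \<in> D - D'" | "x \<notin> D" "x + \<zeta> \<notin> D" | "x \<notin> D" "x + \<zeta> \<in> D'"
        by blast
      then show ?thesis
      proof cases
        case 1
        then have "ennreal (f ((v (x + \<zeta>) - v x)\<^sup>2 / h)) \<le> ennreal (2 * B / h) * (a x)\<^sup>2 + ennreal ?k * c x"
          by (intro truncated_quadratic_split[OF fA AB h] main)
        then show ?thesis unfolding h_def by (rule order_trans) (rule add_increasing[OF zero_le order_refl])
      next
        case 2
        show ?thesis by (rule order_trans[OF le_A]) (use 2 in \<open>simp add: add.assoc\<close>)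
      next
        case 3
        show ?thesis by (rule order_trans[OF le_A]) (use 3 in \<open>simp add: add.assoc add_increasing\<close>)
      next
        case 4
        show ?thesis by (rule order_trans[OF le_A]) (use 4 in \<open>simp add: add.assoc add_increasing\<close>)
      next
        case 5
        then show ?thesis by (simp add: v0 f0)
      next
        case 6
        have "x \<in> cball (x + \<zeta>) (2 * h)" using h by (simp add: dist_norm h_def)
        then show ?thesis using D'(3)[OF 6(2)] 6(1) by blast
      qed
    qed
    have ia: "(\<integral>\<^sup>+x. (a x)\<^sup>2 \<partial>lborel) \<le> ennreal (h\<^sup>2 * g2)"
    proof -
      have "(\<integral>\<^sup>+x. (a x)\<^sup>2 \<partial>lborel) \<le> (\<integral>\<^sup>+x. ennreal (h\<^sup>2) * (\<integral>\<^sup>+y. ennreal (P (y - x)) * ennreal ((G y)\<^sup>2) \<partial>lborel) \<partial>lborel)"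
      proof (rule nn_integral_mono)
        fix x
        have "(a x)\<^sup>2 = ennreal (h\<^sup>2) * (\<integral>\<^sup>+y. ennreal (P (y - x)) * ennreal (G y) \<partial>lborel)\<^sup>2"
          unfolding a_def using h by (simp add: power_mult_distrib ennreal_power)
        also have "\<dots> \<le> ennreal (h\<^sup>2) * (\<integral>\<^sup>+y. ennreal (P (y - x)) * ennreal ((G y)\<^sup>2) \<partial>lborel)"
          by (intro mult_left_mono nn_integral_kernel_Jensen P1 P0 G0) auto
        finally show "(a x)\<^sup>2 \<le> \<dots>" .
      qed
      also have "\<dots> = ennreal (h\<^sup>2) * (\<integral>\<^sup>+x. (\<integral>\<^sup>+y. ennreal (P (y - x)) * ennreal ((G y)\<^sup>2) \<partial>lborel) \<partial>lborel)"
        by (rule nn_integral_cmult) measurable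
      also have "\<dots> = ennreal (h\<^sup>2) * ennreal g2"
        using P1 by (subst nn_integral_kernel_convolution) (auto simp: g2 sigma_finite_lborel)
      also have "\<dots> = ennreal (h\<^sup>2 * g2)" using g2 by (simp add: ennreal_mult)
      finally show ?thesis .
    qed
    have ib: "(\<integral>\<^sup>+x. b x \<partial>lborel) \<le> ennreal (h * sqrt h)"
    proof -
      have "(\<integral>\<^sup>+x. b x \<partial>lborel) = ennreal h * (\<integral>\<^sup>+x. (\<integral>\<^sup>+y. ennreal (P (y - x)) * indicator (- Z) y \<partial>\<nu>) \<partial>lborel)"
        unfolding b_def by (rule nn_integral_cmult) measurable
      also have "\<dots> = ennreal h * emeasure \<nu> (- Z)"
        using P1 by (subst nn_integral_kernel_convolution) (auto simp: \<nu>(2) \<nu>.sigma_finite_measure_axioms)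
      also have "\<dots> \<le> ennreal h * ennreal (sqrt h)" by (intro mult_left_mono Z) simp
      finally show ?thesis using h by (simp add: ennreal_mult)
    qed
    have ic: "(\<integral>\<^sup>+x. c x \<partial>lborel) \<le> ennreal (3 * (h * sqrt h))"
    proof -
      have "(\<integral>\<^sup>+x. c x \<partial>lborel) = (\<integral>\<^sup>+x. b x \<partial>lborel) + (\<integral>\<^sup>+x. err x \<partial>lborel) + (\<integral>\<^sup>+x. err (x + \<zeta>) \<partial>lborel)"
        unfolding c_def by (simp add: nn_integral_add)
      also have "(\<integral>\<^sup>+x. err (x + \<zeta>) \<partial>lborel) = (\<integral>\<^sup>+x. err x \<partial>lborel)"
        by (rule nn_integral_lborel_translate) measurable
      also have "(\<integral>\<^sup>+x. b x \<partial>lborel) + (\<integral>\<^sup>+x. err x \<partial>lborel) + (\<integral>\<^sup>+x. err x \<partial>lborel)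
          \<le> ennreal (h * sqrt h) + ennreal (h * sqrt h) + ennreal (h * sqrt h)"
        by (intro add_mono ib err_int)
      also have "\<dots> = ennreal (3 * (h * sqrt h))" using h by (simp flip: ennreal_plus)
      finally show ?thesis .
    qed
    have "(\<integral>\<^sup>+x. ennreal (f ((v (x + \<zeta>) - v x)\<^sup>2 / norm \<zeta>)) \<partial>lborel) \<le>
      (\<integral>\<^sup>+x. ennreal A * indicator E x + ennreal A * indicator (D - D') x + ennreal A * indicator (D - D') (x + \<zeta>)
       + (ennreal (2 * B / h) * (a x)\<^sup>2 + ennreal ?k * c x) \<partial>lborel)"
      by (rule nn_integral_mono) (rule pw)
    also have "\<dots> = ennreal A * emeasure lborel E + ennreal A * emeasure lborel (D - D')
       + (\<integral>\<^sup>+x. ennreal A * indicator (D - D') (x + \<zeta>) \<partial>lborel)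
       + (ennreal (2 * B / h) * (\<integral>\<^sup>+x. (a x)\<^sup>2 \<partial>lborel) + ennreal ?k * (\<integral>\<^sup>+x. c x \<partial>lborel))"
      by (simp add: nn_integral_add nn_integral_cmult nn_integral_cmult_indicator)
    also have "(\<integral>\<^sup>+x. ennreal A * indicator (D - D') (x + \<zeta>) \<partial>lborel) = ennreal A * emeasure lborel (D - D')"
      using nn_integral_lborel_translate[of "\<lambda>x. ennreal A * indicator (D - D') x" \<zeta>]
      by (simp add: nn_integral_cmult_indicator)
    also have "ennreal A * emeasure lborel E + ennreal A * emeasure lborel (D - D') + ennreal A * emeasure lborel (D - D')
       + (ennreal (2 * B / h) * (\<integral>\<^sup>+x. (a x)\<^sup>2 \<partial>lborel) + ennreal ?k * (\<integral>\<^sup>+x. c x \<partial>lborel))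
      \<le> ennreal A * ennreal (L * h) + ennreal A * ennreal (\<Lambda> * h) + ennreal A * ennreal (\<Lambda> * h)
       + (ennreal (2 * B / h) * ennreal (h\<^sup>2 * g2) + ennreal ?k * ennreal (3 * (h * sqrt h)))"
      by (intro add_mono mult_left_mono ia ic E D') auto
    also have "\<dots> = ennreal (A * (L * h) + A * (\<Lambda> * h) + A * (\<Lambda> * h) + (2 * B / h * (h\<^sup>2 * g2) + ?k * (3 * (h * sqrt h))))"
      using AB L(1) \<Lambda>(1) h g2(2) by (simp flip: ennreal_mult ennreal_plus)
    also have "A * (L * h) + A * (\<Lambda> * h) + A * (\<Lambda> * h) + (2 * B / h * (h\<^sup>2 * g2) + ?k * (3 * (h * sqrt h))) = C * norm \<zeta>"
    proof -
      have "?k * sqrt h = sqrt (2 * A * B)" using h by (simp flip: real_sqrt_mult)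
      then have "?k * (3 * (h * sqrt h)) = 3 * sqrt (2 * A * B) * h" by (simp add: mult_ac)
      moreover have "2 * B / h * (h\<^sup>2 * g2) = 2 * B * g2 * h" using h by (simp add: power2_eq_square)
      ultimately show ?thesis unfolding C_def h_def[symmetric] by (simp add: algebra_simps)
    qed
    finally show "(\<integral>\<^sup>+x. ennreal (f ((v (x + \<zeta>) - v x)\<^sup>2 / norm \<zeta>)) \<partial>lborel) \<le> ennreal (C * norm \<zeta>)" .
  qed
qed

section \<open>The potential function\<close>

locale LEFM_potential =
  fixes f f' :: "real \<Rightarrow> real" and f0' f_inf :: real
  assumes deriv: "\<And>r. 0 \<le> r \<Longrightarrow> (f has_real_derivative f' r) (at r within {0..})"
    and deriv_cont: "continuous_on {0..} f'"
    and pos: "\<And>r. r > 0 \<Longrightarrow> f r > 0"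
    and concave: "concave_on {0..} f"
    and quot0: "((\<lambda>r. f r / r) \<longlongrightarrow> f0') (at_right 0)"
    and deriv0: "(f has_real_derivative f0') (at 0 within {0..})"
    and infinity: "(f \<longlongrightarrow> f_inf) at_top"
begin

lemma at_right_le: "at_right (0::real) \<le> at 0 within {0..}"
  by (intro at_le) auto

text \<open>Continuity at 0 identifies f 0 with the limit of (f r / r) r, which is 0 because the
  quotient converges.\<close>

lemma at_0: "f 0 = 0"
proof -
  have "(f \<longlongrightarrow> f 0) (at 0 within {0..})"
    using DERIV_continuous[OF deriv0] by (simp add: continuous_within)
  then have 1: "(f \<longlongrightarrow> f 0) (at_right 0)" by (rule tendsto_mono[OF at_right_le])
  have "((\<lambda>r. f r / r * r) \<longlongrightarrow> f0' * 0) (at_right 0)"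
    by (intro tendsto_intros quot0)
  then have "(f \<longlongrightarrow> f0' * 0) (at_right 0)"
    by (rule Lim_transform_eventually) (auto simp: eventually_at_filter)
  then have "(f \<longlongrightarrow> 0) (at_right 0)" by simp
  then show ?thesis using 1 tendsto_unique trivial_limit_at_right_real by blast
qed

lemma deriv_at_0: "f' 0 = f0'"
proof -
  have "at (0::real) within {0..} \<noteq> bot"
    using at_right_le trivial_limit_at_right_real[of "0::real"] by (metis bot.extremum_uniqueI)
  then show ?thesis
    by (rule has_field_derivative_unique[OF deriv deriv0, rotated]) simp
qed

text \<open>Along the segment from r to s concavity makes every chord quotient at least f s - f r,
  and letting the parameter tend to 0 gives the derivative. The parametrisation \<open>g\<close>
  treats s < r and s > r together and respects the one-sided derivative at 0.\<close>

lemma tangent: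
  assumes r: "0 \<le> r" and s: "0 \<le> s"
  shows "f s \<le> f r + f' r * (s - r)"
proof (cases "s = r")
  case False
  define g where "g t = r + t * (s - r)" for t
  have g: "g t \<in> {0..}" if "0 \<le> t" "t \<le> 1" for t
  proof -
    have "g t = (1 - t) * r + t * s" by (simp add: g_def algebra_simps)
    then show ?thesis using that r s by simp
  qed
  have "((\<lambda>t. f (g t)) has_real_derivative f' r * (s - r)) (at 0 within {0..1})"
  proof -
    have g0: "g 0 = r" by (simp add: g_def)
    have "g ` {0..1} \<subseteq> {0..}" using g by auto
    from has_field_derivative_subset[OF deriv[OF r] this]
    have "(f has_real_derivative f' r) (at (g 0) within g ` {0..1})" by (simp only: g0)
    moreover have "(g has_real_derivative (s - r)) (at 0 within {0..1})"
      unfolding g_def by (auto intro!: derivative_eq_intros)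
    ultimately have "(f \<circ> g has_real_derivative f' r * (s - r)) (at 0 within {0..1})"
      by (rule DERIV_image_chain)
    then show ?thesis by (simp add: o_def)
  qed
  then have "((\<lambda>t. (f (g t) - f (g 0)) / (t - 0)) \<longlongrightarrow> f' r * (s - r)) (at 0 within {0..1})"
    by (simp add: has_field_derivative_iff)
  then have lim: "((\<lambda>t. (f (g t) - f r) / t) \<longlongrightarrow> f' r * (s - r)) (at_right 0)"
    by (simp add: g_def at_within_Icc_at_right)
  have "f s - f r \<le> f' r * (s - r)"
  proof (rule tendsto_lowerbound[OF lim])
    have "\<forall>\<^sub>F t in at_right (0::real). 0 < t \<and> t < 1" by (rule eventually_at_rightI[of 0 1]) auto
    then show "\<forall>\<^sub>F t in at_right 0. f s - f r \<le> (f (g t) - f r) / t"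
    proof eventually_elim
      case (elim t)
      have "(1 - t) * f r + t * f s \<le> f ((1 - t) * r + t * s)"
        using concave_onD[OF concave, of t r s] elim r s by simp
      moreover have "(1 - t) * r + t * s = g t" by (simp add: g_def algebra_simps)
      ultimately have "t * (f s - f r) \<le> f (g t) - f r" by (simp add: algebra_simps)
      then show ?case using elim by (simp add: pos_le_divide_eq mult.commute)
    qed
  qed simp
  then show ?thesis by simp
qed simp

lemma nonneg: "0 \<le> r \<Longrightarrow> 0 \<le> f r"
  using pos[of r] at_0 by (cases "r = 0") auto

lemma le_linear: "0 \<le> r \<Longrightarrow> f r \<le> f0' * r"
  using tangent[of 0 r] by (simp add: at_0 deriv_at_0)

text \<open>A negative slope would carry the tangent, and with it the nonnegative \<open>f\<close>,
  below 0; \<open>s\<close> is where the tangent takes the value -1.\<close>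

lemma deriv_nonneg:
  assumes "0 \<le> r" shows "0 \<le> f' r"
proof (rule ccontr)
  assume neg: "\<not> 0 \<le> f' r"
  define s where "s = r + (f r + 1) / (- f' r)"
  have s: "s \<ge> 0" using neg assms nonneg[OF assms] unfolding s_def by (intro add_nonneg_nonneg divide_nonneg_nonneg) auto
  have "f s \<le> f r + f' r * (s - r)" by (rule tangent[OF assms s])
  also have "\<dots> = -1" using neg by (simp add: s_def field_simps)
  finally show False using nonneg[OF s] by simp
qed

lemma deriv_le:
  assumes "0 \<le> r" shows "f' r \<le> f0'"
proof (cases "r = 0")
  case False
  have "f' r * r \<le> f r" using tangent[of r 0] assms by (simp add: at_0)
  also have "\<dots> \<le> f0' * r" by (rule le_linear[OF assms])
  finally show ?thesis using False assms by simp
qed (simp add: deriv_at_0)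

lemma mono: "0 \<le> r \<Longrightarrow> r \<le> s \<Longrightarrow> f r \<le> f s"
  using tangent[of s r] deriv_nonneg[of s] mult_nonneg_nonpos[of "f' s" "r - s"] by simp

lemma le_infinity: "0 \<le> r \<Longrightarrow> f r \<le> f_inf"
  by (rule tendsto_lowerbound[OF infinity])
    (auto intro!: eventually_mono[OF eventually_ge_at_top[of r]] mono)

lemma infinity_pos: "f_inf > 0"
  using pos[of 1] le_infinity[of 1] by simp

text \<open>Values at negative arguments are uncontrolled; composition with \<open>max 0\<close>
  gives a continuous function on the line that agrees with the original on the half-line.\<close>

lemma measurable_extension [measurable]:
  "(\<lambda>r. f (max 0 r)) \<in> borel_measurable borel" "(\<lambda>r. f' (max 0 r)) \<in> borel_measurable borel"
proof -
  have "continuous_on {0..} f"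
    by (rule DERIV_continuous_on) (auto intro: deriv)
  then have "continuous_on UNIV (\<lambda>r. f (max 0 r))"
    by (rule continuous_on_compose2) (auto intro!: continuous_intros)
  then show "(\<lambda>r. f (max 0 r)) \<in> borel_measurable borel"
    by (rule borel_measurable_continuous_onI)
  have "continuous_on UNIV (\<lambda>r. f' (max 0 r))"
    by (rule continuous_on_compose2[OF deriv_cont]) (auto intro!: continuous_intros)
  then show "(\<lambda>r. f' (max 0 r)) \<in> borel_measurable borel"
    by (rule borel_measurable_continuous_onI)
qed

text \<open>The map taking \<eta> to \<eta>^2 / (\<epsilon> |\<xi>|) has its range in the half-line,
  so the chain rule relative to the image works with one-sided derivatives of \<open>f\<close>, also
  at \<eta> = 0.\<close>

lemma deriv_peri_W:
  assumes \<epsilon>: "\<epsilon> > 0" and \<xi>: "\<xi> \<noteq> 0"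
  shows "deriv (\<lambda>\<eta>. peri_W J f \<epsilon> \<eta> \<xi>) \<eta>
    = 1 / \<epsilon>^3 * J (norm \<xi>) * (f' (\<eta>\<^sup>2 / (\<epsilon> * norm \<xi>)) * (2 * \<eta> / (\<epsilon> * norm \<xi>)))"
proof (rule DERIV_imp_deriv)
  let ?c = "\<epsilon> * norm \<xi>"
  have c: "?c > 0" using assms by simp
  have 1: "((\<lambda>\<eta>. \<eta>\<^sup>2 / ?c) has_real_derivative (2 * \<eta> / ?c)) (at \<eta> within UNIV)"
    using c by (auto intro!: derivative_eq_intros)
  have 2: "(f has_real_derivative f' (\<eta>\<^sup>2 / ?c)) (at (\<eta>\<^sup>2 / ?c) within range (\<lambda>\<eta>. \<eta>\<^sup>2 / ?c))"
    by (rule has_field_derivative_subset[OF deriv]) (use c in auto)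
  have "((\<lambda>\<eta>. f (\<eta>\<^sup>2 / ?c)) has_real_derivative (f' (\<eta>\<^sup>2 / ?c) * (2 * \<eta> / ?c))) (at \<eta>)"
    using DERIV_image_chain[OF 2 1] by (simp only: o_def)
  from DERIV_cmult[OF this, of "1 / \<epsilon>^3 * J (norm \<xi>)"]
  show "((\<lambda>\<eta>. peri_W J f \<epsilon> \<eta> \<xi>) has_real_derivative
    1 / \<epsilon>^3 * J (norm \<xi>) * (f' (\<eta>\<^sup>2 / (\<epsilon> * norm \<xi>)) * (2 * \<eta> / (\<epsilon> * norm \<xi>)))) (at \<eta>)"
    unfolding peri_W_def by simp
qed

end

section \<open>The influence function\<close>

text \<open>Polar coordinates put this set into the image of the null set
  \<open>N' \<times> UNIV\<close> under a differentiable map of the plane, and such images are null.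
  Statements about almost every radius thus pass to almost every point of the plane.\<close>

lemma negligible_norm_vimage:
  fixes N :: "real set"
  assumes "negligible N"
  shows "negligible {\<xi> :: real^2. norm \<xi> \<in> N}"
proof -
  define p where "p z = (fst z * cos (snd z)) *\<^sub>R axis 1 1 + (fst z * sin (snd z)) *\<^sub>R (axis 2 1 :: real^2)"
    for z :: "real \<times> real"
  \<comment> \<open>A Borel null superset is taken because the product measure is formed from
    \<open>lborel\<close>.\<close>
  obtain N' where N': "N' \<in> null_sets lborel" "N \<subseteq> N'"
    using assms by (auto simp: negligible_iff_null_sets null_sets_completion_iff2)
  have "N' \<times> (UNIV :: real set) \<in> null_sets (lborel \<Otimes>\<^sub>M lborel)"
    using N'(1) by (intro lborel.times_in_null_sets1) auto
  then have "negligible (N' \<times> (UNIV :: real set))"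
    unfolding lborel_prod by (simp add: negligible_iff_null_sets null_sets_completionI)
  moreover have "p differentiable_on N' \<times> UNIV"
  proof -
    have "(p has_derivative (\<lambda>h. (fst h * cos (snd z) - fst z * (snd h * sin (snd z))) *\<^sub>R axis 1 1
         + (fst h * sin (snd z) + fst z * (snd h * cos (snd z))) *\<^sub>R axis 2 1)) (at z within X)" for z X
      unfolding p_def by (auto intro!: derivative_eq_intros simp: algebra_simps)
    then show ?thesis unfolding differentiable_on_def differentiable_def by blast
  qed
  ultimately have neg: "negligible (p ` (N' \<times> UNIV))"
    by (intro negligible_differentiable_image_negligible) auto
  have "{\<xi> :: real^2. norm \<xi> \<in> N} \<subseteq> p ` (N' \<times> UNIV)"
  proof
    fix \<xi> :: "real^2" assume "\<xi> \<in> {\<xi>. norm \<xi> \<in> N}"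
    then have N: "norm \<xi> \<in> N'" using N'(2) by auto
    let ?r = "norm \<xi>"
    have r2: "?r\<^sup>2 = (\<xi> $ 1)\<^sup>2 + (\<xi> $ 2)\<^sup>2"
      unfolding power2_norm_eq_inner inner_vec_def sum_2 by (simp add: power2_eq_square)
    obtain t where "\<xi> $ 1 = ?r * cos t" "\<xi> $ 2 = ?r * sin t"
    proof (cases "?r = 0")
      case False
      then have "(\<xi> $ 1 / ?r)\<^sup>2 + (\<xi> $ 2 / ?r)\<^sup>2 = 1"
        by (simp add: power_divide r2[symmetric] add_divide_distrib[symmetric])
      then obtain t where "\<xi> $ 1 / ?r = cos t" "\<xi> $ 2 / ?r = sin t"
        using sincos_total_2pi by metis
      then show ?thesis using False by (intro that[of t]) (simp_all add: field_simps)
    qed (use that[of 0] in simp)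
    then have "\<xi> = p (?r, t)"
      by (simp add: p_def vec_eq_iff forall_2 axis_def)
    then show "\<xi> \<in> p ` (N' \<times> UNIV)" using N by blast
  qed
  then show ?thesis by (rule negligible_subset[OF neg])
qed

text \<open>If this integral vanished, \<open>J\<close> would be zero for almost every radius in (0,
  1], and so would the planar moment. Its positivity makes \<open>LEFM_mu\<close> and
  \<open>LEFM_Gc\<close> positive, so that finite LEFM energy bounds both the gradient and the
  length of the jump set.\<close>

lemma J_second_moment_pos:
  assumes meas: "J \<in> borel_measurable (lebesgue_on {0..})"
    and bounds: "\<And>r. 0 \<le> r \<Longrightarrow> r \<le> 1 \<Longrightarrow> 0 \<le> J r \<and> J r < M"
    and moment: "J_moment J > 0"
  shows "(LINT r:{0..1}|lebesgue. r\<^sup>2 * J r) > 0"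
proof (rule ccontr)
  assume neg: "\<not> ?thesis"
  let ?g = "\<lambda>r. indicator {0..1} r *\<^sub>R (r\<^sup>2 * J r) :: real"
  have g0: "0 \<le> ?g r" for r using bounds[of r] by (auto simp: indicator_def)
  have Jm: "(\<lambda>r. indicator {0..} r * J r) \<in> borel_measurable lebesgue"
  proof -
    have "(\<lambda>r. if r \<in> {0..} then J r else 0) = (\<lambda>r. indicator {0..} r * J r)" by (auto simp: fun_eq_iff)
    with borel_measurable_if_I[OF meas] show ?thesis by simp
  qed
  have "?g = (\<lambda>r. indicator {0..1} r * r\<^sup>2 * (indicator {0..} r * J r))"
    by (auto simp: indicator_def fun_eq_iff)
  moreover have "(\<lambda>r. indicator {0..1} r * r\<^sup>2 :: real) \<in> borel_measurable lebesgue"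
    by (rule measurable_completion) measurable
  ultimately have gm: "?g \<in> borel_measurable lebesgue"
    using Jm by (simp add: borel_measurable_times)
  have gi: "integrable lebesgue ?g"
  proof (rule Bochner_Integration.integrable_bound[OF _ gm])
    show "integrable lebesgue (\<lambda>r. indicator {0..1::real} r * M)"
      by (intro integrable_mult_left) simp
    show "AE r in lebesgue. norm (?g r) \<le> norm (indicator {0..1} r * M)"
    proof (rule AE_I2)
      fix r :: real
      have "r\<^sup>2 * J r \<le> 1 * J r" if "0 \<le> r" "r \<le> 1"
        using that bounds[of r] by (intro mult_right_mono power_le_one) auto
      then show "norm (?g r) \<le> norm (indicator {0..1} r * M)"
        using bounds[of r] by (auto simp: indicator_def)
    qed
  qed
  have "integral\<^sup>L lebesgue ?g = 0"
  proof (rule antisym)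
    show "integral\<^sup>L lebesgue ?g \<le> 0" using neg unfolding set_lebesgue_integral_def by simp
    show "0 \<le> integral\<^sup>L lebesgue ?g" using g0 by simp
  qed
  then have "AE r in lebesgue. ?g r = 0"
    using integral_nonneg_eq_0_iff_AE[OF gi] g0 by auto
  then have "negligible {r. ?g r \<noteq> 0}"
    by (simp add: negligible_iff_null_sets completion.AE_iff_null_sets)
  from negligible_norm_vimage[OF this]
  have "AE \<xi> in lebesgue. \<xi> \<notin> {\<xi> :: real^2. norm \<xi> \<in> {r. ?g r \<noteq> 0}}"
    unfolding negligible_iff_null_sets by (rule AE_not_in)
  then have "AE \<xi> in lebesgue. indicator (ball 0 1) \<xi> *\<^sub>R (norm (\<xi>::real^2) * J (norm \<xi>)) = 0"
    by eventually_elim (auto simp: indicator_def)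
  then have "J_moment J = 0"
    unfolding J_moment_def set_lebesgue_integral_def by (rule integral_eq_zero_AE)
  then show False using moment by simp
qed

section \<open>Borel representatives\<close>

text \<open>Agreement is required on the whole \<alpha>-neighbourhood, since bonds issuing from
  \<open>D\<close> leave it. In the collar an element of \<open>L20\<close> is zero only almost
  everywhere, and beyond the collar it is arbitrary.\<close>

definition borel_version :: "real \<Rightarrow> (real^2) set \<Rightarrow> (real^2 \<Rightarrow> real) \<Rightarrow> (real^2 \<Rightarrow> real) \<Rightarrow> bool" where
  "borel_version \<alpha> D w v \<longleftrightarrow> v \<in> borel_measurable borel \<and> (\<forall>x. x \<notin> D \<longrightarrow> v x = 0) \<and>
     (AE x in lborel. x \<in> nbhd \<alpha> D \<longrightarrow> w x = v x)"

lemma subset_nbhd: "\<alpha> > 0 \<Longrightarrow> D \<subseteq> nbhd \<alpha> D"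
  unfolding nbhd_def by auto

lemma L2_norm_eq_sq_norm:
  assumes v: "v \<in> borel_measurable borel" "\<And>x. x \<notin> D \<Longrightarrow> v x = 0" and ae: "AE x in lborel. x \<in> D \<longrightarrow> g x = v x"
  shows "L2_norm D g = sq_norm v"
    "set_integrable lebesgue D (\<lambda>x. (g x)\<^sup>2) \<longleftrightarrow> integrable lborel (\<lambda>x. (v x)\<^sup>2)"
proof -
  have m: "(\<lambda>x. (v x)\<^sup>2) \<in> borel_measurable borel" using v(1) by measurable
  have ae: "AE x in lborel. indicator D x *\<^sub>R (g x)\<^sup>2 = (v x)\<^sup>2"
    using ae by eventually_elim (auto simp: indicator_def v(2))
  show "L2_norm D g = sq_norm v"
    unfolding L2_norm_def sq_norm_def set_lebesgue_integral_def
    by (simp only: AE_eq_imp_integral_lebesgue_eq(1)[OF m ae])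
  show "set_integrable lebesgue D (\<lambda>x. (g x)\<^sup>2) \<longleftrightarrow> integrable lborel (\<lambda>x. (v x)\<^sup>2)"
    unfolding set_integrable_def by (rule AE_eq_imp_integral_lebesgue_eq(2)[OF m ae])
qed

lemma L2_version:
  assumes g: "g \<in> L2 D" and D: "open D"
  obtains v where "v \<in> borel_measurable borel" "\<And>x. x \<notin> D \<Longrightarrow> v x = 0"
    "AE x in lborel. x \<in> D \<longrightarrow> g x = v x" "sq_integrable v"
proof -
  have "set_borel_measurable lebesgue D g" using g by (simp add: L2_def)
  then obtain v where v: "v \<in> borel_measurable borel" "\<And>x. x \<notin> D \<Longrightarrow> v x = 0" "AE x in lborel. x \<in> D \<longrightarrow> g x = v x"
    using ex_borel_version[of D g] D by auto
  moreover have "sq_integrable v"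
    unfolding sq_integrable_def using v(1) L2_norm_eq_sq_norm(2)[OF v] g by (simp add: L2_def)
  ultimately show ?thesis by (rule that)
qed

lemma borel_version_extend:
  assumes g: "g \<in> L20 \<alpha> D" and v: "v \<in> borel_measurable borel" "\<And>x. x \<notin> D \<Longrightarrow> v x = 0"
    "AE x in lborel. x \<in> D \<longrightarrow> g x = v x"
  shows "borel_version \<alpha> D g v"
proof -
  have "AE x in lborel. x \<in> nbhd \<alpha> D - D \<longrightarrow> g x = 0"
    using g unfolding L20_def AE_lebesgue_iff by auto
  with v(3) have "AE x in lborel. x \<in> nbhd \<alpha> D \<longrightarrow> g x = v x"
    by eventually_elim (use v(2) in auto)
  then show ?thesis using v unfolding borel_version_def by blast
qed

lemma L20_version:
  assumes g: "g \<in> L20 \<alpha> D" and D: "open D"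
  obtains v where "borel_version \<alpha> D g v" "sq_integrable v"
proof -
  have "g \<in> L2 D" using g by (simp add: L20_def)
  then obtain v where "v \<in> borel_measurable borel" "\<And>x. x \<notin> D \<Longrightarrow> v x = 0"
    "AE x in lborel. x \<in> D \<longrightarrow> g x = v x" "sq_integrable v" using L2_version[OF _ D] by blast
  then show ?thesis using borel_version_extend[OF g] that by blast
qed

lemma AE_shift:
  fixes P :: "real^2 \<Rightarrow> bool"
  assumes "AE x in lborel. P x" "\<epsilon> \<noteq> 0"
  shows "AE \<xi> in lborel. P (x + \<epsilon> *\<^sub>R \<xi>)" "AE \<xi> in lborel. P (x - \<epsilon> *\<^sub>R \<xi>)"
  using AE_lborel_affine[OF assms, of x] AE_lborel_affine[OF assms(1), of "- \<epsilon>" x] assms(2) by simp_all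

lemma in_nbhd:
  assumes "x \<in> D" "norm y < \<alpha>" shows "x + y \<in> nbhd \<alpha> D"
proof -
  have "infdist (x + y) D \<le> dist (x + y) x" by (rule infdist_le[OF assms(1)])
  then show ?thesis using assms(2) by (simp add: nbhd_def dist_norm)
qed

text \<open>Measurability of |\<xi>| J(|\<xi>|) on the disc is read off from
  \<open>J_moment J > 0\<close>: a non-integrable integrand would have integral 0. Division by
  |\<xi>| and clamping to [0, M] then give a kernel with bounds at every point.\<close>

lemma ex_bond_kernel:
  fixes J :: "real \<Rightarrow> real"
  assumes bounds: "\<And>r. 0 \<le> r \<Longrightarrow> r \<le> 1 \<Longrightarrow> 0 \<le> J r \<and> J r < M" and moment: "J_moment J > 0"
  obtains j :: "real^2 \<Rightarrow> real" where "j \<in> borel_measurable borel" "\<And>\<xi>. 0 \<le> j \<xi>" "\<And>\<xi>. j \<xi> \<le> M"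
    "\<And>\<xi>. norm \<xi> \<ge> 1 \<Longrightarrow> j \<xi> = 0" "AE \<xi> in lborel. \<xi> \<in> ball 0 1 \<longrightarrow> J (norm \<xi>) = j \<xi>"
proof -
  have M: "M \<ge> 0" using bounds[of 0] by simp
  let ?b = "ball 0 1 :: (real^2) set"
  have "integrable lebesgue (\<lambda>\<xi>. indicator ?b \<xi> *\<^sub>R (norm \<xi> * J (norm \<xi>)))"
    using moment not_integrable_integral_eq unfolding J_moment_def set_lebesgue_integral_def by force
  then have "set_borel_measurable lebesgue ?b (\<lambda>\<xi>. norm \<xi> * J (norm \<xi>))"
    unfolding set_borel_measurable_def by (rule borel_measurable_integrable)
  then obtain g where g: "g \<in> borel_measurable borel"
    "AE \<xi> in lborel. \<xi> \<in> ?b \<longrightarrow> norm \<xi> * J (norm \<xi>) = g \<xi>"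
    using ex_borel_version[of ?b "\<lambda>\<xi>. norm \<xi> * J (norm \<xi>)"] by auto
  note [measurable] = g(1)
  define j where "j \<xi> = indicator ?b \<xi> * max 0 (min M (g \<xi> / norm \<xi>))" for \<xi>
  show ?thesis
  proof (rule that[of j])
    have "indicator ?b \<in> borel_measurable (borel :: (real^2) measure)"
      by (intro borel_measurable_indicator) simp
    then show "j \<in> borel_measurable borel" unfolding j_def[abs_def]
      by (rule borel_measurable_times) measurable
    show "0 \<le> j \<xi>" "j \<xi> \<le> M" "norm \<xi> \<ge> 1 \<Longrightarrow> j \<xi> = 0" for \<xi>
      using M unfolding j_def by (auto simp: indicator_def)
    have "AE \<xi> in lborel. \<xi> \<noteq> (0 :: real^2)" by (rule AE_lborel_singleton)
    with g(2) show "AE \<xi> in lborel. \<xi> \<in> ?b \<longrightarrow> J (norm \<xi>) = j \<xi>"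
    proof eventually_elim
      case (elim \<xi>)
      show ?case
      proof
        assume b: "\<xi> \<in> ?b"
        then have "g \<xi> / norm \<xi> = J (norm \<xi>)" using elim by (simp add: field_simps)
        moreover have "0 \<le> J (norm \<xi>)" "J (norm \<xi>) < M" using bounds[of "norm \<xi>"] b by auto
        ultimately show "J (norm \<xi>) = j \<xi>" using b unfolding j_def by simp
      qed
    qed
  qed
qed

section \<open>Peridynamics as a bond model\<close>

locale peridynamic_model = LEFM_potential f f' f0' f_inf for f f' f0' f_inf +
  fixes J :: "real \<Rightarrow> real" and j :: "real^2 \<Rightarrow> real" and \<epsilon> M :: real
  assumes \<epsilon>: "\<epsilon> > 0" and f0'_pos: "f0' > 0"
    and j: "j \<in> borel_measurable borel" "\<And>\<xi>. 0 \<le> j \<xi>" "\<And>\<xi>. j \<xi> \<le> M" "\<And>\<xi>. norm \<xi> \<ge> 1 \<Longrightarrow> j \<xi> = 0"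
      "AE \<xi> in lborel. \<xi> \<in> ball 0 1 \<longrightarrow> J (norm \<xi>) = j \<xi>"
begin

sublocale bm: bond_model "\<lambda>r. f (max 0 r)" "\<lambda>r. f' (max 0 r)" j \<epsilon> f0' M
  by unfold_locales
    (use measurable_extension in \<open>auto simp: \<epsilon> j nonneg le_linear deriv_nonneg deriv_le tangent max_absorb2\<close>)

text \<open>Null sets enter in two ways: the value at \<open>x\<close> itself is right for almost
  every \<open>x\<close>, while the two neighbours at distance \<epsilon> |\<xi>| are good for
  almost every \<xi>, whatever \<open>x\<close> is. They lie in the \<alpha>-neighbourhood since
  \<epsilon> < \<alpha>.\<close>

lemma grad_PD_eq:
  assumes D: "open D" and \<alpha>: "\<epsilon> < \<alpha>" and w: "borel_version \<alpha> D w v"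
  shows "AE x in lborel. x \<in> D \<longrightarrow> grad_PD J f \<epsilon> w x = bm.grad v x"
proof -
  have v: "v \<in> borel_measurable borel" and wv: "AE x in lborel. x \<in> nbhd \<alpha> D \<longrightarrow> w x = v x"
    using w unfolding borel_version_def by auto
  note [measurable] = v
  have [simp]: "\<epsilon> \<noteq> 0" using \<epsilon> by simp
  show ?thesis
    using wv
  proof eventually_elim
    case (elim x)
    show ?case
    proof
      assume x: "x \<in> D"
      have wx: "w x = v x" using elim x subset_nbhd[of \<alpha> D] \<alpha> \<epsilon> by auto
      let ?I = "\<lambda>\<xi>. indicator (ball 0 1) \<xi> *\<^sub>R (back_quotient \<epsilon> \<xi>
         (\<lambda>z. deriv (\<lambda>\<eta>. peri_W J f \<epsilon> \<eta> \<xi>) (w (z + \<epsilon> *\<^sub>R \<xi>) - w z)) x * norm \<xi>)"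
      \<comment> \<open>The derivative of \<open>peri_W\<close> contributes 1 / \<epsilon>^3 and the
        back quotient 1 / (\<epsilon> |\<xi>|), whose |\<xi>| cancels; with the prefactor
        \<epsilon>^3 this leaves the 1 / \<epsilon> of \<open>grad\<close>.\<close>
      let ?R = "\<lambda>\<xi>. 1 / \<epsilon>^4 * (bm.force v \<xi> (x - \<epsilon> *\<^sub>R \<xi>) - bm.force v \<xi> x)"
      have "AE \<xi> in lborel. \<xi> \<noteq> (0 :: real^2)" by (rule AE_lborel_singleton)
      with j(5) AE_shift(1)[OF wv \<open>\<epsilon> \<noteq> 0\<close>, of x] AE_shift(2)[OF wv \<open>\<epsilon> \<noteq> 0\<close>, of x]
      have ae: "AE \<xi> in lborel. ?I \<xi> = ?R \<xi>"
      proof eventually_elim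
        case (elim \<xi>)
        show ?case
        proof (cases "norm \<xi> < 1")
          case False
          then show ?thesis by (simp add: bm.force_def bm.k_def j(4) indicator_def)
        next
          case True
          have n: "norm (\<epsilon> *\<^sub>R \<xi>) < \<alpha>"
          proof -
            have "norm (\<epsilon> *\<^sub>R \<xi>) \<le> \<epsilon> * 1" using True \<epsilon> by (simp add: mult_left_le)
            then show ?thesis using \<alpha> by simp
          qed
          have w1: "w (x + \<epsilon> *\<^sub>R \<xi>) = v (x + \<epsilon> *\<^sub>R \<xi>)" using elim in_nbhd[OF x n] by simp
          have w2: "w (x - \<epsilon> *\<^sub>R \<xi>) = v (x - \<epsilon> *\<^sub>R \<xi>)"
            using elim in_nbhd[OF x, of "- (\<epsilon> *\<^sub>R \<xi>)" \<alpha>] n by simp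
          have J: "J (norm \<xi>) = j \<xi>" using elim True by simp
          have \<xi>0: "\<xi> \<noteq> 0" using elim by simp
          have p: "max 0 (a\<^sup>2 / (\<epsilon> * norm \<xi>)) = a\<^sup>2 / (\<epsilon> * norm \<xi>)" for a :: real using \<epsilon> by simp
          have frc: "1 / \<epsilon>^3 * j \<xi> * (f' (a\<^sup>2 / (\<epsilon> * norm \<xi>)) * (2 * a / (\<epsilon> * norm \<xi>)))
              = 1 / \<epsilon>^3 * (2 * bm.k \<xi> * f' (a\<^sup>2 / (\<epsilon> * norm \<xi>)) * a)" for a
            by (simp add: bm.k_def)
          show ?thesis
            using True \<xi>0 \<epsilon> unfolding back_quotient_def deriv_peri_W[OF \<epsilon> \<xi>0] J frc
            by (simp add: bm.force_def bm.bdiff_def p w1 w2 wx power_numeral_reduce divide_simps)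
        qed
      qed
      have "grad_PD J f \<epsilon> w x = \<epsilon>^3 * integral\<^sup>L lebesgue ?I"
        unfolding grad_PD_def set_lebesgue_integral_def ..
      also have "integral\<^sup>L lebesgue ?I = integral\<^sup>L lborel ?R"
        by (rule AE_eq_imp_integral_lebesgue_eq(1)[OF _ ae]) measurable
      also have "\<epsilon>^3 * \<dots> = bm.grad v x"
        unfolding bm.grad_def using \<epsilon> by (simp add: power_numeral_reduce field_simps)
      finally show "grad_PD J f \<epsilon> w x = bm.grad v x" .
    qed
  qed
qed

text \<open>Both orders are needed: \<open>x\<close> outermost for Chebyshev's inequality, \<xi>
  outermost to use increments with a fixed shift.\<close>

lemma nn_integral_dens:
  assumes v: "sq_integrable v"
  shows "(\<integral>\<^sup>+x. \<integral>\<^sup>+\<xi>. ennreal (bm.dens v \<xi> x) \<partial>lborel \<partial>lborel) = ennreal (\<epsilon> * bm.energy v)"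
    "(\<integral>\<^sup>+\<xi>. \<integral>\<^sup>+x. ennreal (bm.dens v \<xi> x) \<partial>lborel \<partial>lborel) = ennreal (\<epsilon> * bm.energy v)"
proof -
  note [measurable] = sq_integrableD(1)[OF v]
  have "(\<integral>\<^sup>+\<xi>. \<integral>\<^sup>+x. ennreal (bm.dens v \<xi> x) \<partial>lborel \<partial>lborel)
      = (\<integral>\<^sup>+p. ennreal (bm.dens v (fst p) (snd p)) \<partial>(lborel \<Otimes>\<^sub>M lborel))"
    by (subst lborel.nn_integral_fst[symmetric]) simp_all
  also have "\<dots> = ennreal (\<epsilon> * bm.energy v)"
    using bm.dens_integrable[OF v] bm.dens_bounds(1) \<epsilon>
    by (subst nn_integral_eq_integral) (auto simp: bm.energy_def)
  finally show 1: "(\<integral>\<^sup>+\<xi>. \<integral>\<^sup>+x. ennreal (bm.dens v \<xi> x) \<partial>lborel \<partial>lborel) = ennreal (\<epsilon> * bm.energy v)" .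
  have "(\<integral>\<^sup>+x. \<integral>\<^sup>+\<xi>. ennreal (bm.dens v \<xi> x) \<partial>lborel \<partial>lborel) = (\<integral>\<^sup>+\<xi>. \<integral>\<^sup>+x. ennreal (bm.dens v \<xi> x) \<partial>lborel \<partial>lborel)"
    by (rule lborel_pair.Fubini') measurable
  then show "(\<integral>\<^sup>+x. \<integral>\<^sup>+\<xi>. ennreal (bm.dens v \<xi> x) \<partial>lborel \<partial>lborel) = ennreal (\<epsilon> * bm.energy v)"
    using 1 by simp
qed

text \<open>With \<zeta> = \<epsilon> \<xi> the inner integral is at most M C \<epsilon>, which
  cancels the normalisation 1 / \<epsilon>; the bound is the same for all horizons. The factor pi is
  the area of the unit disc.\<close>

lemma energy_le_of_increments:
  assumes v: "sq_integrable v" and C: "C \<ge> 0"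
    and inc: "\<And>\<zeta>. \<zeta> \<noteq> 0 \<Longrightarrow> (\<integral>\<^sup>+x. ennreal (f (max 0 ((v (x + \<zeta>) - v x)\<^sup>2 / norm \<zeta>))) \<partial>lborel) \<le> ennreal (C * norm \<zeta>)"
  shows "bm.energy v \<le> M * C * pi"
proof -
  note [measurable] = sq_integrableD(1)[OF v]
  have M: "M \<ge> 0" by (rule bm.M_nonneg)
  have "ennreal (\<epsilon> * bm.energy v) = (\<integral>\<^sup>+\<xi>. \<integral>\<^sup>+x. ennreal (bm.dens v \<xi> x) \<partial>lborel \<partial>lborel)"
    by (rule nn_integral_dens(2)[OF v, symmetric])
  also have "\<dots> \<le> (\<integral>\<^sup>+\<xi>. ennreal (M * C * \<epsilon>) * indicator (ball (0::real^2) 1) \<xi> \<partial>lborel)"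
  proof (rule nn_integral_mono)
    fix \<xi> :: "real^2"
    show "(\<integral>\<^sup>+x. ennreal (bm.dens v \<xi> x) \<partial>lborel) \<le> ennreal (M * C * \<epsilon>) * indicator (ball (0::real^2) 1) \<xi>"
    proof (cases "norm \<xi> < 1 \<and> \<xi> \<noteq> 0")
      case True
      have "(\<integral>\<^sup>+x. ennreal (bm.dens v \<xi> x) \<partial>lborel)
          = (\<integral>\<^sup>+x. ennreal (j \<xi>) * ennreal (f (max 0 ((v (x + \<epsilon> *\<^sub>R \<xi>) - v x)\<^sup>2 / norm (\<epsilon> *\<^sub>R \<xi>)))) \<partial>lborel)"
        using \<epsilon> by (intro nn_integral_cong)
          (simp add: bm.dens_def bm.bdiff_def j(2) nonneg flip: ennreal_mult)
      also have "\<dots> = ennreal (j \<xi>) * (\<integral>\<^sup>+x. ennreal (f (max 0 ((v (x + \<epsilon> *\<^sub>R \<xi>) - v x)\<^sup>2 / norm (\<epsilon> *\<^sub>R \<xi>)))) \<partial>lborel)"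
        by (rule nn_integral_cmult) measurable
      also have "\<dots> \<le> ennreal M * ennreal (C * norm (\<epsilon> *\<^sub>R \<xi>))"
        using True \<epsilon> by (intro mult_mono ennreal_leI j(3) inc) auto
      also have "\<dots> = ennreal (M * (C * (\<epsilon> * norm \<xi>)))"
        using M C \<epsilon> by (simp add: ennreal_mult)
      also have "\<dots> \<le> ennreal (M * (C * (\<epsilon> * 1)))"
        using True M C \<epsilon> by (intro ennreal_leI mult_left_mono) auto
      finally show ?thesis using True by (simp add: mult.assoc)
    next
      case False
      then have "bm.dens v \<xi> x = 0" for x
        using at_0 j(4)[of \<xi>] by (cases "\<xi> = 0") (auto simp: bm.dens_def)
      then show ?thesis by simp
    qed
  qed
  also have "\<dots> = ennreal (M * C * \<epsilon> * pi)"
    using M C \<epsilon> by (simp add: nn_integral_cmult_indicator emeasure_ball unit_ball_vol_2 ennreal_mult)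
  finally have "\<epsilon> * bm.energy v \<le> \<epsilon> * (M * C * pi)"
    using M C \<epsilon> by (simp add: ennreal_le_iff mult_ac)
  then show ?thesis using \<epsilon> by simp
qed

text \<open>The substitution y = x + \<epsilon> \<xi> absorbs the factor 1 / \<epsilon>^2 and
  expresses the fraction through the same bonds as the energy.\<close>

lemma weighted_area_fraction_eq:
  assumes D: "open D" and \<alpha>: "\<epsilon> < \<alpha>" and w: "borel_version \<alpha> D w v"
  shows "AE x in lborel. x \<in> D \<longrightarrow> weighted_area_fraction J \<epsilon> x (unstable_subset rbar \<epsilon> w x) =
    1 / J_moment J * (\<integral>\<xi>. of_bool (sqrt (\<epsilon> * norm \<xi>) * rbar < \<bar>v (x + \<epsilon> *\<^sub>R \<xi>) - v x\<bar>) * (norm \<xi> * j \<xi>) \<partial>lborel)"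
proof -
  have v: "v \<in> borel_measurable borel" and wv: "AE x in lborel. x \<in> nbhd \<alpha> D \<longrightarrow> w x = v x"
    using w unfolding borel_version_def by auto
  note [measurable] = v j(1)
  show ?thesis
    using wv
  proof eventually_elim
    case (elim x)
    show ?case
    proof
      assume x: "x \<in> D"
      have wx: "w x = v x" using elim x subset_nbhd[of \<alpha> D] \<alpha> \<epsilon> by auto
      let ?I = "\<lambda>y. indicator (ball x \<epsilon>) y *\<^sub>R (indicator (unstable_subset rbar \<epsilon> w x) y * norm ((y - x) /\<^sub>R \<epsilon>) * J (norm ((y - x) /\<^sub>R \<epsilon>)))"
      let ?R = "\<lambda>y. of_bool (sqrt (norm (y - x)) * rbar < \<bar>v y - v x\<bar>) * (norm ((y - x) /\<^sub>R \<epsilon>) * j ((y - x) /\<^sub>R \<epsilon>))"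
      have "AE y in lborel. - ((1/\<epsilon>) *\<^sub>R x) + (1/\<epsilon>) *\<^sub>R y \<in> ball 0 1 \<longrightarrow>
          J (norm (- ((1/\<epsilon>) *\<^sub>R x) + (1/\<epsilon>) *\<^sub>R y)) = j (- ((1/\<epsilon>) *\<^sub>R x) + (1/\<epsilon>) *\<^sub>R y)"
        by (rule AE_lborel_affine[OF j(5)]) (use \<epsilon> in simp)
      moreover have "- ((1/\<epsilon>) *\<^sub>R x) + (1/\<epsilon>) *\<^sub>R y = (y - x) /\<^sub>R \<epsilon>" for y
        by (simp add: divide_inverse scaleR_diff_right)
      ultimately have "AE y in lborel. (y - x) /\<^sub>R \<epsilon> \<in> ball 0 1 \<longrightarrow> J (norm ((y - x) /\<^sub>R \<epsilon>)) = j ((y - x) /\<^sub>R \<epsilon>)"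
        by (simp only:)
      with wv have ae: "AE y in lborel. ?I y = ?R y"
      proof eventually_elim
        case (elim y)
        have n: "norm ((y - x) /\<^sub>R \<epsilon>) = norm (y - x) / \<epsilon>" using \<epsilon> by (simp add: divide_inverse mult.commute)
        show ?case
        proof (cases "norm (y - x) < \<epsilon>")
          case True
          have yn: "y \<in> nbhd \<alpha> D" using in_nbhd[OF x, of "y - x" \<alpha>] True \<alpha> by simp
          have wy: "w y = v y" using elim(1) yn by simp
          have yb: "y \<in> ball x \<epsilon>" using True by (simp add: dist_norm norm_minus_commute)
          have "norm ((y - x) /\<^sub>R \<epsilon>) < 1" unfolding n using True \<epsilon> by simp
          then have Jj: "J (norm ((y - x) /\<^sub>R \<epsilon>)) = j ((y - x) /\<^sub>R \<epsilon>)" using elim(2) by simp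
          have "y \<in> unstable_subset rbar \<epsilon> w x \<longleftrightarrow> sqrt (norm (y - x)) * rbar < \<bar>v y - v x\<bar>"
            unfolding unstable_subset_def using yb wy wx by simp
          then show ?thesis using yb unfolding Jj by (simp add: indicator_def)
        next
          case False
          then have "norm ((y - x) /\<^sub>R \<epsilon>) \<ge> 1" unfolding n using \<epsilon> by simp
          moreover have "y \<notin> ball x \<epsilon>" using False by (simp add: dist_norm norm_minus_commute)
          ultimately show ?thesis by (simp add: j(4))
        qed
      qed
      have "(LINT y:ball x \<epsilon>|lebesgue. indicator (unstable_subset rbar \<epsilon> w x) y * norm ((y - x) /\<^sub>R \<epsilon>) * J (norm ((y - x) /\<^sub>R \<epsilon>)))
          = integral\<^sup>L lborel ?R"
        unfolding set_lebesgue_integral_def by (rule AE_eq_imp_integral_lebesgue_eq(1)[OF _ ae]) measurable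
      also have "\<dots> = \<epsilon>\<^sup>2 * (\<integral>\<xi>. ?R (x + \<epsilon> *\<^sub>R \<xi>) \<partial>lborel)"
        using integral_lborel_affine[of ?R \<epsilon> x] \<epsilon> by simp
      also have "(\<lambda>\<xi>. ?R (x + \<epsilon> *\<^sub>R \<xi>)) =
          (\<lambda>\<xi>. of_bool (sqrt (\<epsilon> * norm \<xi>) * rbar < \<bar>v (x + \<epsilon> *\<^sub>R \<xi>) - v x\<bar>) * (norm \<xi> * j \<xi>))"
        using \<epsilon> by (simp add: fun_eq_iff)
      finally show "weighted_area_fraction J \<epsilon> x (unstable_subset rbar \<epsilon> w x) =
        1 / J_moment J * (\<integral>\<xi>. of_bool (sqrt (\<epsilon> * norm \<xi>) * rbar < \<bar>v (x + \<epsilon> *\<^sub>R \<xi>) - v x\<bar>) * (norm \<xi> * j \<xi>) \<partial>lborel)"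
        unfolding weighted_area_fraction_def using \<epsilon> by simp
    qed
  qed
qed

text \<open>An unstable bond has its argument \<eta>^2 / (\<epsilon> |\<xi>|) above rbar^2, where
  the monotone \<open>f\<close> is at least f(rbar^2); the extra weight |\<xi>| is at most
  1.\<close>

lemma unstable_bond_le_dens:
  assumes rbar: "rbar > 0"
  shows "f (rbar\<^sup>2) * (of_bool (sqrt (\<epsilon> * norm \<xi>) * rbar < \<bar>v (x + \<epsilon> *\<^sub>R \<xi>) - v x\<bar>) * (norm \<xi> * j \<xi>)) \<le> bm.dens v \<xi> x"
proof (cases "sqrt (\<epsilon> * norm \<xi>) * rbar < \<bar>v (x + \<epsilon> *\<^sub>R \<xi>) - v x\<bar> \<and> norm \<xi> < 1 \<and> \<xi> \<noteq> 0")
  case True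
  let ?d = "v (x + \<epsilon> *\<^sub>R \<xi>) - v x"
  have c: "\<epsilon> * norm \<xi> > 0" using True \<epsilon> by simp
  have "(sqrt (\<epsilon> * norm \<xi>) * rbar)\<^sup>2 \<le> \<bar>?d\<bar>\<^sup>2"
    using True rbar c by (intro power_mono) auto
  then have "\<epsilon> * norm \<xi> * rbar\<^sup>2 \<le> ?d\<^sup>2" using c by (simp add: power_mult_distrib)
  then have "rbar\<^sup>2 \<le> ?d\<^sup>2 / (\<epsilon> * norm \<xi>)" using c by (simp add: pos_le_divide_eq mult.commute)
  then have "f (rbar\<^sup>2) \<le> f (?d\<^sup>2 / (\<epsilon> * norm \<xi>))" by (intro mono) auto
  then have "f (rbar\<^sup>2) * (norm \<xi> * j \<xi>) \<le> f (?d\<^sup>2 / (\<epsilon> * norm \<xi>)) * (1 * j \<xi>)"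
    using True j(2)[of \<xi>] nonneg[of "?d\<^sup>2 / (\<epsilon> * norm \<xi>)"] c by (intro mult_mono mult_right_mono) auto
  then show ?thesis using True c by (simp add: bm.dens_def bm.bdiff_def mult.commute)
next
  case False
  then have "of_bool (sqrt (\<epsilon> * norm \<xi>) * rbar < \<bar>v (x + \<epsilon> *\<^sub>R \<xi>) - v x\<bar>) * (norm \<xi> * j \<xi>) = 0"
    using j(4)[of \<xi>] by auto
  then show ?thesis using bm.dens_bounds(1)[of v \<xi> x] by (simp only: mult_zero_right)
qed

text \<open>The bondwise bound gives at most \<epsilon> E / (m f(rbar^2)) for the integral of the
  area fraction, with m = \<open>J_moment J\<close>; division by the threshold sqrt \<epsilon>
  leaves sqrt \<epsilon>.\<close>

lemma process_zone_step:
  assumes D: "open D" and \<alpha>: "\<epsilon> < \<alpha>" and w: "borel_version \<alpha> D w v" and v: "sq_integrable v"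
    and rbar: "rbar > 0" and moment: "J_moment J > 0" and E: "bm.energy v \<le> E"
  shows "{x \<in> D. weighted_area_fraction J \<epsilon> x (unstable_subset rbar \<epsilon> w x) > sqrt \<epsilon>} \<in> sets lebesgue"
    "emeasure lebesgue {x \<in> D. weighted_area_fraction J \<epsilon> x (unstable_subset rbar \<epsilon> w x) > sqrt \<epsilon>}
      \<le> ennreal (E / (J_moment J * f (rbar\<^sup>2)) * sqrt \<epsilon>)"
proof -
  note [measurable] = sq_integrableD(1)[OF v] j(1)
  define W where "W x = 1 / J_moment J * (\<integral>\<xi>. of_bool (sqrt (\<epsilon> * norm \<xi>) * rbar < \<bar>v (x + \<epsilon> *\<^sub>R \<xi>) - v x\<bar>) * (norm \<xi> * j \<xi>) \<partial>lborel)" for x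
  let ?Z = "{x \<in> D. weighted_area_fraction J \<epsilon> x (unstable_subset rbar \<epsilon> w x) > sqrt \<epsilon>}"
  define Z where "Z = {x \<in> D. W x > sqrt \<epsilon>}"
  have [measurable]: "D \<in> sets borel" using D by simp
  have W_meas [measurable]: "W \<in> borel_measurable borel"
    unfolding W_def[abs_def] by measurable
  have Z: "Z \<in> sets borel" unfolding Z_def by measurable
  have Z': "Z \<in> sets lebesgue" using Z by simp
  \<comment> \<open>The set agrees with the Borel set \<open>Z\<close> only almost everywhere;
    completeness of Lebesgue measure makes it measurable.\<close>
  have ae: "AE x in lebesgue. x \<in> ?Z \<longleftrightarrow> x \<in> Z"
    unfolding AE_lebesgue_iff
    using weighted_area_fraction_eq[OF D \<alpha> w, of rbar] by eventually_elim (auto simp: Z_def W_def)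
  have "{x. \<not> (x \<in> ?Z \<longleftrightarrow> x \<in> Z)} \<in> null_sets lebesgue"
    using ae unfolding completion.AE_iff_null_sets by simp
  then have "negligible ((Z - ?Z) \<union> (?Z - Z))"
    unfolding negligible_iff_null_sets by (rule completion.complete2[rotated]) auto
  then show sets: "?Z \<in> sets lebesgue" using sets_negligible_symdiff[OF Z'] by blast
  have m: "f (rbar\<^sup>2) > 0" using rbar by (intro pos) simp
  have "emeasure lebesgue ?Z = emeasure lebesgue Z"
    by (rule emeasure_eq_AE[OF ae sets Z'])
  also have "\<dots> = emeasure lborel Z" using Z by simp
  also have "\<dots> \<le> emeasure lborel ({x \<in> UNIV. 1 \<le> ennreal (1 / sqrt \<epsilon>) * ennreal (W x)} \<inter> UNIV)"
  proof (rule emeasure_mono)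
    show "Z \<subseteq> {x \<in> UNIV. 1 \<le> ennreal (1 / sqrt \<epsilon>) * ennreal (W x)} \<inter> UNIV"
    proof
      fix x assume "x \<in> Z"
      then have "sqrt \<epsilon> < W x" by (simp add: Z_def)
      then have "1 \<le> 1 / sqrt \<epsilon> * W x" "0 \<le> W x" using \<epsilon> by (auto simp: field_simps) (smt (verit) real_sqrt_ge_zero)
      then have "ennreal 1 \<le> ennreal (1 / sqrt \<epsilon> * W x)" by (intro ennreal_leI)
      then show "x \<in> {x \<in> UNIV. 1 \<le> ennreal (1 / sqrt \<epsilon>) * ennreal (W x)} \<inter> UNIV"
        using \<open>0 \<le> W x\<close> \<epsilon> by (simp flip: ennreal_mult)
    qed
  qed measurable
  also have "\<dots> \<le> ennreal (1 / sqrt \<epsilon>) * (\<integral>\<^sup>+x. ennreal (W x) * indicator UNIV x \<partial>lborel)"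
    using nn_integral_Markov_inequality[of "\<lambda>x. ennreal (W x)" UNIV lborel "ennreal (1 / sqrt \<epsilon>)"] by simp
  also have "\<dots> \<le> ennreal (1 / sqrt \<epsilon>) * ennreal (1 / (J_moment J * f (rbar\<^sup>2)) * (\<epsilon> * E))"
  proof (rule mult_left_mono)
    let ?c = "1 / (J_moment J * f (rbar\<^sup>2))"
    have c: "?c \<ge> 0" using moment m by simp
    have "(\<integral>\<^sup>+x. ennreal (W x) * indicator UNIV x \<partial>lborel) \<le> (\<integral>\<^sup>+x. ennreal ?c * (\<integral>\<^sup>+\<xi>. ennreal (bm.dens v \<xi> x) \<partial>lborel) \<partial>lborel)"
    proof (rule nn_integral_mono)
      fix x
      let ?g = "\<lambda>\<xi>. of_bool (sqrt (\<epsilon> * norm \<xi>) * rbar < \<bar>v (x + \<epsilon> *\<^sub>R \<xi>) - v x\<bar>) * (norm \<xi> * j \<xi>)"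
      have g0: "?g \<xi> \<ge> 0" for \<xi> using j(2) by simp
      have "ennreal (W x) = ennreal (1 / J_moment J) * ennreal (norm (integral\<^sup>L lborel ?g))"
      proof -
        have "norm (integral\<^sup>L lborel ?g) = integral\<^sup>L lborel ?g" 
          unfolding real_norm_def by (intro abs_of_nonneg Bochner_Integration.integral_nonneg g0)
        then show ?thesis unfolding W_def using moment by (subst ennreal_mult'[symmetric]) simp_all
      qed
      also have "\<dots> \<le> ennreal (1 / J_moment J) * (\<integral>\<^sup>+\<xi>. ennreal (norm (?g \<xi>)) \<partial>lborel)"
        by (intro mult_left_mono norm_integral_le_nn_integral) simp
      also have "\<dots> \<le> ennreal (1 / J_moment J) * (\<integral>\<^sup>+\<xi>. ennreal (1 / f (rbar\<^sup>2)) * ennreal (bm.dens v \<xi> x) \<partial>lborel)"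
      proof (intro mult_left_mono nn_integral_mono)
        fix \<xi>
        have "?g \<xi> \<le> 1 / f (rbar\<^sup>2) * bm.dens v \<xi> x"
          using unstable_bond_le_dens[OF rbar, of \<xi> v x] m by (simp add: pos_le_divide_eq mult.commute)
        then show "ennreal (norm (?g \<xi>)) \<le> ennreal (1 / f (rbar\<^sup>2)) * ennreal (bm.dens v \<xi> x)"
          using g0[of \<xi>] m bm.dens_bounds(1)[of v \<xi> x] by (simp add: ennreal_leI flip: ennreal_mult)
      qed simp
      also have "\<dots> = ennreal (1 / J_moment J) * (ennreal (1 / f (rbar\<^sup>2)) * (\<integral>\<^sup>+\<xi>. ennreal (bm.dens v \<xi> x) \<partial>lborel))"
        by (subst nn_integral_cmult) simp_all
      also have "\<dots> = ennreal ?c * (\<integral>\<^sup>+\<xi>. ennreal (bm.dens v \<xi> x) \<partial>lborel)"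
        using moment m by (simp add: mult.assoc[symmetric] flip: ennreal_mult)
      finally show "ennreal (W x) * indicator UNIV x \<le> \<dots>" by simp
    qed
    also have "\<dots> = ennreal ?c * ennreal (\<epsilon> * bm.energy v)"
      by (subst nn_integral_cmult) (simp_all add: nn_integral_dens(1)[OF v])
    also have "\<dots> = ennreal (?c * (\<epsilon> * bm.energy v))"
      by (rule ennreal_mult'[OF c, symmetric])
    also have "\<dots> \<le> ennreal (?c * (\<epsilon> * E))"
      using c \<epsilon> E by (intro ennreal_leI mult_left_mono) auto
    finally show "(\<integral>\<^sup>+x. ennreal (W x) * indicator UNIV x \<partial>lborel) \<le> ennreal (?c * (\<epsilon> * E))" .
  qed simp
  also have "\<dots> = ennreal (E / (J_moment J * f (rbar\<^sup>2)) * sqrt \<epsilon>)"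
  proof -
    have "1 / sqrt \<epsilon> * (1 / (J_moment J * f (rbar\<^sup>2)) * (\<epsilon> * E)) = E / (J_moment J * f (rbar\<^sup>2)) * (\<epsilon> / sqrt \<epsilon>)"
      by (simp add: mult_ac)
    also have "\<epsilon> / sqrt \<epsilon> = sqrt \<epsilon>" using \<epsilon> by (intro real_div_sqrt) simp
    finally show ?thesis using \<epsilon> by (subst ennreal_mult'[symmetric]) simp_all
  qed
  finally show "emeasure lebesgue ?Z \<le> ennreal (E / (J_moment J * f (rbar\<^sup>2)) * sqrt \<epsilon>)" .
qed

end

section \<open>Uniform energy bound and the process zone\<close>

lemma L2_derivative_version:
  assumes w: "L2_derivative D T w w'"
    and U: "\<And>t. t \<in> {0..T} \<Longrightarrow> sq_integrable (U t)" "\<And>t x. t \<in> {0..T} \<Longrightarrow> x \<notin> D \<Longrightarrow> U t x = 0"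
      "\<And>t. t \<in> {0..T} \<Longrightarrow> AE x in lborel. x \<in> D \<longrightarrow> w t x = U t x"
    and U': "\<And>t. t \<in> {0..T} \<Longrightarrow> sq_integrable (U' t)" "\<And>t x. t \<in> {0..T} \<Longrightarrow> x \<notin> D \<Longrightarrow> U' t x = 0"
      "\<And>t. t \<in> {0..T} \<Longrightarrow> AE x in lborel. x \<in> D \<longrightarrow> w' t x = U' t x"
  shows "sq_has_derivative T U U'"
  unfolding sq_has_derivative_def
proof
  fix t assume t: "t \<in> {0..T}"
  have "((\<lambda>s. L2_norm D (\<lambda>x. (w s x - w t x) / (s - t) - w' t x)) \<longlongrightarrow> 0) (at t within {0..T})"
    using w t by (simp add: L2_derivative_def)
  moreover have "\<forall>\<^sub>F s in at t within {0..T}. L2_norm D (\<lambda>x. (w s x - w t x) / (s - t) - w' t x)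
      = sq_norm (\<lambda>x. (U s x - U t x) / (s - t) - U' t x)"
    unfolding eventually_at_filter
  proof (rule always_eventually, intro allI impI)
    fix s assume s: "s \<in> {0..T}"
    note [measurable] = sq_integrableD(1)[OF U(1)[OF s]] sq_integrableD(1)[OF U(1)[OF t]]
      sq_integrableD(1)[OF U'(1)[OF t]]
    show "L2_norm D (\<lambda>x. (w s x - w t x) / (s - t) - w' t x)
      = sq_norm (\<lambda>x. (U s x - U t x) / (s - t) - U' t x)"
    proof (rule L2_norm_eq_sq_norm(1))
      show "(U s x - U t x) / (s - t) - U' t x = 0" if "x \<notin> D" for x
        using that U(2) U'(2) s t by simp
      show "AE x in lborel. x \<in> D \<longrightarrow> (w s x - w t x) / (s - t) - w' t x = (U s x - U t x) / (s - t) - U' t x"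
        using U(3)[OF s] U(3)[OF t] U'(3)[OF t] by eventually_elim auto
    qed measurable
  qed
  ultimately show "((\<lambda>s. sq_norm (\<lambda>x. (U s x - U t x) / (s - t) - U' t x)) \<longlongrightarrow> 0) (at t within {0..T})"
    by (rule Lim_transform_eventually)
qed

lemma L2_versions:
  assumes w: "\<forall>t\<in>{0..T}. w t \<in> L2 D" and D: "open D"
  shows "\<exists>U. (\<forall>t\<in>{0..T}. sq_integrable (U t)) \<and> (\<forall>t x. x \<notin> D \<longrightarrow> U t x = 0) \<and>
    (\<forall>t\<in>{0..T}. AE x in lborel. x \<in> D \<longrightarrow> w t x = U t x)"
proof -
  have ex: "\<exists>v. (\<forall>x. x \<notin> D \<longrightarrow> v x = 0) \<and> sq_integrable v \<and> (AE x in lborel. x \<in> D \<longrightarrow> w t x = v x)"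
    if t: "t \<in> {0..T}" for t
  proof -
    obtain v where "\<And>x. x \<notin> D \<Longrightarrow> v x = 0" "AE x in lborel. x \<in> D \<longrightarrow> w t x = v x" "sq_integrable v"
      by (rule L2_version[OF bspec[OF w t] D]) (rule that)
    then show ?thesis by (intro exI[of _ v]) simp
  qed
  let ?P = "\<lambda>t v. (\<forall>x. x \<notin> D \<longrightarrow> v x = 0) \<and> sq_integrable v \<and> (AE x in lborel. x \<in> D \<longrightarrow> w t x = v x)"
  \<comment> \<open>The zero function as default makes the vanishing outside \<open>D\<close> hold
    for every \<open>t\<close>, also beyond the time interval.\<close>
  define U where "U t = (if t \<in> {0..T} then SOME v. ?P t v else (\<lambda>_. 0))" for t
  have U: "?P t (U t)" if "t \<in> {0..T}" for t
    using someI_ex[OF ex[OF that]] that by (simp add: U_def)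
  have "U t x = 0" if "x \<notin> D" for t x
    using U[of t] that by (cases "t \<in> {0..T}") (auto simp: U_def)
  then show ?thesis using U by (intro exI[of _ U]) auto
qed

text \<open>The load is differentiable, hence continuous in L^2, so its norm is bounded on the
  compact time interval.\<close>

lemma C1_L2_version:
  assumes b: "C1_L2 D T b" and D: "open D"
  obtains F B where "\<And>t. t \<in> {0..T} \<Longrightarrow> sq_integrable (F t)" "\<And>t. t \<in> {0..T} \<Longrightarrow> sq_norm (F t) \<le> B"
    "\<And>t. t \<in> {0..T} \<Longrightarrow> AE x in lborel. x \<in> D \<longrightarrow> b t x = F t x"
proof -
  obtain b' where "(\<forall>t\<in>{0..T}. b t \<in> L2 D \<and> b' t \<in> L2 D) \<and> L2_derivative D T b b' \<and> L2_continuous D T b'"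
    using b unfolding C1_L2_def ..
  then have b': "\<And>t. t \<in> {0..T} \<Longrightarrow> b t \<in> L2 D" "\<And>t. t \<in> {0..T} \<Longrightarrow> b' t \<in> L2 D" "L2_derivative D T b b'"
    by blast+
  have "\<forall>t\<in>{0..T}. b t \<in> L2 D" using b'(1) by blast
  from L2_versions[OF this D] obtain F where "(\<forall>t\<in>{0..T}. sq_integrable (F t)) \<and> (\<forall>t x. x \<notin> D \<longrightarrow> F t x = 0) \<and>
    (\<forall>t\<in>{0..T}. AE x in lborel. x \<in> D \<longrightarrow> b t x = F t x)" ..
  then have F: "\<And>t. t \<in> {0..T} \<Longrightarrow> sq_integrable (F t)" "\<And>t x. x \<notin> D \<Longrightarrow> F t x = 0"
    "\<And>t. t \<in> {0..T} \<Longrightarrow> AE x in lborel. x \<in> D \<longrightarrow> b t x = F t x" by blast+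
  have "\<forall>t\<in>{0..T}. b' t \<in> L2 D" using b'(2) by blast
  from L2_versions[OF this D] obtain F' where "(\<forall>t\<in>{0..T}. sq_integrable (F' t)) \<and> (\<forall>t x. x \<notin> D \<longrightarrow> F' t x = 0) \<and>
    (\<forall>t\<in>{0..T}. AE x in lborel. x \<in> D \<longrightarrow> b' t x = F' t x)" ..
  then have F': "\<And>t. t \<in> {0..T} \<Longrightarrow> sq_integrable (F' t)" "\<And>t x. x \<notin> D \<Longrightarrow> F' t x = 0"
    "\<And>t. t \<in> {0..T} \<Longrightarrow> AE x in lborel. x \<in> D \<longrightarrow> b' t x = F' t x" by blast+
  have "sq_has_derivative T F F'"
    by (rule L2_derivative_version[OF b'(3)]) (use F F' in auto)
  then have "continuous_on {0..T} (\<lambda>t. sq_norm (F t))"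
    by (intro sq_norm_continuous_on sq_has_derivative_imp_continuous[OF F(1) F'(1)] F(1))
  then have "bounded ((\<lambda>t. sq_norm (F t)) ` {0..T})"
    by (intro compact_imp_bounded compact_continuous_image) auto
  then obtain B where "\<forall>t\<in>{0..T}. sq_norm (F t) \<le> B"
    unfolding bounded_iff by auto
  then show ?thesis using F by (intro that[of F B]) auto
qed

context peridynamic_model
begin

text \<open>Passes from the evolution, given up to null sets, to a curve of Borel functions obeying
  the energy bound. The versions at time 0 are prescribed, so that the initial energies for all
  horizons refer to one representative.\<close>

lemma evolution_version:
  assumes D: "open D" and \<alpha>: "\<epsilon> < \<alpha>" and T: "T > 0" and \<rho>: "\<rho> > 0"
    and ev: "peridynamic_evolution \<alpha> D \<rho> J f T b u0 v0 \<epsilon> w"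
    and F: "\<And>t. t \<in> {0..T} \<Longrightarrow> sq_integrable (F t)" "\<And>t. t \<in> {0..T} \<Longrightarrow> sq_norm (F t) \<le> B"
      "\<And>t. t \<in> {0..T} \<Longrightarrow> AE x in lborel. x \<in> D \<longrightarrow> b t x = F t x"
    and a0: "sq_integrable a0" "\<And>x. x \<notin> D \<Longrightarrow> a0 x = 0" "AE x in lborel. x \<in> D \<longrightarrow> u0 x = a0 x"
    and a1: "sq_integrable a1" "\<And>x. x \<notin> D \<Longrightarrow> a1 x = 0" "AE x in lborel. x \<in> D \<longrightarrow> v0 x = a1 x"
    and t: "t \<in> {0..T}"
  shows "\<exists>v. borel_version \<alpha> D (w t) v \<and> sq_integrable v \<and>
    bm.energy v \<le> (\<rho> / 2 * (sq_norm a1)\<^sup>2 + bm.energy a0 + B\<^sup>2 / (2 * \<rho>) + 1) * exp (2 * T)"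
proof -
  obtain w1 w2 where W: "(\<forall>t\<in>{0..T}. w t \<in> L20 \<alpha> D \<and> w1 t \<in> L20 \<alpha> D \<and> w2 t \<in> L20 \<alpha> D) \<and>
      L2_derivative D T w w1 \<and> L2_derivative D T w1 w2 \<and> L2_continuous D T w2 \<and>
      (\<forall>t\<in>{0<..T}. AE x in lborel. x \<in> D \<longrightarrow> \<rho> * w2 t x = - grad_PD J f \<epsilon> (w t) x + b t x) \<and>
      (AE x in lborel. x \<in> D \<longrightarrow> w 0 x = u0 x) \<and> (AE x in lborel. x \<in> D \<longrightarrow> w1 0 x = v0 x)"
    using ev unfolding peridynamic_evolution_def AE_lebesgue_iff by (elim exE) (rule that)
  have w: "\<And>t. t \<in> {0..T} \<Longrightarrow> w t \<in> L20 \<alpha> D" "\<And>t. t \<in> {0..T} \<Longrightarrow> w1 t \<in> L20 \<alpha> D"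
      "\<And>t. t \<in> {0..T} \<Longrightarrow> w2 t \<in> L20 \<alpha> D"
    using W[THEN conjunct1] by blast+
  note W2 = W[THEN conjunct2]
  note dw = W2[THEN conjunct1] W2[THEN conjunct2, THEN conjunct1]
  note W3 = W2[THEN conjunct2, THEN conjunct2, THEN conjunct2]
  note eq = W3[THEN conjunct1, THEN bspec]
  note init = W3[THEN conjunct2, THEN conjunct1] W3[THEN conjunct2, THEN conjunct2]
  have versions: "\<exists>U. (\<forall>t x. x \<notin> D \<longrightarrow> U t x = 0) \<and> U 0 = a \<and> (\<forall>t\<in>{0..T}. borel_version \<alpha> D (z t) (U t) \<and> sq_integrable (U t))"
    if z: "\<And>t. t \<in> {0..T} \<Longrightarrow> z t \<in> L20 \<alpha> D" and a: "sq_integrable a" "\<And>x. x \<notin> D \<Longrightarrow> a x = 0"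
      "AE x in lborel. x \<in> D \<longrightarrow> z 0 x = a x" for z a
  proof -
    \<comment> \<open>At time 0 the version is forced to be the prescribed \<open>a\<close>; at
      other times of the interval any version serves.\<close>
    have "\<exists>v. (\<forall>x. x \<notin> D \<longrightarrow> v x = 0) \<and> (t = 0 \<longrightarrow> v = a) \<and> (t \<in> {0..T} \<longrightarrow> borel_version \<alpha> D (z t) v \<and> sq_integrable v)" for t
    proof -
      consider "t = 0" | "t \<noteq> 0" "t \<in> {0..T}" | "t \<notin> {0..T}" by blast
      then show ?thesis
      proof cases
        case 1
        have "borel_version \<alpha> D (z 0) a"
          using z[of 0] T a sq_integrableD(1)[OF a(1)] by (intro borel_version_extend) auto
        then show ?thesis using 1 a by blast
      next
        case 2
        obtain v where "borel_version \<alpha> D (z t) v" "sq_integrable v" using L20_version[OF z[OF 2(2)] D] by blast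
        then show ?thesis using 2 by (intro exI[of _ v]) (auto simp: borel_version_def)
      next
        case 3
        then show ?thesis using T by (intro exI[of _ "\<lambda>_. 0"]) auto
      qed
    qed
    from choice[OF allI[OF this]] obtain U where U: "\<forall>t. (\<forall>x. x \<notin> D \<longrightarrow> U t x = 0) \<and> (t = 0 \<longrightarrow> U t = a) \<and>
        (t \<in> {0..T} \<longrightarrow> borel_version \<alpha> D (z t) (U t) \<and> sq_integrable (U t))" ..
    show ?thesis by (rule exI[of _ U]) (use U in auto)
  qed
  have i0: "AE x in lborel. x \<in> D \<longrightarrow> w 0 x = a0 x" using init(1) a0(3) by eventually_elim auto
  have i1: "AE x in lborel. x \<in> D \<longrightarrow> w1 0 x = a1 x" using init(2) a1(3) by eventually_elim auto
  obtain U where "(\<forall>t x. x \<notin> D \<longrightarrow> U t x = 0) \<and> U 0 = a0 \<and>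
      (\<forall>t\<in>{0..T}. borel_version \<alpha> D (w t) (U t) \<and> sq_integrable (U t))"
    using versions[where z = w and a = a0, OF w(1) a0(1,2) i0] ..
  then have U: "\<And>t x. x \<notin> D \<Longrightarrow> U t x = 0" "U 0 = a0"
    "\<And>t. t \<in> {0..T} \<Longrightarrow> borel_version \<alpha> D (w t) (U t)"
    "\<And>t. t \<in> {0..T} \<Longrightarrow> sq_integrable (U t)"
    by blast+
  obtain U1 where "(\<forall>t x. x \<notin> D \<longrightarrow> U1 t x = 0) \<and> U1 0 = a1 \<and>
      (\<forall>t\<in>{0..T}. borel_version \<alpha> D (w1 t) (U1 t) \<and> sq_integrable (U1 t))"
    using versions[where z = w1 and a = a1, OF w(2) a1(1,2) i1] ..
  then have U1: "\<And>t x. x \<notin> D \<Longrightarrow> U1 t x = 0" "U1 0 = a1"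
    "\<And>t. t \<in> {0..T} \<Longrightarrow> borel_version \<alpha> D (w1 t) (U1 t)"
    "\<And>t. t \<in> {0..T} \<Longrightarrow> sq_integrable (U1 t)"
    by blast+
  have "\<forall>t\<in>{0..T}. w2 t \<in> L2 D" using w(3) by (simp add: L20_def)
  from L2_versions[OF this D] obtain U2 where "(\<forall>t\<in>{0..T}. sq_integrable (U2 t)) \<and> (\<forall>t x. x \<notin> D \<longrightarrow> U2 t x = 0) \<and>
    (\<forall>t\<in>{0..T}. AE x in lborel. x \<in> D \<longrightarrow> w2 t x = U2 t x)" ..
  then have U2: "\<And>t. t \<in> {0..T} \<Longrightarrow> sq_integrable (U2 t)" "\<And>t x. x \<notin> D \<Longrightarrow> U2 t x = 0"
    "\<And>t. t \<in> {0..T} \<Longrightarrow> AE x in lborel. x \<in> D \<longrightarrow> w2 t x = U2 t x" by blast+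
  have on_D: "AE x in lborel. x \<in> D \<longrightarrow> z x = v x" if "borel_version \<alpha> D z v" for z v
  proof -
    have "AE x in lborel. x \<in> nbhd \<alpha> D \<longrightarrow> z x = v x" using that by (simp add: borel_version_def)
    then show ?thesis by eventually_elim (use subset_nbhd[of \<alpha> D] \<alpha> \<epsilon> in auto)
  qed
  have "bm.energy (U t) \<le> (\<rho> / 2 * (sq_norm (U1 0))\<^sup>2 + bm.energy (U 0) + B\<^sup>2 / (2 * \<rho>) + 1) * exp (2 * T)"
  proof (rule bm.evolution_energy_bound[OF T \<rho> U(4) U1(4) U2(1) F(1,2) _ _ U(1) _ t])
    show "sq_has_derivative T U U1"
      by (rule L2_derivative_version[OF dw(1)]) (use U U1 on_D in auto)
    show "sq_has_derivative T U1 U2"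
      by (rule L2_derivative_version[OF dw(2)]) (use U1 U2 on_D in auto)
    fix s assume s: "0 < s" "s \<le> T"
    then have s': "s \<in> {0..T}" "s \<in> {0<..T}" by auto
    show "AE x in lborel. x \<in> D \<longrightarrow> \<rho> * U2 s x = - bm.grad (U s) x + F s x"
      using eq[OF s'(2)] grad_PD_eq[OF D \<alpha> U(3)[OF s'(1)]] U2(3)[OF s'(1)] F(3)[OF s'(1)]
      by eventually_elim auto
  qed
  then show ?thesis using U(3)[OF t] U(4)[OF t] unfolding U(2) U1(2) by blast
qed

end

section \<open>Summation over the dyadic horizons\<close>

text \<open>The area bounds form a geometric series of ratio sqrt (1/2) whose first term belongs to
  the largest admissible horizon, which is below \<delta>. Hence the factor 1 / (1 - sqrt (1/2)) and
  the power sqrt \<delta>.\<close>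

lemma geometric_process_zone_measure:
  assumes Z: "\<And>i. i \<ge> 1 \<Longrightarrow> Z i \<in> sets lebesgue"
    "\<And>i. i \<ge> 1 \<Longrightarrow> emeasure lebesgue (Z i) \<le> ennreal (c * sqrt (horizon i))" and c: "c \<ge> 0" and \<delta>: "\<delta> > 0"
  shows "(\<Union>i\<in>{i. 1 \<le> i \<and> horizon i < \<delta>}. Z i) \<in> lmeasurable"
    "measure lebesgue (\<Union>i\<in>{i. 1 \<le> i \<and> horizon i < \<delta>}. Z i) \<le> c / (1 - sqrt (1/2)) * sqrt \<delta>"
proof -
  let ?I = "{i. 1 \<le> i \<and> horizon i < \<delta>}" and ?U = "\<Union>i\<in>{i. 1 \<le> i \<and> horizon i < \<delta>}. Z i"
  have hpos: "horizon i > 0" for i by (simp add: horizon_def)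
  define q where "q = sqrt (1/2)"
  have q: "0 < q" "q < 1" unfolding q_def by auto
  have hq: "sqrt (horizon i) = q ^ i" for i unfolding horizon_def q_def by (rule real_sqrt_power)
  obtain n where n: "horizon n < \<delta>"
    using real_arch_pow_inv[of \<delta> "1/2"] \<delta> unfolding horizon_def by auto
  \<comment> \<open>Passing to the successor guards against index 0, which is not
    admissible.\<close>
  have "horizon (Suc n) \<le> horizon n" unfolding horizon_def by simp
  then have ex: "1 \<le> Suc n \<and> horizon (Suc n) < \<delta>" using n by simp
  define m where "m = (LEAST i. 1 \<le> i \<and> horizon i < \<delta>)"
  have m: "1 \<le> m" "horizon m < \<delta>" using LeastI[of "\<lambda>i. 1 \<le> i \<and> horizon i < \<delta>", OF ex] unfolding m_def by auto
  have m_le: "m \<le> i" if "i \<in> ?I" for i using that unfolding m_def by (auto intro: Least_le)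
  have sets: "?U \<in> sets lebesgue"
    by (rule sets.countable_UN') (auto intro: Z countable_Collect countableI_type)
  have sub: "?U \<subseteq> (\<Union>i. Z (i + m))"
  proof
    fix x assume "x \<in> ?U"
    then obtain i where i: "i \<in> ?I" "x \<in> Z i" by blast
    then have "x \<in> Z ((i - m) + m)" using m_le[OF i(1)] by simp
    then show "x \<in> (\<Union>i. Z (i + m))" by blast
  qed
  have "emeasure lebesgue ?U \<le> emeasure lebesgue (\<Union>i. Z (i + m))"
    by (rule emeasure_mono[OF sub]) (use Z m in \<open>auto intro!: sets.countable_UN\<close>)
  also have "\<dots> \<le> (\<Sum>i. emeasure lebesgue (Z (i + m)))"
    by (rule emeasure_subadditive_countably) (use Z m in auto)
  also have "\<dots> \<le> (\<Sum>i. ennreal (c * q ^ m * q ^ i))"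
  proof (rule suminf_le)
    fix i
    have "emeasure lebesgue (Z (i + m)) \<le> ennreal (c * sqrt (horizon (i + m)))" using Z(2) m by simp
    then show "emeasure lebesgue (Z (i + m)) \<le> ennreal (c * q ^ m * q ^ i)"
      unfolding hq by (simp add: power_add mult_ac)
  qed auto
  also have "\<dots> = ennreal (c * q ^ m * (1 / (1 - q)))"
    using q c by (intro suminf_ennreal_eq sums_mult geometric_sums) auto
  also have "\<dots> \<le> ennreal (c / (1 - q) * sqrt \<delta>)"
  proof (rule ennreal_leI)
    have "q ^ m \<le> sqrt \<delta>" unfolding hq[symmetric] using m by simp
    then have "c / (1 - q) * q ^ m \<le> c / (1 - q) * sqrt \<delta>" using c q by (intro mult_left_mono) auto
    then show "c * q ^ m * (1 / (1 - q)) \<le> c / (1 - q) * sqrt \<delta>" by simp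
  qed
  finally have bound: "emeasure lebesgue ?U \<le> ennreal (c / (1 - q) * sqrt \<delta>)" .
  show "?U \<in> lmeasurable"
    using sets bound by (intro fmeasurableI) (auto intro: le_less_trans)
  show "measure lebesgue ?U \<le> c / (1 - sqrt (1/2)) * sqrt \<delta>"
    using enn2real_mono[OF bound] c q \<delta> unfolding q_def[symmetric] by (simp add: measure_def)
qed

lemma process_zone_eq:
  "process_zone D J rbar u \<delta> t = (\<Union>i\<in>{i. 1 \<le> i \<and> horizon i < \<delta>}.
    {x \<in> D. weighted_area_fraction J (horizon i) x (unstable_subset rbar (horizon i) (u i t) x) > sqrt (horizon i)})"
  unfolding process_zone_def by auto

theorem theorem3:
  fixes D :: "(real^2) set" and \<alpha> \<rho> M T f0' f_inf rbar :: real
    and J f :: "real \<Rightarrow> real"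
    and u0 v0 :: "real^2 \<Rightarrow> real"
    and b :: "real \<Rightarrow> real^2 \<Rightarrow> real"
    and u :: "nat \<Rightarrow> real \<Rightarrow> real^2 \<Rightarrow> real"
  assumes D: "open D" "D \<noteq> {}" "convex D" "bounded D"
    and \<alpha>: "\<And>j. j \<ge> 1 \<Longrightarrow> horizon j < \<alpha>"
    and \<rho>: "\<rho> > 0"
    and J_meas: "J \<in> borel_measurable (lebesgue_on {0..})"
    and J_bounds: "\<And>r. 0 \<le> r \<Longrightarrow> r \<le> 1 \<Longrightarrow> 0 \<le> J r \<and> J r < M"
    and J_support: "\<And>r. r > 1 \<Longrightarrow> J r = 0"
    and J_moment: "J_moment J > 0"
    and f_pos: "\<And>r. r > 0 \<Longrightarrow> f r > 0"
    and f_smooth: "smooth_halfline f"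
    and f_concave: "concave_on {0..} f"
    and f_deriv0: "((\<lambda>r. f r / r) \<longlongrightarrow> f0') (at_right 0)"
      "(f has_real_derivative f0') (at 0 within {0..})" "f0' > 0"
    and f_infinity: "(f \<longlongrightarrow> f_inf) at_top"
    and inflection: "rbar > 0" "convex_on {0..rbar} (\<lambda>r. f (r\<^sup>2))"
      "concave_on {rbar..} (\<lambda>r. f (r\<^sup>2))"
    and T: "T > 0"
    and data: "LEFM_initial_data \<alpha> D J f0' f_inf u0 v0"
    and b: "C1_L2 D T b"
    and evolution: "\<And>j. j \<ge> 1 \<Longrightarrow>
      peridynamic_evolution \<alpha> D \<rho> J f T b u0 v0 (horizon j) (u j)"
  shows "(\<forall>t\<in>{0..T}. \<forall>\<delta>1>0. \<forall>\<delta>2\<ge>\<delta>1.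
            process_zone D J rbar u \<delta>1 t \<subseteq> process_zone D J rbar u \<delta>2 t)
       \<and> (\<exists>C>0. \<forall>t\<in>{0..T}. \<forall>\<delta>>0.
            process_zone D J rbar u \<delta> t \<in> lmeasurable \<and>
            measure lebesgue (process_zone D J rbar u \<delta> t) \<le> C * sqrt \<delta>)
       \<and> (\<forall>t\<in>{0..T}.
            process_zone0 D J rbar u t \<in> null_sets lebesgue \<and>
            measure lebesgue (process_zone0 D J rbar u t) = 0 \<and>
            ((\<lambda>\<delta>. measure lebesgue (process_zone D J rbar u \<delta> t))
               \<longlongrightarrow> measure lebesgue (process_zone0 D J rbar u t)) (at_right 0))"
proof -
  obtain F where "F 0 = f \<and> (\<forall>n. \<forall>r\<ge>0. (F n has_real_derivative F (Suc n) r) (at r within {0..}))"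
    using f_smooth unfolding smooth_halfline_def ..
  then have F: "F 0 = f" "\<And>n r. r \<ge> 0 \<Longrightarrow> (F n has_real_derivative F (Suc n) r) (at r within {0..})"
    by blast+
  interpret LEFM_potential f "F 1" f0' f_inf
  proof
    show "(f has_real_derivative F 1 r) (at r within {0..})" if "0 \<le> r" for r
      using F(2)[OF that, of 0] F(1) by simp
    show "continuous_on {0..} (F 1)"
      by (rule DERIV_continuous_on) (use F(2)[of _ 1] in auto)
  qed (fact f_pos f_concave f_deriv0 f_infinity)+
  obtain j where j: "j \<in> borel_measurable borel" "\<And>\<xi>. 0 \<le> j \<xi>" "\<And>\<xi>. j \<xi> \<le> M" "\<And>\<xi>. norm \<xi> \<ge> 1 \<Longrightarrow> j \<xi> = 0"
    "AE \<xi> in lborel. \<xi> \<in> ball 0 1 \<longrightarrow> J (norm \<xi>) = j (\<xi> :: real^2)"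
    by (rule ex_bond_kernel[of J M]) (auto simp: J_moment J_bounds intro: that)
  have hpos: "horizon i > 0" for i by (simp add: horizon_def)
  have pm: "peridynamic_model f (F 1) f0' f_inf J j (horizon i) M" for i
    by unfold_locales (use hpos f_deriv0(3) j in auto)
  have second: "(LINT r:{0..1}|lebesgue. r\<^sup>2 * J r) > 0"
    by (rule J_second_moment_pos[OF J_meas J_bounds J_moment])
  have mu: "LEFM_mu J f0' > 0" and Gc: "LEFM_Gc J f_inf > 0"
    using second f_deriv0(3) infinity_pos unfolding LEFM_mu_def LEFM_Gc_def by simp_all
  have u0: "u0 \<in> L20 \<alpha> D" "u0 \<in> SBV D" and v0: "v0 \<in> L20 \<alpha> D"
    and bd: "\<exists>K. AE x in lborel. x \<in> D \<longrightarrow> \<bar>u0 x\<bar> \<le> K"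
    and fin: "(\<integral>\<^sup>+x\<in>D. ennreal (LEFM_mu J f0' * (norm (approx_gradient u0 x))\<^sup>2) \<partial>lebesgue)
       + ennreal (LEFM_Gc J f_inf) * hausdorff1 (jump_set D u0) < \<infinity>"
    using data unfolding LEFM_initial_data_def AE_lebesgue_iff by auto
  have jump: "hausdorff1 (jump_set D u0) < \<infinity>"
  proof -
    have "ennreal (LEFM_Gc J f_inf) * hausdorff1 (jump_set D u0) < \<infinity>"
      using fin by (simp add: ennreal_add_less_top)
    then show ?thesis using Gc by (auto simp: ennreal_mult_less_top)
  qed
  \<comment> \<open>The positive factor \<open>LEFM_mu J f0'\<close> is divided out; measurability
    of the integrand comes from integrability of the approximate gradient.\<close>
  have grad: "(\<integral>\<^sup>+x. ennreal ((norm (approx_gradient u0 x))\<^sup>2) * indicator D x \<partial>lebesgue) < \<infinity>"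
  proof -
    let ?a = "(\<integral>\<^sup>+x\<in>D. ennreal (LEFM_mu J f0' * (norm (approx_gradient u0 x))\<^sup>2) \<partial>lebesgue)"
    have "ennreal ((norm (approx_gradient u0 x))\<^sup>2) * indicator D x
      = ennreal (1 / LEFM_mu J f0') * (ennreal (LEFM_mu J f0' * (norm (approx_gradient u0 x))\<^sup>2) * indicator D x)" for x
      using mu by (simp add: mult.assoc[symmetric] flip: ennreal_mult')
    moreover have "(\<lambda>x. ennreal (LEFM_mu J f0' * (norm (approx_gradient u0 x))\<^sup>2) * indicator D x) \<in> borel_measurable lebesgue"
    proof -
      have "(\<lambda>x. indicator D x *\<^sub>R approx_gradient u0 x) \<in> borel_measurable lebesgue"
        using u0(2) unfolding SBV_def set_integrable_def by auto
      then have "(\<lambda>x. ennreal (LEFM_mu J f0' * (norm (indicator D x *\<^sub>R approx_gradient u0 x))\<^sup>2)) \<in> borel_measurable lebesgue"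
        by measurable
      moreover have "ennreal (LEFM_mu J f0' * (norm (indicator D x *\<^sub>R approx_gradient u0 x))\<^sup>2)
        = ennreal (LEFM_mu J f0' * (norm (approx_gradient u0 x))\<^sup>2) * indicator D x" for x
        by (auto simp: indicator_def)
      ultimately show ?thesis by (simp only:)
    qed
    ultimately have "(\<integral>\<^sup>+x. ennreal ((norm (approx_gradient u0 x))\<^sup>2) * indicator D x \<partial>lebesgue)
        = ennreal (1 / LEFM_mu J f0') * ?a"
      by (simp only: nn_integral_cmult)
    also have "\<dots> < \<infinity>" using fin by (simp add: ennreal_mult_less_top ennreal_add_less_top)
    finally show ?thesis .
  qed
  obtain K where K: "AE x in lborel. x \<in> D \<longrightarrow> \<bar>u0 x\<bar> \<le> K" using bd by blast
  obtain a where a: "a \<in> borel_measurable borel" "\<And>x. x \<notin> D \<Longrightarrow> a x = 0"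
    "AE x in lborel. x \<in> D \<longrightarrow> u0 x = a x" "sq_integrable a"
    using L2_version[of u0 D] u0(1) D(1) by (auto simp: L20_def)
  \<comment> \<open>Clamping turns the essential bound on \<open>u0\<close> into a bound at every
    point; the absolute value spares a proof that \<open>K\<close> is nonnegative.\<close>
  define a0 where "a0 x = max (- \<bar>K\<bar>) (min \<bar>K\<bar> (a x))" for x
  have a0_meas: "a0 \<in> borel_measurable borel" using a(1) unfolding a0_def[abs_def] by measurable
  have a0_bd: "\<bar>a0 x\<bar> \<le> \<bar>K\<bar>" and a0_out: "x \<notin> D \<Longrightarrow> a0 x = 0" for x
    using a(2)[of x] unfolding a0_def by auto
  have a0_ae: "AE x in lborel. x \<in> D \<longrightarrow> u0 x = a0 x"
    using a(3) K by eventually_elim (auto simp: a0_def)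
  have a0_sq: "sq_integrable a0"
    unfolding sq_integrable_def
    using a0_meas L2_norm_eq_sq_norm(2)[OF a0_meas a0_out a0_ae] u0(1) by (simp add: L20_def L2_def)
  obtain a1 where a1: "\<And>x. x \<notin> D \<Longrightarrow> a1 x = 0" "AE x in lborel. x \<in> D \<longrightarrow> v0 x = a1 x" "sq_integrable a1"
    using L2_version[of v0 D] v0 D(1) by (auto simp: L20_def)
  \<comment> \<open>The growth bounds are A = \<open>f_inf\<close> and B =
    \<open>f0'\<close>.\<close>
  obtain C0 where C0: "C0 \<ge> 0" "\<And>\<zeta>. \<zeta> \<noteq> 0 \<Longrightarrow>
    (\<integral>\<^sup>+x. ennreal (f (max 0 ((a0 (x + \<zeta>) - a0 x)\<^sup>2 / norm \<zeta>))) \<partial>lborel) \<le> ennreal (C0 * norm \<zeta>)"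
    by (rule SBV_increment_bound[OF D u0(2) a0_meas a0_out a0_ae a0_bd grad jump measurable_extension(1), of f_inf f0'])
      (auto simp: at_0 le_infinity le_linear infinity_pos f_deriv0(3) max_absorb2)
  obtain G B where G: "\<And>t. t \<in> {0..T} \<Longrightarrow> sq_integrable (G t)" "\<And>t. t \<in> {0..T} \<Longrightarrow> sq_norm (G t) \<le> B"
    "\<And>t. t \<in> {0..T} \<Longrightarrow> AE x in lborel. x \<in> D \<longrightarrow> b t x = G t x"
    using C1_L2_version[OF b D(1)] by blast
  have M: "M \<ge> 0" using j(2,3) order_trans by blast
  \<comment> \<open>Free of the horizon: initial velocity and load are common to all evolutions, and
    the initial energy is replaced by its uniform bound.\<close>
  define E where "E = (\<rho> / 2 * (sq_norm a1)\<^sup>2 + M * C0 * pi + B\<^sup>2 / (2 * \<rho>) + 1) * exp (2 * T)"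
  have E: "E > 0" unfolding E_def using \<rho> M C0(1) by (intro mult_pos_pos add_nonneg_pos add_nonneg_nonneg) auto
  define c where "c = E / (J_moment J * f (rbar\<^sup>2))"
  have c: "c > 0" unfolding c_def using E J_moment f_pos[of "rbar\<^sup>2"] inflection(1) by simp
  define Z where "Z t i = {x \<in> D. weighted_area_fraction J (horizon i) x (unstable_subset rbar (horizon i) (u i t) x) > sqrt (horizon i)}" for t i
  have Z: "Z t i \<in> sets lebesgue" "emeasure lebesgue (Z t i) \<le> ennreal (c * sqrt (horizon i))"
    if t: "t \<in> {0..T}" and i: "i \<ge> 1" for t i
  proof -
    interpret peridynamic_model f "F 1" f0' f_inf J j "horizon i" M by (rule pm)
    have e0: "bm.energy a0 \<le> M * C0 * pi" by (rule energy_le_of_increments[OF a0_sq C0])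
    obtain v where v: "borel_version \<alpha> D (u i t) v" "sq_integrable v"
      and ev: "bm.energy v \<le> (\<rho> / 2 * (sq_norm a1)\<^sup>2 + bm.energy a0 + B\<^sup>2 / (2 * \<rho>) + 1) * exp (2 * T)"
      using evolution_version[OF D(1) \<alpha>[OF i] T \<rho> evolution[OF i] G a0_sq a0_out a0_ae a1(3,1,2) t] by blast
    have "bm.energy v \<le> E"
      unfolding E_def by (rule order_trans[OF ev]) (use e0 in \<open>intro mult_right_mono add_mono, auto\<close>)
    from process_zone_step[OF D(1) \<alpha>[OF i] v inflection(1) J_moment this]
    show "Z t i \<in> sets lebesgue" "emeasure lebesgue (Z t i) \<le> ennreal (c * sqrt (horizon i))"
      unfolding Z_def c_def by simp_all
  qed
  define C where "C = c / (1 - sqrt (1/2))"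
  have C: "C > 0" unfolding C_def using c by simp
  have mono: "process_zone D J rbar u \<delta>1 t \<subseteq> process_zone D J rbar u \<delta>2 t" if "\<delta>1 \<le> \<delta>2" for t \<delta>1 \<delta>2
    using that unfolding process_zone_def by force
  have zone: "process_zone D J rbar u \<delta> t \<in> lmeasurable"
    "measure lebesgue (process_zone D J rbar u \<delta> t) \<le> C * sqrt \<delta>" if "t \<in> {0..T}" "\<delta> > 0" for t \<delta>
    using geometric_process_zone_measure[of "Z t" c \<delta>, OF Z[OF that(1)] less_imp_le[OF c] that(2)]
    unfolding process_zone_eq Z_def C_def by auto
  have lim: "((\<lambda>\<delta>. measure lebesgue (process_zone D J rbar u \<delta> t)) \<longlongrightarrow> 0) (at_right 0)" if t: "t \<in> {0..T}" for t
  proof (rule tendsto_sandwich[OF _ _ tendsto_const])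
    have "((\<lambda>\<delta>. C * sqrt \<delta>) \<longlongrightarrow> C * sqrt 0) (at_right 0)" by (intro tendsto_intros)
    then show "((\<lambda>\<delta>. C * sqrt \<delta>) \<longlongrightarrow> 0) (at_right 0)" by simp
    show "\<forall>\<^sub>F \<delta> in at_right 0. measure lebesgue (process_zone D J rbar u \<delta> t) \<le> C * sqrt \<delta>"
      using eventually_at_right_less[of 0] by eventually_elim (rule zone(2)[OF t])
  qed simp
  \<comment> \<open>An uncountable intersection, contained in zones of arbitrarily small measure: it
    is null, and measurable by completeness.\<close>
  have null: "process_zone0 D J rbar u t \<in> null_sets lebesgue" if t: "t \<in> {0..T}" for t
    unfolding negligible_iff_null_sets[symmetric]
  proof (rule negligible_outer_le[THEN iffD2], intro allI impI)
    fix e :: real assume e: "e > 0"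
    \<comment> \<open>Solves C sqrt \<delta> = e.\<close>
    define \<delta> where "\<delta> = (e / C)\<^sup>2"
    have \<delta>: "\<delta> > 0" "C * sqrt \<delta> = e" using e C unfolding \<delta>_def by auto
    show "\<exists>S. process_zone0 D J rbar u t \<subseteq> S \<and> S \<in> lmeasurable \<and> measure lebesgue S \<le> e"
      using zone[OF t \<delta>(1)] \<delta> unfolding process_zone0_def
      by (intro exI[of _ "process_zone D J rbar u \<delta> t"]) auto
  qed
  show ?thesis
    using mono zone C null lim measure_eq_0_null_sets[OF null] by auto
qed

end
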